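(* Let $\tau\in\mathbb{T}=\partial\mathbb{D}$. Let $\gamma:[0,\infty)\to\mathbb{R}^{\ge0}$ be a monotone increasing function with $\gamma(t)=O(t^2)$ as $t\to0$ such that $\sqrt{\gamma(t)}$ is a $\gamma$-augury. Let $\varphi:\mathbb{D}\to\overline{\mathbb{D}}$ be an analytic function. The following are equivalent: \begin{enumerate} \item $\varphi$ is transform $\gamma$-regular at $\tau$; \item for some $C,D>0$, $J_\varphi(z)$ is bounded on $S^{\sqrt{D\gamma(Ct)}}_{\tau}$ as $z\to\tau$; \item for some $C,D>0$, $\displaystyle\limsup_{t\to0}J_\varphi\big(\tau e^{-D\gamma(C|t|)+it}\big)<\infty$ (with $t$ real, $t\ne0$). \end{enumerate}
   Context: $\mathbb{D}$ is the open unit disk and $\Pi=\{z\in\mathbb{C}:\operatorname{Im} z>0\}$. For analytic $\varphi:\mathbb{D}\to\overline{\mathbb{D}}$ the Julia quotient is $J_\varphi(z)=\frac{1-|\varphi(z)|}{1-|z|}$. The Nevanlinna measure $\mu_f$ of an analytic $f:\Pi\to\overline\Pi$ is the positive Borel measure on $\mathbb{R}$ that is the weak limit, as $y\to0^+$, of the measures $\operatorname{Im} f(x+iy)\,dx$. For $\gamma$ monotone increasing and $O(t^2)$ as $t\to 0$ (with $\gamma(t)>0$ for $t>0$, and $1/0=+\infty$), $f$ is $\gamma$-regular at $\sigma\in\mathbb{R}$ if there is $C>0$ such that $t\mapsto\frac1{\gamma(C|t-\sigma|)}$ is integrable on a neighborhood of $\sigma$ with respect to $\mu_f$. $\varphi:\mathbb{D}\to\overline{\mathbb{D}}$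 is transform $\gamma$-regular at $\tau$ if there are conformal (Möbius) maps $\chi:\Pi\to\mathbb{D}$ and $\psi:\mathbb{D}\to\Pi$ (extended to the boundary) and $\sigma\in\mathbb{R}$ with $\chi(\sigma)=\tau$ such that $\psi\circ\varphi\circ\chi$ is $\gamma$-regular at $\sigma$. A function $\lambda:[0,\infty)\to\mathbb{R}^{\ge0}$ with $\lambda(t)=o(t)$ as $t\to0$ is a $\gamma$-augury if there is $C>0$ such that $\frac{t\lambda(Ct)\,\mathrm{d}\gamma(t)}{\gamma(t)^2}$ is integrable on $[0,1)$, where $\mathrm{d}\gamma$ is the distributional derivative of $\gamma$ (a positive measure). For $\lambda:[0,\infty)\to\mathbb{R}^{\ge0}$, the $\lambda$-Stolz region in $\mathbb{D}$ at $\tau$ is $S^\lambda_\tau=\{z\in\mathbb{D}:\ \text{for some } c>0,\ 1-|z|\ge\lambda(c)\text{ and }\sqrt{|z-\tau|^2-(1-|z|)^2}\le c\}$; $S_\tau^{\sqrt{D\gamma(Ct)}}$ means $\lambda(t)=\sqrt{D\gamma(Ct)}$. "Bounded on $S$ as $z\to\tau$" means bounded on the intersection of $S$ with some neighborhood of $\tau$.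
   Formalization: In the definition of a γ-augury, dγ(t)/γ(t)² is read as dγ(t)/(γ(t−)γ(t+)), i.e. −d(1/γ); this agrees with the original for continuous γ, but with γ(t)² taken literally at jumps of a right-continuous γ the claimed equivalence is false. *)

theory Defs
  imports "HOL-Analysis.Analysis" "HOL-Library.Landau_Symbols"
begin

abbreviation upper_half_plane :: "complex set" where
  "upper_half_plane \<equiv> {z. 0 < Im z}"

definition julia_quotient :: "(complex \<Rightarrow> complex) \<Rightarrow> complex \<Rightarrow> real" where
  "julia_quotient \<phi> z = (1 - norm (\<phi> z)) / (1 - norm z)"

text \<open>Functions on $[0,\infty)$ are total functions on the reals of which only the values on
  \<open>{0..}\<close> matter.\<close>

definition regularity_gauge :: "(real \<Rightarrow> real) \<Rightarrow> bool" where
  "regularity_gauge \<gamma> \<longleftrightarrow>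
     (\<forall>t\<ge>0. 0 \<le> \<gamma> t) \<and> (\<forall>t>0. 0 < \<gamma> t) \<and> mono_on {0..} \<gamma> \<and>
     \<gamma> \<in> O[at_right 0](\<lambda>t. t\<^sup>2)"

text \<open>The measures \<open>Im f(x + iy) dx\<close> may have infinite total mass, so weak convergence is tested
  against continuous functions of compact support, and the limit is locally finite. There is exactly
  one such limit when \<open>f\<close> is an analytic self-map of the upper half plane (boundary values allowed).\<close>

definition weak_limit :: "('a \<Rightarrow> real measure) \<Rightarrow> real measure \<Rightarrow> 'a filter \<Rightarrow> bool" where
  "weak_limit M \<mu> F \<longleftrightarrow>
     (\<forall>g :: real \<Rightarrow> real. continuous_on UNIV g \<and> compact (closure {x. g x \<noteq> 0}) \<longrightarrow>
        ((\<lambda>y. integral\<^sup>L (M y) g) \<longlongrightarrow> integral\<^sup>L \<mu> g) F)"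

definition is_nevanlinna_measure :: "(complex \<Rightarrow> complex) \<Rightarrow> real measure \<Rightarrow> bool" where
  "is_nevanlinna_measure f \<mu> \<longleftrightarrow>
     sets \<mu> = sets borel \<and> (\<forall>K. compact K \<longrightarrow> emeasure \<mu> K < \<infinity>) \<and>
     weak_limit (\<lambda>y. density lborel (\<lambda>x. ennreal (Im (f (Complex x y))))) \<mu> (at_right 0)"

definition nevanlinna_measure :: "(complex \<Rightarrow> complex) \<Rightarrow> real measure" where
  "nevanlinna_measure f = (THE \<mu>. is_nevanlinna_measure f \<mu>)"

text \<open>The quotient is taken in \<^typ>\<open>ennreal\<close>, where $1/0 = \infty$.\<close>

definition gamma_regular :: "(real \<Rightarrow> real) \<Rightarrow> (complex \<Rightarrow> complex) \<Rightarrow> real \<Rightarrow> bool" where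
  "gamma_regular \<gamma> f \<sigma> \<longleftrightarrow>
     (\<exists>C>0. \<exists>U. open U \<and> \<sigma> \<in> U \<and>
        (\<integral>\<^sup>+t\<in>U. 1 / ennreal (\<gamma> (C * \<bar>t - \<sigma>\<bar>)) \<partial>nevanlinna_measure f) < \<infinity>)"

text \<open>The condition \<open>c' * \<phi> z + d' \<noteq> 0\<close> says that the composite is finite valued. It can only fail
  when \<open>\<phi>\<close> is constant, equal to the point of the unit circle that \<open>\<psi>\<close> sends to infinity.\<close>

definition transform_gamma_regular :: "(real \<Rightarrow> real) \<Rightarrow> (complex \<Rightarrow> complex) \<Rightarrow> complex \<Rightarrow> bool" where
  "transform_gamma_regular \<gamma> \<phi> \<tau> \<longleftrightarrow>
     (\<exists>a b c d a' b' c' d' \<eta> \<psi> \<sigma>.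
        a * d - b * c \<noteq> 0 \<and> \<eta> = moebius a b c d \<and> \<eta> ` upper_half_plane = ball 0 1 \<and>
        a' * d' - b' * c' \<noteq> 0 \<and> \<psi> = moebius a' b' c' d' \<and> \<psi> ` ball 0 1 = upper_half_plane \<and>
        \<eta> (complex_of_real \<sigma>) = \<tau> \<and>
        (\<forall>z\<in>ball 0 1. c' * \<phi> z + d' \<noteq> 0) \<and>
        gamma_regular \<gamma> (\<psi> \<circ> \<phi> \<circ> \<eta>) \<sigma>)"

text \<open>The distributional derivative of \<open>\<gamma>\<close>, extended by 0 to the negative axis, is the
  Lebesgue-Stieltjes measure of its right-continuous modification.\<close>

definition deriv_measure :: "(real \<Rightarrow> real) \<Rightarrow> real measure" where
  "deriv_measure \<gamma> = interval_measure (\<lambda>t. if t < 0 then 0 else Lim (at_right t) \<gamma>)"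

text \<open>The weight $d\gamma/\gamma^2$ is read as the distributional derivative of $-1/\gamma$. Its density
  with respect to $d\gamma$ is $1/(\gamma(t-)\gamma(t+))$: a jump of \<open>\<gamma>\<close> from $a$ to $b$ has
  weight $1/a - 1/b = (b - a)/(ab)$, and where \<open>\<gamma>\<close> is continuous the density is $1/\gamma(t)^2$.
  Evaluating $\gamma(t)^2$ pointwise at the jumps would make the notion depend on the representative
  of \<open>\<gamma>\<close>, which the distributional derivative does not see.\<close>

definition gamma_augury :: "(real \<Rightarrow> real) \<Rightarrow> (real \<Rightarrow> real) \<Rightarrow> bool" where
  "gamma_augury \<gamma> l \<longleftrightarrow>
     (\<forall>t\<ge>0. 0 \<le> l t) \<and> l \<in> o[at_right 0](\<lambda>t. t) \<and>
     (\<exists>C>0. set_integrable (deriv_measure \<gamma>) {0..<1}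
        (\<lambda>t. t * l (C * t) / (Lim (at_left t) \<gamma> * Lim (at_right t) \<gamma>)))"

lemma gamma_augury_continuous:
  assumes "continuous_on {0..} \<gamma>"
  shows "gamma_augury \<gamma> l \<longleftrightarrow>
     (\<forall>t\<ge>0. 0 \<le> l t) \<and> l \<in> o[at_right 0](\<lambda>t. t) \<and>
     (\<exists>C>0. set_integrable (deriv_measure \<gamma>) {0..<1} (\<lambda>t. t * l (C * t) / (\<gamma> t)\<^sup>2))"
proof -
  have lims: "Lim (at_left t) \<gamma> = \<gamma> t \<and> Lim (at_right t) \<gamma> = \<gamma> t" if "t > 0" for t
  proof -
    have "isCont \<gamma> t"
      using continuous_on_interior[OF assms, of t] that by simp
    then have "(\<gamma> \<longlongrightarrow> \<gamma> t) (at t)" by (simp add: isCont_def)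
    then have "(\<gamma> \<longlongrightarrow> \<gamma> t) (at_left t)" "(\<gamma> \<longlongrightarrow> \<gamma> t) (at_right t)"
      by (auto simp: filterlim_at_split)
    then show ?thesis by (auto intro: tendsto_Lim)
  qed
  have "set_integrable (deriv_measure \<gamma>) {0..<1}
          (\<lambda>t. t * l (C * t) / (Lim (at_left t) \<gamma> * Lim (at_right t) \<gamma>)) \<longleftrightarrow>
        set_integrable (deriv_measure \<gamma>) {0..<1} (\<lambda>t. t * l (C * t) / (\<gamma> t)\<^sup>2)" for C
  proof (rule set_integrable_cong)
    fix t :: real assume "t \<in> {0..<1}"
    then show "t * l (C * t) / (Lim (at_left t) \<gamma> * Lim (at_right t) \<gamma>) = t * l (C * t) / (\<gamma> t)\<^sup>2"
      using lims[of t] by (cases "t = 0") (auto simp: power2_eq_square)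
  qed simp_all
  then show ?thesis unfolding gamma_augury_def by simp
qed

definition stolz_region :: "(real \<Rightarrow> real) \<Rightarrow> complex \<Rightarrow> complex set" where
  "stolz_region l \<tau> =
     {z \<in> ball 0 1. \<exists>c>0. 1 - norm z \<ge> l c \<and>
        sqrt ((norm (z - \<tau>))\<^sup>2 - (1 - norm z)\<^sup>2) \<le> c}"

end

theory Submission
  imports Defs "HOL-Complex_Analysis.Complex_Analysis" "HOL-Probability.Probability"
begin

text \<open>
  Transported to the half plane, with \<open>f = \<psi> \<circ> \<phi> \<circ> \<eta>\<close>, the Julia quotient is controlled from above by
  \<open>Im f(z) / Im z\<close>, and controls it if the pole of \<open>\<psi>\<close> is kept away from the values of \<open>\<phi>\<close>. By the Herglotz
  representation (theorem \<open>herglotz_half_plane\<close>, derived from a weak limit of Poisson integrals in the disc)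
  and the identification of the Nevanlinna measure \<open>\<mu>\<close> (theorem \<open>nevanlinna_measure_eq\<close>),
  \<open>Im f(z) / Im z\<close> is \<open>\<beta> + (1/\<pi>) \<integral> d\<mu>(s) / |s - z|\<^sup>2\<close>. The theorem then compares this integral with
  \<open>\<integral> d\<mu>(s) / \<gamma>(C|s - \<sigma>|)\<close> near \<open>\<sigma>\<close>.

  If the second integral is finite, then the first is bounded on the Stolz region, since there
  \<open>\<gamma>(C|s - \<sigma>|) = O(|s - z|\<^sup>2)\<close> uniformly in \<open>s\<close> (theorem \<open>regular_imp_bounded\<close>). This is why the profile of
  the region is the square root of a multiple of \<open>\<gamma>\<close>.

  The curve of the third condition runs at height \<open>D \<gamma>(C|t|)\<close>, far below the boundary \<open>sqrt(D' \<gamma>(C' t))\<close> of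
  the Stolz region if only \<open>D, D'\<close> are adjusted. The augury condition forces such fast decay of \<open>\<gamma>\<close> that
  \<open>\<gamma>(cu) = O(\<gamma>(u)\<^sup>2)\<close> for some \<open>c > 0\<close> (lemma \<open>augury_dominates_square\<close>), and so a change of the constant
  inside \<open>\<gamma>\<close> absorbs the square root: the curve lies in the region.

  Finally, let the quotient be bounded along the curve. With the height \<open>h(t) = D \<gamma>(C|t|)\<close> this bounds
  \<open>\<integral> d\<mu>(s) / (|s - t| + h(t))\<^sup>2\<close> uniformly in \<open>t\<close>, up to the parametrisation of the circle. Integration over
  \<open>t\<close> in an interval of length \<open>h(s)\<close> next to \<open>s\<close> turns this kernel into \<open>1/h(s)\<close>, which gives regularity
  (theorem \<open>bounded_on_curve_imp_regular\<close>).
\<close>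

section \<open>Monotone gauges and the augury condition\<close>

lemma mono_on_tendsto_at_right:
  fixes g :: "real \<Rightarrow> real"
  assumes mono: "mono_on {0..} g" and t: "0 \<le> t"
  shows "(g \<longlongrightarrow> Inf (g ` {t<..})) (at_right t)"
proof (rule order_tendstoI)
  have bdd: "bdd_below (g ` {t<..})"
    using mono t by (intro bdd_belowI2[of _ "g t"]) (auto simp: mono_on_def)
  {
    fix a assume "a < Inf (g ` {t<..})"
    then have "\<And>x. x > t \<Longrightarrow> a < g x"
      using cINF_lower[OF bdd] by (metis greaterThan_iff less_le_trans)
    then show "\<forall>\<^sub>F x in at_right t. a < g x"
      by (auto simp: eventually_at_filter)
  next
    fix a assume "Inf (g ` {t<..}) < a"
    then obtain u where u: "u > t" "g u < a"
      using cInf_lessD[of "g ` {t<..}" a] by auto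
    have "g x < a" if "t < x" "x < u" for x
    proof -
      have "g x \<le> g u" using mono t that by (auto simp: mono_on_def)
      then show ?thesis using u by simp
    qed
    then show "\<forall>\<^sub>F x in at_right t. g x < a"
      using u(1) by (auto simp: eventually_at_right_field)
  }
qed

lemma mono_on_tendsto_at_left:
  fixes g :: "real \<Rightarrow> real"
  assumes mono: "mono_on {0..} g" and t: "0 < t"
  shows "(g \<longlongrightarrow> Sup (g ` {0..<t})) (at_left t)"
proof (rule order_tendstoI)
  have bdd: "bdd_above (g ` {0..<t})"
    using mono t by (intro bdd_aboveI2[of _ _ "g t"]) (auto simp: mono_on_def)
  {
    fix a assume "Sup (g ` {0..<t}) < a"
    then have "g x < a" if "0 \<le> x" "x < t" for x
      using cSUP_upper[OF _ bdd, of x] that by auto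
    then show "\<forall>\<^sub>F x in at_left t. g x < a"
      using t by (auto simp: eventually_at_left_field intro!: exI[of _ 0])
  next
    fix a assume "a < Sup (g ` {0..<t})"
    then obtain u where u: "0 \<le> u" "u < t" "a < g u"
      using less_cSupD[of "g ` {0..<t}" a] t by auto
    have "a < g x" if "u < x" "x < t" for x
    proof -
      have "g u \<le> g x" using mono u that by (auto simp: mono_on_def)
      then show ?thesis using u by simp
    qed
    then show "\<forall>\<^sub>F x in at_left t. a < g x"
      using u(2) by (auto simp: eventually_at_left_field)
  }
qed

text \<open>The right-continuous modification of \<open>\<gamma>\<close>, extended by zero to the negative axis: the distribution
  function of \<open>d\<gamma>\<close>.\<close>

definition right_limit :: "(real \<Rightarrow> real) \<Rightarrow> real \<Rightarrow> real" where
  "right_limit \<gamma> t = (if t < 0 then 0 else Lim (at_right t) \<gamma>)"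

lemma deriv_measure_eq: "deriv_measure \<gamma> = interval_measure (right_limit \<gamma>)"
  by (simp add: deriv_measure_def right_limit_def[abs_def])

context
  fixes \<gamma> :: "real \<Rightarrow> real"
  assumes nonneg: "\<And>t. 0 \<le> t \<Longrightarrow> 0 \<le> \<gamma> t" and mono: "mono_on {0..} \<gamma>"
begin

lemma right_limit_eq: "0 \<le> t \<Longrightarrow> right_limit \<gamma> t = Inf (\<gamma> ` {t<..})"
  using tendsto_Lim[OF _ mono_on_tendsto_at_right[OF mono]] by (simp add: right_limit_def)

lemma right_limit_lower: "0 \<le> t \<Longrightarrow> \<gamma> t \<le> right_limit \<gamma> t"
  using mono by (auto simp: right_limit_eq mono_on_def intro!: cINF_greatest)

lemma right_limit_upper: "0 \<le> t \<Longrightarrow> t < u \<Longrightarrow> right_limit \<gamma> t \<le> \<gamma> u"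
  using mono by (auto simp: right_limit_eq mono_on_def intro!: cINF_lower bdd_belowI2[of _ "\<gamma> t"])

lemma mono_right_limit: "mono (right_limit \<gamma>)"
proof (rule monoI)
  fix x y :: real assume xy: "x \<le> y"
  consider "x < 0" "y < 0" | "x < 0" "0 \<le> y" | "0 \<le> x" "x = y" | "0 \<le> x" "x < y" using xy by linarith
  then show "right_limit \<gamma> x \<le> right_limit \<gamma> y"
  proof cases
    case 2
    then show ?thesis
      using nonneg[of y] right_limit_lower[of y] by (simp add: right_limit_def[of _ x])
  next
    case 4
    then show ?thesis
      using right_limit_lower[of y] right_limit_upper[of x y] by linarith
  qed (auto simp: right_limit_def)
qed

lemma continuous_right_limit: "continuous (at_right t) (right_limit \<gamma>)"
proof (cases "t < 0")
  case True
  have "\<forall>\<^sub>F x in at_right t. right_limit \<gamma> x = 0"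
    using True eventually_at_right_field[of _ t] by (auto simp: right_limit_def intro!: exI[of _ 0])
  then show ?thesis
    using True by (simp add: continuous_within right_limit_def[of _ t] tendsto_eventually)
next
  case False
  have "(right_limit \<gamma> \<longlongrightarrow> right_limit \<gamma> t) (at_right t)"
  proof (rule order_tendstoI)
    fix a assume "a < right_limit \<gamma> t"
    then show "\<forall>\<^sub>F x in at_right t. a < right_limit \<gamma> x"
      using monoD[OF mono_right_limit, of t]
      by (intro eventually_at_rightI[of t "t+1"]) (auto intro: less_le_trans)
  next
    fix a assume "right_limit \<gamma> t < a"
    then obtain u where u: "u > t" "\<gamma> u < a"
      using cInf_lessD[of "\<gamma> ` {t<..}" a] False by (auto simp: right_limit_eq)
    have "right_limit \<gamma> x < a" if "x \<in> {t<..<u}" for x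
      using right_limit_upper[of x u] that u False by auto
    then show "\<forall>\<^sub>F x in at_right t. right_limit \<gamma> x < a"
      by (rule eventually_at_rightI[OF _ u(1)])
  qed
  then show ?thesis by (simp add: continuous_within)
qed

lemma emeasure_deriv_measure:
  "a \<le> b \<Longrightarrow> emeasure (deriv_measure \<gamma>) {a<..b} = ennreal (right_limit \<gamma> b - right_limit \<gamma> a)"
  unfolding deriv_measure_eq
  by (intro emeasure_interval_measure_Ioc monoD[OF mono_right_limit] continuous_right_limit)

lemma left_limit_le:
  assumes "0 < t" "\<And>u. 0 \<le> u \<Longrightarrow> u < t \<Longrightarrow> \<gamma> u \<le> B"
  shows "Lim (at_left t) \<gamma> \<le> B"
proof -
  have "Lim (at_left t) \<gamma> = Sup (\<gamma> ` {0..<t})"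
    using tendsto_Lim[OF _ mono_on_tendsto_at_left[OF mono assms(1)]] by simp
  then show ?thesis using assms by (auto intro!: cSUP_least)
qed

lemma left_limit_ge:
  assumes "0 \<le> u" "u < t"
  shows "\<gamma> u \<le> Lim (at_left t) \<gamma>"
proof -
  have "bdd_above (\<gamma> ` {0..<t})"
    using mono by (intro bdd_aboveI2[of _ _ "\<gamma> t"]) (auto simp: mono_on_def)
  then have "\<gamma> u \<le> Sup (\<gamma> ` {0..<t})" using assms by (auto intro!: cSUP_upper)
  then show ?thesis
    using tendsto_Lim[OF _ mono_on_tendsto_at_left[OF mono, of t]] assms by simp
qed

text \<open>A bound from below for the tail near \<open>s\<close> of the weight \<open>d\<gamma>/\<gamma>\<^sup>2\<close>. Let \<open>g = \<gamma>(s+)\<close> and let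
  \<open>b\<close> be the point where \<open>\<gamma>\<close> first passes \<open>2g\<close>. On \<open>(s, b]\<close> the density \<open>1/(\<gamma>(t-) \<gamma>(t+))\<close> is at
  least \<open>1/(2g \<gamma>(b+))\<close>, and the interval has \<open>d\<gamma>\<close>-mass \<open>\<gamma>(b+) - g \<ge> \<gamma>(b+)/2\<close>, even if \<open>\<gamma>\<close>
  jumps at \<open>b\<close> to a value much larger than \<open>2g\<close>.\<close>

lemma weight_tail_lower:
  assumes pos: "\<And>t. 0 < t \<Longrightarrow> 0 < \<gamma> t"
    and s: "0 < s" "s < r" and r: "2 * right_limit \<gamma> s < right_limit \<gamma> r"
    and w: "0 \<le> w"
    and h: "\<And>t. s < t \<Longrightarrow> t \<le> r \<Longrightarrow> w \<le> h t"
  shows "ennreal (w / (4 * right_limit \<gamma> s)) \<le>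
    (\<integral>\<^sup>+t. ennreal (h t / (Lim (at_left t) \<gamma> * Lim (at_right t) \<gamma>)) * indicator {s<..r} t \<partial>deriv_measure \<gamma>)"
proof -
  let ?F = "right_limit \<gamma>"
  define g where "g = ?F s"
  have g: "0 < g" using pos[of s] right_limit_lower[of s] s by (simp add: g_def)
  define b where "b = Sup {t. s \<le> t \<and> ?F t \<le> 2 * g}"
  have ub: "t \<le> r" if "?F t \<le> 2 * g" for t
    using r monoD[OF mono_right_limit, of r t] that by (cases "r \<le> t") (auto simp: g_def)
  have bdd: "bdd_above {t. s \<le> t \<and> ?F t \<le> 2 * g}" using ub by (auto intro!: bdd_aboveI)
  have sin: "s \<in> {t. s \<le> t \<and> ?F t \<le> 2 * g}" using g by (simp add: g_def)
  have sb: "s \<le> b" unfolding b_def by (rule cSup_upper[OF sin bdd])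
  have br: "b \<le> r" unfolding b_def using sin ub by (intro cSup_least) auto
  have below: "?F t \<le> 2 * g" if tb: "t < b" "s \<le> t" for t
  proof -
    have "\<exists>u\<in>{t. s \<le> t \<and> ?F t \<le> 2 * g}. t < u"
      using sin tb(1) unfolding b_def by (intro less_cSupD) auto
    then obtain u where "t < u" "?F u \<le> 2 * g" by auto
    then show ?thesis using monoD[OF mono_right_limit, of t u] by linarith
  qed
  have Fb: "2 * g \<le> ?F b"
  proof (rule tendsto_lowerbound)
    show "(?F \<longlongrightarrow> ?F b) (at_right b)" using continuous_right_limit[of b] by (simp add: continuous_within)
    have "2 * g \<le> ?F t" if "t > b" for t
      using cSup_upper[OF _ bdd, of t] that sb unfolding b_def[symmetric] by (cases "?F t \<le> 2 * g") auto
    then show "\<forall>\<^sub>F t in at_right b. 2 * g \<le> ?F t"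
      by (auto simp: eventually_at_filter)
  qed simp
  have weight: "w / (2 * g * ?F b) \<le> h t / (Lim (at_left t) \<gamma> * Lim (at_right t) \<gamma>)" if t: "s < t" "t \<le> b" for t
  proof -
    have "Lim (at_left t) \<gamma> \<le> 2 * g"
    proof (rule left_limit_le)
      fix u assume u: "0 \<le> u" "u < t"
      show "\<gamma> u \<le> 2 * g"
      proof (cases "s \<le> u")
        case True
        then show ?thesis using below[of u] right_limit_lower[of u] u t by simp
      next
        case False
        then have "\<gamma> u \<le> \<gamma> s" using mono u by (auto simp: mono_on_def)
        then show ?thesis using right_limit_lower[of s] g s by (simp add: g_def)
      qed
    qed (use s t in simp)
    moreover have "0 < Lim (at_left t) \<gamma>" using left_limit_ge[of s t] pos[of s] s t by linarith
    moreover have R: "Lim (at_right t) \<gamma> = ?F t" using s t by (simp add: right_limit_def)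
    moreover have "?F t \<le> ?F b" using monoD[OF mono_right_limit] t by simp
    moreover have "0 < ?F t" using right_limit_lower[of t] pos[of t] s t by simp
    ultimately show ?thesis
      using h[of t] t br w by (auto intro!: frac_le mult_mono mult_pos_pos)
  qed
  have "w / (4 * g) \<le> w / (2 * g * ?F b) * (?F b - g)"
  proof -
    have "w / (4 * g) = w / (2 * g * ?F b) * (?F b / 2)" using g Fb by (simp add: field_simps)
    also have "\<dots> \<le> w / (2 * g * ?F b) * (?F b - g)"
      using Fb g w by (intro mult_left_mono) auto
    finally show ?thesis .
  qed
  then have "ennreal (w / (4 * g)) \<le> ennreal (w / (2 * g * ?F b)) * ennreal (?F b - g)"
    using Fb g w by (subst ennreal_mult[symmetric]) (auto intro!: ennreal_leI)
  also have "\<dots> = (\<integral>\<^sup>+t. ennreal (w / (2 * g * ?F b)) * indicator {s<..b} t \<partial>deriv_measure \<gamma>)"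
    using emeasure_deriv_measure[OF sb] by (subst nn_integral_cmult_indicator) (auto simp: g_def deriv_measure_eq)
  also have "\<dots> \<le> (\<integral>\<^sup>+t. ennreal (h t / (Lim (at_left t) \<gamma> * Lim (at_right t) \<gamma>)) * indicator {s<..r} t \<partial>deriv_measure \<gamma>)"
    using weight br by (intro nn_integral_mono) (auto simp: indicator_def intro!: ennreal_leI)
  finally show ?thesis by (simp add: g_def)
qed

end

lemma regularity_gaugeD:
  assumes "regularity_gauge \<gamma>"
  shows "\<And>t. 0 \<le> t \<Longrightarrow> 0 \<le> \<gamma> t" "\<And>t. 0 < t \<Longrightarrow> 0 < \<gamma> t" "mono_on {0..} \<gamma>"
    "\<And>s t. 0 \<le> s \<Longrightarrow> s \<le> t \<Longrightarrow> \<gamma> s \<le> \<gamma> t"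
    "\<gamma> \<in> O[at_right 0](\<lambda>t. t\<^sup>2)"
  using assms by (auto simp: regularity_gauge_def mono_on_def)

lemma regularity_gauge_quadratic:
  assumes "regularity_gauge \<gamma>"
  obtains M r where "0 < M" "0 < r" "\<And>t. 0 \<le> t \<Longrightarrow> t \<le> r \<Longrightarrow> \<gamma> t \<le> M * t\<^sup>2"
proof -
  obtain M where M: "M > 0" "\<forall>\<^sub>F t in at_right 0. norm (\<gamma> t) \<le> M * norm (t\<^sup>2)"
    using regularity_gaugeD(5)[OF assms] by (elim landau_o.bigE) blast
  then obtain r where r: "r > 0" "\<And>t. 0 < t \<Longrightarrow> t < r \<Longrightarrow> \<gamma> t \<le> M * t\<^sup>2"
    by (auto simp: eventually_at_right_field abs_le_iff)
  have zero: "\<gamma> 0 \<le> 0"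
  proof (rule tendsto_lowerbound)
    show "((\<lambda>t. M * t\<^sup>2) \<longlongrightarrow> 0) (at_right 0)" by (auto intro!: tendsto_eq_intros)
    show "\<forall>\<^sub>F t in at_right 0. \<gamma> 0 \<le> M * t\<^sup>2"
      using r regularity_gaugeD(4)[OF assms, of 0]
      by (auto simp: eventually_at_right_field intro!: exI[of _ r] order_trans[OF _ r(2)])
  qed simp
  have "\<gamma> t \<le> M * t\<^sup>2" if "0 \<le> t" "t \<le> r/2" for t
    using r(2)[of t] zero r(1) that by (cases "t = 0") auto
  then show thesis using that[of M "r/2"] M r by auto
qed

text \<open>The integrand of the augury condition carries the increasing factor \<open>t sqrt(\<gamma>(Ct))\<close>, and the weight
  to the right of \<open>s\<close> has mass at least \<open>1/(4 \<gamma>(s+))\<close>. Hence \<open>s sqrt(\<gamma>(Cs)) = O(\<gamma>(2s))\<close>.\<close>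

lemma augury_contracts:
  assumes reg: "regularity_gauge \<gamma>" and aug: "gamma_augury \<gamma> (\<lambda>t. sqrt (\<gamma> t))"
  obtains c L r where "0 < c" "c < 1" "0 < L" "0 < r"
    "\<And>u. 0 < u \<Longrightarrow> u \<le> r \<Longrightarrow> \<gamma> (c * u) \<le> L * (\<gamma> u)\<^sup>2 / u\<^sup>2"
proof -
  note \<gamma> = regularity_gaugeD[OF reg]
  let ?q = "\<lambda>t. Lim (at_left t) \<gamma> * Lim (at_right t) \<gamma>"
  obtain C where C: "C > 0" and int: "set_integrable (deriv_measure \<gamma>) {0..<1} (\<lambda>t. t * sqrt (\<gamma> (C * t)) / ?q t)"
    using aug by (auto simp: gamma_augury_def)
  define I where "I = (\<integral>\<^sup>+t. ennreal (t * sqrt (\<gamma> (C * t)) / ?q t) * indicator {0..<1} t \<partial>deriv_measure \<gamma>)"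
  have "I \<le> (\<integral>\<^sup>+t. ennreal (norm (indicator {0..<1} t *\<^sub>R (t * sqrt (\<gamma> (C * t)) / ?q t))) \<partial>deriv_measure \<gamma>)"
    unfolding I_def real_norm_def
    by (intro nn_integral_mono) (auto simp: indicator_def simp del: abs_mult abs_divide intro!: ennreal_leI abs_ge_self)
  also have "\<dots> < \<infinity>"
    using int by (simp add: set_integrable_def integrable_iff_bounded)
  finally obtain J where J: "J \<ge> 0" "I = ennreal J"
    by (metis ennreal_cases infinity_ennreal_def less_irrefl)
  have rl_half: "0 < right_limit \<gamma> (1/2)"
    using right_limit_lower[OF \<gamma>(1,3), of "1/2"] \<gamma>(2)[of "1/2"] by simp
  obtain M r0 where M: "0 < M" "0 < r0" "\<And>t. 0 \<le> t \<Longrightarrow> t \<le> r0 \<Longrightarrow> \<gamma> t \<le> M * t\<^sup>2"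
    using regularity_gauge_quadratic[OF reg] by blast
  have "((\<lambda>t. 2 * (M * (2 * t)\<^sup>2)) \<longlongrightarrow> 0) (at_right 0)" by (auto intro!: tendsto_eq_intros)
  then have "\<forall>\<^sub>F t in at_right 0. 2 * (M * (2 * t)\<^sup>2) < right_limit \<gamma> (1/2)"
    using rl_half order_tendstoD(2) by blast
  then obtain r1 where r1: "r1 > 0" "\<And>t. 0 < t \<Longrightarrow> t < r1 \<Longrightarrow> 2 * (M * (2 * t)\<^sup>2) < right_limit \<gamma> (1/2)"
    by (auto simp: eventually_at_right_field)
  define r where "r = min (r1/2) (min (r0/2) (1/4))"
  have r: "0 < r" "r < r1" "2 * r \<le> r0" "r < 1/2" using M r1 by (auto simp: r_def)
  have key: "\<gamma> (C * s) \<le> 16 * J\<^sup>2 * (\<gamma> (2 * s))\<^sup>2 / s\<^sup>2" if s: "0 < s" "s \<le> r" for s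
  proof -
    have rl_le: "right_limit \<gamma> s \<le> \<gamma> (2 * s)"
      using right_limit_upper[OF \<gamma>(1,3), of s "2 * s"] s by simp
    have small: "2 * right_limit \<gamma> s < right_limit \<gamma> (1/2)"
      using r1(2)[of s] M(3)[of "2 * s"] rl_le s r by simp
    have rl_pos: "0 < right_limit \<gamma> s"
      using right_limit_lower[OF \<gamma>(1,3), of s] \<gamma>(2)[of s] s by simp
    have "ennreal (s * sqrt (\<gamma> (C * s)) / (4 * right_limit \<gamma> s)) \<le>
      (\<integral>\<^sup>+t. ennreal (t * sqrt (\<gamma> (C * t)) / ?q t) * indicator {s<..1/2} t \<partial>deriv_measure \<gamma>)"
    proof (rule weight_tail_lower[OF \<gamma>(1,3,2), where h = "\<lambda>t. t * sqrt (\<gamma> (C * t))"])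
      show "0 \<le> s * sqrt (\<gamma> (C * s))" using s C \<gamma>(1)[of "C * s"] by simp
      show "s * sqrt (\<gamma> (C * s)) \<le> t * sqrt (\<gamma> (C * t))" if "s < t" for t
        using that s C \<gamma>(1)[of "C * s"] \<gamma>(4)[of "C * s" "C * t"] by (intro mult_mono) auto
    qed (use s r small in auto)
    also have "\<dots> \<le> I"
      unfolding I_def using s by (intro nn_integral_mono) (auto simp: indicator_def)
    finally have "s * sqrt (\<gamma> (C * s)) / (4 * right_limit \<gamma> s) \<le> J"
      using J by simp
    then have "s * sqrt (\<gamma> (C * s)) \<le> J * (4 * right_limit \<gamma> s)"
      using rl_pos by (simp add: divide_le_eq)
    also have "\<dots> \<le> J * (4 * \<gamma> (2 * s))" using rl_le J by (intro mult_left_mono) auto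
    finally have "(s * sqrt (\<gamma> (C * s)))\<^sup>2 \<le> (J * (4 * \<gamma> (2 * s)))\<^sup>2"
      using s \<gamma>(1)[of "C * s"] C by (intro power_mono) auto
    then have "s\<^sup>2 * \<gamma> (C * s) \<le> 16 * J\<^sup>2 * (\<gamma> (2 * s))\<^sup>2"
      using s C \<gamma>(1)[of "C * s"] by (simp add: power_mult_distrib)
    then show ?thesis using s by (simp add: field_simps)
  qed
  define c where "c = min (C/2) (1/2)"
  define L where "L = 64 * J\<^sup>2 + 1"
  have "\<gamma> (c * u) \<le> L * (\<gamma> u)\<^sup>2 / u\<^sup>2" if u: "0 < u" "u \<le> 2 * r" for u
  proof -
    have "c * u \<le> C * (u/2)" using u C by (auto simp: c_def min_def field_simps)
    moreover have "0 \<le> c * u" using u C by (auto simp: c_def)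
    ultimately have "\<gamma> (c * u) \<le> \<gamma> (C * (u/2))" using \<gamma>(4) by blast
    also have "\<dots> \<le> 16 * J\<^sup>2 * (\<gamma> u)\<^sup>2 / (u/2)\<^sup>2" using key[of "u/2"] u by simp
    also have "\<dots> = 64 * J\<^sup>2 * (\<gamma> u)\<^sup>2 / u\<^sup>2" using u by (simp add: field_simps)
    also have "\<dots> \<le> L * (\<gamma> u)\<^sup>2 / u\<^sup>2"
      by (intro divide_right_mono mult_right_mono) (auto simp: L_def)
    finally show ?thesis .
  qed
  moreover have "L > 0" by (simp add: L_def add_nonneg_pos)
  ultimately show thesis using that[of c L "2*r"] C r by (auto simp: c_def)
qed

text \<open>Since \<open>\<gamma>(s) = o(s\<^sup>2)\<close>, the estimate \<open>\<gamma>(cs) = O(\<gamma>(s)\<^sup>2/s\<^sup>2)\<close> makes \<open>\<gamma>(s)/s\<^sup>3\<close> nonincreasing under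
  \<open>s \<mapsto> cs\<close>, so that \<open>\<gamma>(s) = O(s\<^sup>3)\<close>. Applying the estimate twice then gives
  \<open>\<gamma>(c\<^sup>2 s) = O(\<gamma>(s)\<^sup>4/s\<^sup>6) = O(\<gamma>(s)\<^sup>2)\<close>.\<close>

lemma augury_dominates_square:
  assumes reg: "regularity_gauge \<gamma>" and aug: "gamma_augury \<gamma> (\<lambda>t. sqrt (\<gamma> t))"
  obtains c K r where "0 < c" "0 < K" "0 < r"
    "\<And>u. 0 < u \<Longrightarrow> u \<le> r \<Longrightarrow> \<gamma> (c * u) \<le> K * (\<gamma> u)\<^sup>2"
proof -
  note \<gamma> = regularity_gaugeD[OF reg]
  obtain c L r0 where c: "0 < c" "c < 1" and L: "0 < L" and r0: "0 < r0"
    and con: "\<And>u. 0 < u \<Longrightarrow> u \<le> r0 \<Longrightarrow> \<gamma> (c * u) \<le> L * (\<gamma> u)\<^sup>2 / u\<^sup>2"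
    using augury_contracts[OF assms] by blast
  \<comment> \<open>If \<open>\<gamma>(s) \<le> e\<^sup>2 s\<^sup>2\<close> for this \<open>e\<close>, then one step contracts \<open>\<gamma>\<close> by the factor \<open>c\<^sup>3\<close>.\<close>
  define e where "e = sqrt (c^3 / L)"
  have e: "e > 0" "L * e\<^sup>2 = c^3" using c L by (auto simp: e_def)
  have "(\<lambda>t. sqrt (\<gamma> t)) \<in> o[at_right 0](\<lambda>t. t)"
    using aug by (simp add: gamma_augury_def)
  from landau_o.smallD[OF this e(1)] obtain r1 where r1: "r1 > 0"
    "\<And>t. 0 < t \<Longrightarrow> t < r1 \<Longrightarrow> \<bar>sqrt (\<gamma> t)\<bar> \<le> e * \<bar>t\<bar>"
    by (auto simp: eventually_at_right_field)
  define r where "r = min r0 (r1/2)"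
  have r: "0 < r" "r \<le> r0" "r < r1" using r0 r1 by (auto simp: r_def)
  have quad: "\<gamma> t \<le> e\<^sup>2 * t\<^sup>2" if "0 < t" "t \<le> r" for t
  proof -
    have "\<bar>sqrt (\<gamma> t)\<bar>\<^sup>2 \<le> (e * \<bar>t\<bar>)\<^sup>2" using r1(2)[of t] that r by (intro power_mono) auto
    then show ?thesis using \<gamma>(1)[of t] that by (simp add: power_mult_distrib)
  qed
  have geo: "\<gamma> (c * u) \<le> c^3 * \<gamma> u" if u: "0 < u" "u \<le> r" for u
  proof -
    have "\<gamma> (c * u) \<le> L * (\<gamma> u * \<gamma> u) / u\<^sup>2" using con[of u] u r by (simp add: power2_eq_square)
    also have "\<dots> \<le> L * (\<gamma> u * (e\<^sup>2 * u\<^sup>2)) / u\<^sup>2"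
      using quad[OF u] \<gamma>(1)[of u] u L by (intro divide_right_mono mult_left_mono) auto
    also have "\<dots> = (L * e\<^sup>2) * \<gamma> u" using u by simp
    finally show ?thesis by (simp add: e)
  qed
  define B where "B = \<gamma> r / (c * r)^3"
  have B: "B > 0" using c r \<gamma>(2)[of r] by (simp add: B_def)
  have top: "\<gamma> u \<le> B * u^3" if u: "c * r < u" "u \<le> r" for u
  proof -
    have u0: "0 < u" using u c r by (meson less_trans mult_pos_pos)
    have "\<gamma> u \<le> B * (c * r)^3" using \<gamma>(4)[of u r] u u0 c r by (simp add: B_def)
    also have "\<dots> \<le> B * u^3" using B u c r by (intro mult_left_mono power_mono) auto
    finally show ?thesis .
  qed
  have cubic_step: "\<forall>u. c^n * (c * r) < u \<and> u \<le> r \<longrightarrow> \<gamma> u \<le> B * u^3" for n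
  proof (induction n)
    case 0
    then show ?case using top by simp
  next
    case (Suc n)
    show ?case
    proof (intro allI impI)
      fix u assume u: "c ^ Suc n * (c * r) < u \<and> u \<le> r"
      show "\<gamma> u \<le> B * u^3"
      proof (cases "c * r < u")
        case False
        then have "c^n * (c * r) < u/c" "u/c \<le> r" using u c by (simp_all add: field_simps)
        then have IH: "\<gamma> (u/c) \<le> B * (u/c)^3" using Suc by blast
        have "0 < u/c" using \<open>c^n * (c * r) < u/c\<close> c r by (meson less_trans mult_pos_pos zero_less_power)
        then have "\<gamma> u \<le> c^3 * \<gamma> (u/c)" using geo[of "u/c"] \<open>u/c \<le> r\<close> c by simp
        also have "\<dots> \<le> c^3 * (B * (u/c)^3)" using IH c by (intro mult_left_mono) auto
        also have "\<dots> = B * u^3" using c by (simp add: field_simps)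
        finally show ?thesis .
      qed (use top u in blast)
    qed
  qed
  have cubic: "\<gamma> u \<le> B * u^3" if u: "0 < u" "u \<le> r" for u
  proof -
    have "(\<lambda>n. c^n * (c * r)) \<longlonglongrightarrow> 0 * (c * r)"
      using c by (intro tendsto_mult_right LIMSEQ_power_zero) auto
    then have "\<forall>\<^sub>F n in sequentially. c^n * (c * r) < u" using u order_tendstoD(2) by fastforce
    then show ?thesis using cubic_step u by (auto simp: eventually_sequentially)
  qed
  define K where "K = L * L\<^sup>2 * B\<^sup>2 / c\<^sup>2"
  have "\<gamma> ((c * c) * u) \<le> K * (\<gamma> u)\<^sup>2" if u: "0 < u" "u \<le> r" for u
  proof -
    have cu: "0 < c * u" "c * u \<le> r" using u c mult_left_le_one_le[of u c] order_trans[of "c * u" u r] by simp_all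
    have "\<gamma> (c * (c * u)) \<le> L * (\<gamma> (c * u))\<^sup>2 / (c * u)\<^sup>2"
      using con[of "c * u"] cu r by simp
    also have "\<dots> \<le> L * (L * (\<gamma> u)\<^sup>2 / u\<^sup>2)\<^sup>2 / (c * u)\<^sup>2"
      using con[of u] u r L cu \<gamma>(1)[of "c*u"] by (intro divide_right_mono mult_left_mono power_mono) auto
    also have "\<dots> = L * L\<^sup>2 / c\<^sup>2 * (\<gamma> u)\<^sup>2 * (\<gamma> u / u^3)\<^sup>2"
      using u c by (simp add: field_simps power_mult_distrib eval_nat_numeral)
    also have "\<dots> \<le> L * L\<^sup>2 / c\<^sup>2 * (\<gamma> u)\<^sup>2 * B\<^sup>2"
      using cubic[OF u] u \<gamma>(1)[of u] L by (intro mult_left_mono power_mono) (auto simp: field_simps)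
    finally show ?thesis by (simp add: K_def mult_ac)
  qed
  then show thesis using that[of "c * c" K r] c L B r by (simp add: K_def)
qed

section \<open>Moebius maps and the Schwarz--Pick lemma\<close>

lemma cmod_add_power2: "(cmod (x + y))\<^sup>2 = (cmod x)\<^sup>2 + 2 * Re (x * cnj y) + (cmod y)\<^sup>2"
  unfolding cmod_power2 by (simp add: power2_eq_square algebra_simps)

lemma moebius_inj:
  assumes "a * d - b * c \<noteq> (0::complex)" "c * z + d \<noteq> 0" "c * w + d \<noteq> 0"
    and "moebius a b c d z = moebius a b c d w"
  shows "z = w"
  using moebius_inverse[of a d b c z] moebius_inverse[of a d b c w] assms
  by (metis eq_iff_diff_eq_0)

text \<open>The library function \<open>moebius\<close> has the value \<open>0\<close> at a pole, so a pole inside the half plane is not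
  excluded at once by the image being the disc; it is excluded because the map is unbounded near it.\<close>

lemma moebius_half_plane_disc_no_pole:
  assumes det: "a * d - b * c \<noteq> (0::complex)"
    and img: "moebius a b c d ` upper_half_plane = ball 0 1" and z: "Im z > 0"
  shows "c * z + d \<noteq> 0"
proof
  assume pole: "c * z + d = 0"
  have c: "c \<noteq> 0" using det pole by auto
  have "cmod (a * z + b) \<le> h * (cmod c + cmod a)" if h: "h > 0" for h
  proof -
    let ?w = "z + \<i> * of_real h"
    have w: "c * ?w + d = c * (\<i> * of_real h)" using pole by (simp add: algebra_simps)
    have "moebius a b c d ?w \<in> ball 0 1"
      unfolding img[symmetric] using z h by (intro imageI) simp
    then have "cmod (a * ?w + b) < cmod c * h"
      using c h by (simp add: moebius_def w norm_divide norm_mult divide_less_eq)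
    moreover have "cmod (a * z + b) \<le> cmod (a * ?w + b) + cmod (a * (\<i> * of_real h))"
      using norm_triangle_ineq4[of "a * ?w + b" "a * (\<i> * of_real h)"] by (simp add: algebra_simps)
    ultimately show ?thesis using h by (simp add: norm_mult algebra_simps)
  qed
  then have "cmod (a * z + b) \<le> 0"
    by (intro tendsto_lowerbound[of "\<lambda>h. h * (cmod c + cmod a)" 0 "at_right 0"])
       (auto intro!: tendsto_eq_intros simp: eventually_at_filter)
  then have "a * z = - b" "c * z = - d" using pole by (auto simp: eq_neg_iff_add_eq_0)
  then have "(a * d - b * c) = - (a * (c * z)) + (a * z) * c" by simp
  then show False using det by (simp add: algebra_simps)
qed

text \<open>A Moebius map of the half plane onto the disc carries the real line into the unit circle, so the
  Hermitian form \<open>|cz + d|\<^sup>2 - |az + b|\<^sup>2\<close> vanishes on the real line and is a multiple of \<open>Im z\<close>.\<close>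

lemma moebius_half_plane_disc:
  assumes det: "a * d - b * c \<noteq> (0::complex)"
    and img: "moebius a b c d ` upper_half_plane = ball 0 1"
  obtains k where "k > 0" "\<And>z. (cmod (c * z + d))\<^sup>2 - (cmod (a * z + b))\<^sup>2 = k * Im z"
proof -
  define q where "q z = (cmod (c * z + d))\<^sup>2 - (cmod (a * z + b))\<^sup>2" for z
  define A where "A = (cmod c)\<^sup>2 - (cmod a)\<^sup>2"
  define B where "B = c * cnj d - a * cnj b"
  define E where "E = (cmod d)\<^sup>2 - (cmod b)\<^sup>2"
  have q: "q z = A * (cmod z)\<^sup>2 + 2 * Re (z * B) + E" for z
    unfolding q_def cmod_add_power2 A_def B_def E_def
    by (simp add: norm_mult power_mult_distrib algebra_simps)
  have pos: "q z > 0" if z: "Im z > 0" for z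
  proof -
    have "moebius a b c d z \<in> ball 0 1" unfolding img[symmetric] using z by auto
    then have "cmod (a * z + b) < cmod (c * z + d)"
      using moebius_half_plane_disc_no_pole[OF assms z] by (simp add: moebius_def norm_divide divide_less_eq)
    then show ?thesis by (simp add: q_def power_strict_mono)
  qed
  have real_zero: "q (of_real x) = 0" for x
  proof (rule ccontr)
    assume nz: "q (of_real x) \<noteq> 0"
    have "0 \<le> q (of_real x)"
    proof (rule tendsto_lowerbound)
      show "((\<lambda>h. q (of_real x + \<i> * of_real h)) \<longlongrightarrow> q (of_real x)) (at_right 0)"
        unfolding q_def by (auto intro!: tendsto_eq_intros)
      show "\<forall>\<^sub>F h in at_right 0. 0 \<le> q (of_real x + \<i> * of_real h)"
        using pos by (auto simp: eventually_at_right_field intro!: exI[of _ 1] less_imp_le)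
    qed simp
    then have gt: "q (of_real x) > 0" using nz by simp
    then have lt: "cmod (a * of_real x + b) < cmod (c * of_real x + d)"
      using power_less_imp_less_base by (fastforce simp: q_def)
    then have "moebius a b c d (of_real x) \<in> ball 0 1" by (auto simp: moebius_def norm_divide divide_less_eq)
    then obtain w where w: "Im w > 0" "moebius a b c d (of_real x) = moebius a b c d w"
      unfolding img[symmetric] by auto
    have "of_real x = w"
      using lt by (intro moebius_inj[OF det _ moebius_half_plane_disc_no_pole[OF assms w(1)] w(2)]) auto
    then show False using w(1) by auto
  qed
  have E: "E = 0" using real_zero[of 0] by (simp add: q)
  have "A + 2 * Re B = 0" "A - 2 * Re B = 0" using real_zero[of 1] real_zero[of "-1"] E by (simp_all add: q)
  then have "A = 0" "Re B = 0" by linarith+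
  then have form: "q z = (- 2 * Im B) * Im z" for z using E by (simp add: q)
  have "- 2 * Im B > 0" using pos[of \<i>] by (simp add: form)
  then show thesis using that form unfolding q_def by blast
qed

text \<open>A Moebius map \<open>\<psi>\<close> of the disc onto the half plane satisfies \<open>Im \<psi>(w) = \<kappa> (1 - |w|\<^sup>2)/|cw + d|\<^sup>2\<close>
  with \<open>\<kappa> > 0\<close>, as its inverse is covered by the preceding lemma.\<close>

lemma moebius_disc_half_plane:
  assumes det: "a * d - b * c \<noteq> (0::complex)"
    and img: "moebius a b c d ` ball 0 1 = upper_half_plane"
  shows "\<And>w. cmod w < 1 \<Longrightarrow> c * w + d \<noteq> 0"
    and "\<exists>m>0. \<forall>w. cmod w < 1 \<longrightarrow> m * (1 - cmod w) \<le> Im (moebius a b c d w)"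
proof -
  show no_pole: "c * w + d \<noteq> 0" if w: "cmod w < 1" for w
  proof
    assume "c * w + d = 0"
    then have "moebius a b c d w = 0" by (simp add: moebius_def)
    moreover have "moebius a b c d w \<in> upper_half_plane" unfolding img[symmetric] using w by simp
    ultimately show False by simp
  qed
  have inv: "moebius d (-b) (-c) a (moebius a b c d w) = w" if "cmod w < 1" for w
    using moebius_inverse[of a d b c w] no_pole[OF that] det by simp
  have "moebius d (-b) (-c) a ` upper_half_plane = (\<lambda>w. w) ` ball 0 1"
    unfolding img[symmetric] image_image by (intro image_cong) (auto simp: inv)
  then obtain k where k: "k > 0" "\<And>z. (cmod (- c * z + a))\<^sup>2 - (cmod (d * z + - b))\<^sup>2 = k * Im z"
    using moebius_half_plane_disc[of d a "-b" "-c"] det by (auto simp: mult.commute)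
  define N where "N = cmod c + cmod d"
  have N: "N > 0" using no_pole[of 0] by (simp add: N_def add_nonneg_pos)
  define D where "D = cmod (a * d - b * c)"
  have D: "D > 0" using det by (simp add: D_def)
  have "D\<^sup>2 / (k * N\<^sup>2) * (1 - cmod w) \<le> Im (moebius a b c d w)" if w: "cmod w < 1" for w
  proof -
    let ?z = "moebius a b c d w" and ?q = "c * w + d"
    have nz: "?q \<noteq> 0" using no_pole w by simp
    have "(- c * ?z + a) * ?q = a * d - b * c" "(d * ?z + - b) * ?q = (a * d - b * c) * w"
      using nz by (simp_all add: moebius_def field_simps)
    then have 1: "cmod (- c * ?z + a) * cmod ?q = D" "cmod (d * ?z + - b) * cmod ?q = D * cmod w"
      by (metis D_def norm_mult)+
    have "(k * Im ?z) * (cmod ?q)\<^sup>2 = (cmod (- c * ?z + a) * cmod ?q)\<^sup>2 - (cmod (d * ?z + - b) * cmod ?q)\<^sup>2"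
      by (simp add: k(2)[symmetric] algebra_simps power_mult_distrib)
    also have "\<dots> = D\<^sup>2 * (1 - (cmod w)\<^sup>2)" unfolding 1 by (simp add: algebra_simps power_mult_distrib)
    finally have eq: "(k * Im ?z) * (cmod ?q)\<^sup>2 = D\<^sup>2 * (1 - (cmod w)\<^sup>2)" .
    have "?z \<in> upper_half_plane" unfolding img[symmetric] using w by simp
    then have Im: "Im ?z > 0" by simp
    have "cmod ?q \<le> cmod c * 1 + cmod d"
      using w by (intro order_trans[OF norm_triangle_ineq] add_right_mono)
                 (auto simp: norm_mult mult_left_le)
    then have "(cmod ?q)\<^sup>2 \<le> N\<^sup>2" by (intro power_mono) (auto simp: N_def)
    then have "(k * Im ?z) * (cmod ?q)\<^sup>2 \<le> (k * Im ?z) * N\<^sup>2"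
      using k(1) Im by (intro mult_left_mono) auto
    moreover have "(cmod w)\<^sup>2 \<le> cmod w" using w by (simp add: power2_eq_square mult_left_le)
    then have "D\<^sup>2 * (1 - cmod w) \<le> D\<^sup>2 * (1 - (cmod w)\<^sup>2)" by (intro mult_left_mono) auto
    ultimately have "D\<^sup>2 * (1 - cmod w) \<le> (k * Im ?z) * N\<^sup>2" using eq by linarith
    then show ?thesis using k(1) N by (simp add: field_simps)
  qed
  moreover have "D\<^sup>2 / (k * N\<^sup>2) > 0" using D k(1) N by simp
  ultimately show "\<exists>m>0. \<forall>w. cmod w < 1 \<longrightarrow> m * (1 - cmod w) \<le> Im (moebius a b c d w)" by blast
qed

text \<open>Near a boundary point the inverse of a Moebius map of the half plane onto the disc is Lipschitz
  and distorts distances to the boundary by bounded factors.\<close>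

lemma moebius_half_plane_disc_local:
  assumes det: "a * d - b * c \<noteq> (0::complex)"
    and img: "moebius a b c d ` upper_half_plane = ball 0 1"
    and \<sigma>: "moebius a b c d (of_real \<sigma>) = \<tau>" and \<tau>: "\<tau> \<noteq> 0"
  obtains m R r where "m > 0" "R > 0" "r > 0"
    "\<And>z. cmod z < 1 \<Longrightarrow> cmod (z - \<tau>) < r \<Longrightarrow> \<exists>\<zeta>. Im \<zeta> > 0 \<and> moebius a b c d \<zeta> = z \<and>
       cmod (\<zeta> - of_real \<sigma>) \<le> R * cmod (z - \<tau>) \<and> m * (1 - cmod z) \<le> Im \<zeta> \<and> Im \<zeta> \<le> R * (1 - cmod z)"
proof -
  obtain k where k: "k > 0" "\<And>z. (cmod (c * z + d))\<^sup>2 - (cmod (a * z + b))\<^sup>2 = k * Im z"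
    using moebius_half_plane_disc[OF det img] by blast
  let ?s = "of_real \<sigma> :: complex"
  have snz: "c * ?s + d \<noteq> 0" using \<sigma> \<tau> by (auto simp: moebius_def)
  define D where "D = cmod (a * d - b * c)"
  have D: "D > 0" using det by (simp add: D_def)
  define p where "p = cmod (a - c * \<tau>)"
  have "(a - c * \<tau>) * (c * ?s + d) = a * d - b * c"
    unfolding \<sigma>[symmetric] using snz by (simp add: moebius_def field_simps)
  then have p: "p > 0" using det by (auto simp: p_def)
  define r where "r = p / (2 * (cmod c + 1))"
  have r: "r > 0" using p by (simp add: r_def add_nonneg_pos)
  define R where "R = max (2 * cmod (c * ?s + d) / p) (8 * D\<^sup>2 / (k * p\<^sup>2))"
  define m where "m = D\<^sup>2 / (k * (2 * p)\<^sup>2)"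
  have R: "R > 0" using D k(1) p by (simp add: R_def less_max_iff_disj)
  have m: "m > 0" using D k(1) p by (simp add: m_def)
  show thesis
  proof (rule that[OF m R r])
    fix z assume z: "cmod z < 1" "cmod (z - \<tau>) < r"
    then obtain \<zeta> where \<zeta>: "Im \<zeta> > 0" "z = moebius a b c d \<zeta>"
      using img by (metis (mono_tags, lifting) imageE mem_Collect_eq mem_ball_0)
    have nz: "c * \<zeta> + d \<noteq> 0" using moebius_half_plane_disc_no_pole[OF det img \<zeta>(1)] .
    have e1: "(a - c * z) * (c * \<zeta> + d) = a * d - b * c"
      unfolding \<zeta>(2) using nz by (simp add: moebius_def field_simps)
    then have D_eq: "cmod (a - c * z) * cmod (c * \<zeta> + d) = D" by (metis D_def norm_mult)
    have "cmod ((a - c * z) - (a - c * \<tau>)) \<le> cmod c * r"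
      using z(2) by (simp add: right_diff_distrib[symmetric] norm_mult norm_minus_commute mult_left_mono)
    also have "\<dots> \<le> (cmod c + 1) * r" using r by simp
    also have "\<dots> = p / 2" using add_nonneg_pos[OF norm_ge_zero[of c] zero_less_one] by (simp add: r_def divide_simps)
    finally have "\<bar>cmod (a - c * z) - p\<bar> \<le> p / 2"
      unfolding p_def using norm_triangle_ineq3 order_trans by blast
    then have pz: "p / 2 \<le> cmod (a - c * z)" "cmod (a - c * z) \<le> 2 * p" using p by linarith+
    have "(\<zeta> - ?s) * (a - c * z) = (z - \<tau>) * (c * ?s + d)"
    proof -
      have "z * (c * \<zeta> + d) = a * \<zeta> + b" "\<tau> * (c * ?s + d) = a * ?s + b"
        using nz snz \<sigma> \<zeta>(2) by (auto simp: moebius_def)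
      then show ?thesis by algebra
    qed
    then have "cmod (\<zeta> - ?s) * cmod (a - c * z) = cmod (z - \<tau>) * cmod (c * ?s + d)" by (metis norm_mult)
    moreover have "cmod (\<zeta> - ?s) * (p / 2) \<le> cmod (\<zeta> - ?s) * cmod (a - c * z)"
      using pz by (intro mult_left_mono) auto
    ultimately have "cmod (\<zeta> - ?s) \<le> 2 * cmod (c * ?s + d) / p * cmod (z - \<tau>)"
      using p by (simp add: field_simps)
    also have "\<dots> \<le> R * cmod (z - \<tau>)" by (intro mult_right_mono) (auto simp: R_def)
    finally have b1: "cmod (\<zeta> - ?s) \<le> R * cmod (z - \<tau>)" .
    have "cmod z * cmod (c * \<zeta> + d) = cmod (a * \<zeta> + b)"
      using nz by (simp add: \<zeta>(2) moebius_def norm_divide)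
    then have "k * Im \<zeta> = (1 - (cmod z)\<^sup>2) * (cmod (c * \<zeta> + d))\<^sup>2"
      using k(2)[of \<zeta>] by (metis (no_types, opaque_lifting) left_diff_distrib mult_1 power_mult_distrib)
    then have "k * Im \<zeta> * (cmod (a - c * z))\<^sup>2 = (1 - (cmod z)\<^sup>2) * D\<^sup>2"
      unfolding D_eq[symmetric] by (simp add: power_mult_distrib)
    moreover have "k * Im \<zeta> * (p / 2)\<^sup>2 \<le> k * Im \<zeta> * (cmod (a - c * z))\<^sup>2"
      "k * Im \<zeta> * (cmod (a - c * z))\<^sup>2 \<le> k * Im \<zeta> * (2 * p)\<^sup>2"
      using k(1) \<zeta>(1) pz p by (intro mult_left_mono power_mono; simp)+
    moreover have "(1 - cmod z) * D\<^sup>2 \<le> (1 - (cmod z)\<^sup>2) * D\<^sup>2" "(1 - (cmod z)\<^sup>2) * D\<^sup>2 \<le> (2 * (1 - cmod z)) * D\<^sup>2"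
    proof -
      have "(cmod z)\<^sup>2 \<le> cmod z" using z by (simp add: power2_eq_square mult_left_le)
      then show "(1 - cmod z) * D\<^sup>2 \<le> (1 - (cmod z)\<^sup>2) * D\<^sup>2" by (intro mult_right_mono) auto
      have "0 \<le> (1 - cmod z)\<^sup>2" by simp
      then have "1 - (cmod z)\<^sup>2 \<le> 2 * (1 - cmod z)" by (simp add: power2_eq_square algebra_simps)
      then show "(1 - (cmod z)\<^sup>2) * D\<^sup>2 \<le> (2 * (1 - cmod z)) * D\<^sup>2" by (intro mult_right_mono) auto
    qed
    ultimately have up: "k * Im \<zeta> * (p / 2)\<^sup>2 \<le> (2 * (1 - cmod z)) * D\<^sup>2"
      and lo: "(1 - cmod z) * D\<^sup>2 \<le> k * Im \<zeta> * (2 * p)\<^sup>2" by linarith+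
    have "Im \<zeta> \<le> 8 * D\<^sup>2 / (k * p\<^sup>2) * (1 - cmod z)"
      using up k(1) p by (simp add: field_simps)
    also have "\<dots> \<le> R * (1 - cmod z)" using z by (intro mult_right_mono) (auto simp: R_def)
    finally have b2: "Im \<zeta> \<le> R * (1 - cmod z)" .
    have b3: "m * (1 - cmod z) \<le> Im \<zeta>"
      using lo k(1) p by (simp add: m_def field_simps)
    show "\<exists>\<zeta>. Im \<zeta> > 0 \<and> moebius a b c d \<zeta> = z \<and> cmod (\<zeta> - ?s) \<le> R * cmod (z - \<tau>) \<and>
       m * (1 - cmod z) \<le> Im \<zeta> \<and> Im \<zeta> \<le> R * (1 - cmod z)"
      using \<zeta> b1 b2 b3 by blast
  qed
qed

lemma one_minus_norm_Moebius_function: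
  assumes "cmod w < 1" "cmod z < 1"
  shows "(1 - (cmod (Moebius_function 0 w z))\<^sup>2) * (cmod (1 - cnj w * z))\<^sup>2 = (1 - (cmod w)\<^sup>2) * (1 - (cmod z)\<^sup>2)"
proof -
  have "cmod (cnj w * z) < 1" using assms norm_mult_less[of "cnj w" 1 z 1] by simp
  then have "1 - cnj w * z \<noteq> 0" by auto
  then have "(1 - (cmod (Moebius_function 0 w z))\<^sup>2) * (cmod (1 - cnj w * z))\<^sup>2 =
      (cmod (1 - cnj w * z))\<^sup>2 - (cmod (z - w))\<^sup>2"
    by (simp add: Moebius_function_simple norm_divide power_divide field_simps)
  also have "\<dots> = (1 - (cmod w)\<^sup>2) * (1 - (cmod z)\<^sup>2)"
    unfolding cmod_power2 by (simp add: power2_eq_square algebra_simps)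
  finally show ?thesis .
qed

lemma Schwarz_Pick:
  assumes hol: "f holomorphic_on ball 0 1" and img: "\<And>z. cmod z < 1 \<Longrightarrow> cmod (f z) < 1"
    and z: "cmod z < 1" and w: "cmod w < 1"
  shows "(cmod (f z - f w))\<^sup>2 * ((1 - (cmod z)\<^sup>2) * (1 - (cmod w)\<^sup>2)) \<le>
    (1 - (cmod (f z))\<^sup>2) * (1 - (cmod (f w))\<^sup>2) * (cmod (1 - cnj w * z))\<^sup>2"
proof -
  define h where "h = (\<lambda>u. Moebius_function 0 (f w) (f (Moebius_function 0 (- w) u)))"
  have M: "cmod (Moebius_function 0 v u) < 1" if "cmod v < 1" "cmod u < 1" for u v
    using Moebius_function_norm_lt_1 that by blast
  have holM: "Moebius_function 0 v holomorphic_on ball 0 1" if "cmod v < 1" for v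
    using Moebius_function_holomorphic that by blast
  have "f \<circ> Moebius_function 0 (- w) holomorphic_on ball 0 1"
    using M[of "-w"] w by (intro holomorphic_on_compose_gen[OF holM hol]) auto
  then have "Moebius_function 0 (f w) \<circ> (f \<circ> Moebius_function 0 (- w)) holomorphic_on ball 0 1"
    using M[of "-w"] w img by (intro holomorphic_on_compose_gen[OF _ holM]) auto
  then have holh: "h holomorphic_on ball 0 1" by (simp add: h_def o_def)
  have h0: "h 0 = 0" by (simp add: h_def Moebius_function_of_zero Moebius_function_eq_zero)
  have "cmod (h u) < 1" if "cmod u < 1" for u using M img w that by (simp add: h_def)
  then have "cmod (h (Moebius_function 0 w z)) \<le> cmod (Moebius_function 0 w z)"
    using Schwarz_Lemma(1)[OF holh h0] M w z by blast
  moreover have "Moebius_function 0 (- w) (Moebius_function 0 w z) = z"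
    using Moebius_function_compose[of "-w" w z] w z by simp
  ultimately have le: "cmod (Moebius_function 0 (f w) (f z)) \<le> cmod (Moebius_function 0 w z)"
    by (simp add: h_def)
  define X where "X = cmod (Moebius_function 0 (f w) (f z))"
  define Y where "Y = cmod (Moebius_function 0 w z)"
  have XY: "0 \<le> X" "X \<le> Y" "Y < 1" using le M w z by (auto simp: X_def Y_def)
  have iX: "(1 - X\<^sup>2) * (cmod (1 - cnj (f w) * f z))\<^sup>2 = (1 - (cmod (f w))\<^sup>2) * (1 - (cmod (f z))\<^sup>2)"
    unfolding X_def using img w z by (intro one_minus_norm_Moebius_function) auto
  have iY: "(1 - Y\<^sup>2) * (cmod (1 - cnj w * z))\<^sup>2 = (1 - (cmod w)\<^sup>2) * (1 - (cmod z)\<^sup>2)"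
    unfolding Y_def using w z by (intro one_minus_norm_Moebius_function) auto
  have diff: "(cmod (f z - f w))\<^sup>2 \<le> (cmod (1 - cnj (f w) * f z))\<^sup>2"
  proof -
    have "(cmod (1 - cnj (f w) * f z))\<^sup>2 - (cmod (f z - f w))\<^sup>2 = (1 - (cmod (f w))\<^sup>2) * (1 - (cmod (f z))\<^sup>2)"
      unfolding cmod_power2 by (simp add: power2_eq_square algebra_simps)
    also have "\<dots> \<ge> 0" using img[OF w] img[OF z] by (intro mult_nonneg_nonneg) (auto simp: power_le_one)
    finally show ?thesis by simp
  qed
  have "(cmod (f z - f w))\<^sup>2 * ((1 - (cmod z)\<^sup>2) * (1 - (cmod w)\<^sup>2)) =
     (cmod (f z - f w))\<^sup>2 * ((1 - Y\<^sup>2) * (cmod (1 - cnj w * z))\<^sup>2)" using iY by (simp add: mult.commute)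
  also have "\<dots> \<le> (cmod (1 - cnj (f w) * f z))\<^sup>2 * ((1 - X\<^sup>2) * (cmod (1 - cnj w * z))\<^sup>2)"
    using diff XY by (intro mult_mono mult_right_mono) (auto simp: power_le_one power_mono)
  also have "\<dots> = ((1 - X\<^sup>2) * (cmod (1 - cnj (f w) * f z))\<^sup>2) * (cmod (1 - cnj w * z))\<^sup>2" by simp
  finally show ?thesis unfolding iX by (simp add: mult_ac)
qed

section \<open>Herglotz representation in the disc\<close>

text \<open>The Poisson kernel of the unit disc; the circle is parametrised by \<open>t \<mapsto> e\<^sup>2\<^sup>\<pi>\<^sup>i\<^sup>t\<close>, so that
  normalised arc length becomes Lebesgue measure on \<open>[0, 1]\<close>.\<close>

definition poisson_kernel :: "complex \<Rightarrow> real \<Rightarrow> real" where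
  "poisson_kernel z t = (1 - (cmod z)\<^sup>2) / (cmod (cis (2 * pi * t) - z))\<^sup>2"

lemma poisson_kernel_denominator:
  assumes "cmod z < 1"
  shows "1 - cmod z \<le> cmod (cis (2 * pi * t) - z)"
  using norm_triangle_ineq2[of "cis (2 * pi * t)" z] by simp

lemma isCont_poisson_kernel:
  assumes "cmod z < 1"
  shows "isCont (poisson_kernel z) t"
  using poisson_kernel_denominator[OF assms, of t] assms unfolding poisson_kernel_def cis_conv_exp
  by (intro continuous_intros) auto

lemma poisson_kernel_bounds:
  assumes "cmod z < 1"
  shows "0 \<le> poisson_kernel z t" "poisson_kernel z t \<le> 1 / (1 - cmod z)\<^sup>2"
proof -
  have "(cmod z)\<^sup>2 \<le> 1" using assms by (simp add: power_le_one)
  then show "0 \<le> poisson_kernel z t" by (simp add: poisson_kernel_def)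
  show "poisson_kernel z t \<le> 1 / (1 - cmod z)\<^sup>2"
    unfolding poisson_kernel_def using assms poisson_kernel_denominator[OF assms, of t] \<open>(cmod z)\<^sup>2 \<le> 1\<close>
    by (intro frac_le power_mono) auto
qed

text \<open>Cauchy's formula for \<open>w \<mapsto> g(w)(1 - |z|\<^sup>2)/(1 - \<bar>z w)\<close> at the point \<open>z\<close>, where this function
  has the value \<open>g(z)\<close>; on the circle the Cauchy kernel becomes the Poisson kernel.\<close>

lemma poisson_formula:
  assumes hol: "g holomorphic_on ball 0 1" and cont: "continuous_on (cball 0 1) g" and z: "cmod z < 1"
  shows "((\<lambda>t. poisson_kernel z t * Re (g (cis (2 * pi * t)))) has_integral Re (g z)) {0..1}"
proof -
  define h where "h w = g w * of_real (1 - (cmod z)\<^sup>2) / (1 - cnj z * w)" for w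
  have nz: "1 - cnj z * w \<noteq> 0" if "cmod w \<le> 1" for w
  proof -
    have "cmod (cnj z * w) \<le> cmod z * 1" unfolding norm_mult complex_mod_cnj using that by (intro mult_left_mono) auto
    then have "cmod (cnj z * w) < 1" using z by simp
    then show ?thesis by auto
  qed
  have "((\<lambda>u. h u / (u - z)) has_contour_integral (2 * of_real pi * \<i> * h z)) (circlepath 0 1)"
    unfolding h_def using nz z
    by (intro Cauchy_integral_circlepath) (auto intro!: continuous_intros holomorphic_intros cont hol)
  then have "((\<lambda>t. h (circlepath 0 1 t) / (circlepath 0 1 t - z) *
      vector_derivative (circlepath 0 1) (at t within {0..1})) has_integral (2 * of_real pi * \<i> * h z)) {0..1}"
    by (simp add: has_contour_integral_def)
  then have "((\<lambda>t. 1 / (2 * of_real pi * \<i>) * (h (circlepath 0 1 t) / (circlepath 0 1 t - z) *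
      vector_derivative (circlepath 0 1) (at t within {0..1}))) has_integral
      1 / (2 * of_real pi * \<i>) * (2 * of_real pi * \<i> * h z)) {0..1}"
    by (rule has_integral_mult_right)
  also have "1 / (2 * of_real pi * \<i>) * (2 * of_real pi * \<i> * h z) = h z" by simp
  also have "h z = g z"
  proof -
    have "cnj z * z = of_real ((cmod z)\<^sup>2)" by (metis complex_norm_square mult.commute)
    then show ?thesis using nz[of z] z by (simp add: h_def)
  qed
  also have "((\<lambda>t. 1 / (2 * of_real pi * \<i>) * (h (circlepath 0 1 t) / (circlepath 0 1 t - z) *
      vector_derivative (circlepath 0 1) (at t within {0..1}))) has_integral g z) {0..1} \<longleftrightarrow>
    ((\<lambda>t. of_real (poisson_kernel z t) * g (cis (2 * pi * t))) has_integral g z) {0..1}"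
  proof (rule has_integral_cong)
    fix t :: real assume t: "t \<in> {0..1}"
    let ?w = "cis (2 * pi * t)"
    have w: "circlepath 0 1 t = ?w" "vector_derivative (circlepath 0 1) (at t within {0..1}) = 2 * of_real pi * \<i> * ?w"
      using t vector_derivative_circlepath01[of t 0 1] by (simp_all add: cis_conv_exp circlepath mult_ac)
    have wz: "?w - z \<noteq> 0" using poisson_kernel_denominator[OF z, of t] z by auto
    have "(?w - z) * cnj (?w - z) = of_real ((cmod (?w - z))\<^sup>2)" by (metis complex_norm_square)
    moreover have "cnj (?w - z) * ?w = 1 - cnj z * ?w"
      by (simp add: left_diff_distrib cis_cnj cis_mult)
    ultimately have e: "of_real ((cmod (?w - z))\<^sup>2) * ?w = (?w - z) * (1 - cnj z * ?w)"
      by (metis mult.assoc)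
    have "1 / (2 * of_real pi * \<i>) * (h ?w / (?w - z) * (2 * of_real pi * \<i> * ?w)) = h ?w * ?w / (?w - z)"
    proof -
      have "1 / K * (x / y * (K * v)) = x * v / y" if "K \<noteq> 0" for K x y v :: complex
        using that by simp
      from this[of "2 * of_real pi * \<i>"] show ?thesis by simp
    qed
    also have "\<dots> = g ?w * of_real (1 - (cmod z)\<^sup>2) * (?w / ((?w - z) * (1 - cnj z * ?w)))"
      by (simp add: h_def mult_ac)
    also have "?w / ((?w - z) * (1 - cnj z * ?w)) = 1 / of_real ((cmod (?w - z))\<^sup>2)"
      using wz nz[of ?w] e by (simp add: divide_eq_eq eq_divide_eq mult_ac)
    also have "g ?w * of_real (1 - (cmod z)\<^sup>2) * (1 / of_real ((cmod (?w - z))\<^sup>2)) = of_real (poisson_kernel z t) * g ?w"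
      by (simp add: poisson_kernel_def)
    finally show "1 / (2 * of_real pi * \<i>) * (h (circlepath 0 1 t) / (circlepath 0 1 t - z) *
      vector_derivative (circlepath 0 1) (at t within {0..1})) = of_real (poisson_kernel z t) * g ?w"
      unfolding w .
  qed
  finally show ?thesis
    by (drule_tac has_integral_Re) (simp add: Re_complex_of_real)
qed

text \<open>The representing measure lives on parameters \<open>t\<close>. It is a weak limit of the
  probability measures with densities \<open>Re f(r e\<^sup>2\<^sup>\<pi>\<^sup>i\<^sup>t) / Re f(0)\<close>
  on \<open>[0, 1]\<close> as \<open>r \<rightarrow> 1\<close>.\<close>

theorem herglotz_disc:
  assumes hol: "f holomorphic_on ball 0 1" and pos: "\<And>z. cmod z < 1 \<Longrightarrow> Re (f z) > 0"
  obtains M where "real_distribution M"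
    "\<And>z. cmod z < 1 \<Longrightarrow> Re (f z) = Re (f 0) * (\<integral>t. poisson_kernel z t \<partial>M)"
proof -
  define k where "k = Re (f 0)"
  have k: "k > 0" using pos[of 0] by (simp add: k_def)
  define r :: "nat \<Rightarrow> real" where "r n = 1 + - inverse (real (Suc (Suc n)))" for n
  have r: "0 < r n" "r n < 1" for n by (auto simp: r_def field_simps)
  have r_lim: "r \<longlonglongrightarrow> 1"
    unfolding r_def using LIMSEQ_Suc[OF LIMSEQ_inverse_real_of_nat_add_minus[of 1]] by simp
  define D where "D n t = indicator {0..1} t * (Re (f (of_real (r n) * cis (2 * pi * t))) / k)" for n and t :: real
  have in_ball: "cmod (of_real (r n) * w) < 1" if "cmod w \<le> 1" for n w
  proof -
    have "cmod (of_real (r n) * w) \<le> r n * 1" using r[of n] that by (auto simp: norm_mult intro!: mult_left_mono)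
    then show ?thesis using r[of n] by simp
  qed
  have contf: "continuous_on (ball 0 1) f" using hol by (rule holomorphic_on_imp_continuous_on)
  have contg: "continuous_on S (\<lambda>w. f (of_real (r n) * w))" if "S \<subseteq> cball 0 1" for n S
    using that in_ball by (intro continuous_on_compose2[OF contf]) (auto intro!: continuous_intros)
  have contD: "continuous_on A (\<lambda>t. Re (f (of_real (r n) * cis (2 * pi * t))) / k)" for n A
    unfolding cis_conv_exp using in_ball[of "exp _" n] k
    by (intro continuous_intros continuous_on_compose2[OF contf]) auto
  have D_meas [measurable]: "D n \<in> borel_measurable borel" for n
  proof -
    have [measurable]: "(\<lambda>t. Re (f (of_real (r n) * cis (2 * pi * t))) / k) \<in> borel_measurable borel"
      by (rule borel_measurable_continuous_onI[OF contD])
    show ?thesis unfolding D_def by measurable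
  qed
  have D_nonneg: "0 \<le> D n t" for n t
    unfolding D_def using pos[OF in_ball[of "cis (2 * pi * t)" n]] k by (auto simp: indicator_def)
  have int_D: "integrable lborel (\<lambda>t. D n t * poisson_kernel z t)"
     "(\<integral>t. D n t * poisson_kernel z t \<partial>lborel) = Re (f (of_real (r n) * z)) / k" if z: "cmod z < 1" for n z
  proof -
    have c: "continuous_on {0..1} (\<lambda>t. poisson_kernel z t * (Re (f (of_real (r n) * cis (2 * pi * t))) / k))"
      using contD isCont_poisson_kernel[OF z]
      by (intro continuous_on_mult) (auto intro!: continuous_at_imp_continuous_on)
    have si: "set_integrable lborel {0..1} (\<lambda>t. poisson_kernel z t * (Re (f (of_real (r n) * cis (2 * pi * t))) / k))"
      by (rule borel_integrable_atLeastAtMost'[OF c])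
    then show "integrable lborel (\<lambda>t. D n t * poisson_kernel z t)"
      by (simp add: set_integrable_def D_def mult_ac)
    have "((\<lambda>t. poisson_kernel z t * Re (f (of_real (r n) * cis (2 * pi * t)))) has_integral Re (f (of_real (r n) * z))) {0..1}"
      using in_ball contg[of "cball 0 1" n] z
      by (intro poisson_formula[where g = "\<lambda>w. f (of_real (r n) * w)"]
             holomorphic_on_compose_gen[OF _ hol, unfolded o_def]) (auto intro!: holomorphic_intros)
    then have "((\<lambda>t. poisson_kernel z t * Re (f (of_real (r n) * cis (2 * pi * t))) * (1/k)) has_integral
        Re (f (of_real (r n) * z)) * (1/k)) {0..1}" by (rule has_integral_mult_left)
    then have "integral {0..1} (\<lambda>t. poisson_kernel z t * (Re (f (of_real (r n) * cis (2 * pi * t))) / k)) =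
        Re (f (of_real (r n) * z)) / k" by (intro integral_unique) simp
    then show "(\<integral>t. D n t * poisson_kernel z t \<partial>lborel) = Re (f (of_real (r n) * z)) / k"
      using set_borel_integral_eq_integral(2)[OF si] k by (simp add: set_lebesgue_integral_def D_def mult_ac)
  qed
  define N where "N n = density lborel (\<lambda>t. ennreal (D n t))" for n
  have mass: "(\<integral>\<^sup>+t. ennreal (D n t) \<partial>lborel) = 1" for n
  proof -
    have "poisson_kernel 0 = (\<lambda>t. 1)" by (auto simp: poisson_kernel_def)
    then show ?thesis using int_D[of 0 n] D_nonneg k by (simp add: nn_integral_eq_integral k_def)
  qed
  have distN: "real_distribution (N n)" for n
  proof -
    have "prob_space (N n)" by standard (simp add: N_def emeasure_density mass)
    then show ?thesis by (simp add: real_distribution_def real_distribution_axioms_def N_def)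
  qed
  have support: "measure (N n) {-1<..1} = 1" for n
  proof -
    have "emeasure (N n) {-1<..1} = (\<integral>\<^sup>+t. ennreal (D n t) * indicator {-1<..1} t \<partial>lborel)"
      by (simp add: N_def emeasure_density)
    also have "\<dots> = (\<integral>\<^sup>+t. ennreal (D n t) \<partial>lborel)"
      by (intro nn_integral_cong) (auto simp: D_def indicator_def)
    finally have "emeasure (N n) {-1<..1} = (\<integral>\<^sup>+t. ennreal (D n t) \<partial>lborel)" .
    then show ?thesis by (simp add: mass measure_def)
  qed
  have "tight N"
    unfolding tight_def
  proof (intro conjI allI impI)
    fix \<epsilon> :: real assume "0 < \<epsilon>"
    then have "(-1 :: real) < 1 \<and> (\<forall>n. measure (N n) {-1<..1} > 1 - \<epsilon>)" by (simp add: support)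
    then show "\<exists>a b. a < b \<and> (\<forall>n. measure (N n) {a<..b} > 1 - \<epsilon>)" by blast
  qed (rule distN)
  from tight_imp_convergent_subsubsequence[OF this strict_mono_id]
  obtain q M where q: "strict_mono q" and M: "real_distribution M" and conv: "weak_conv_m (N \<circ> id \<circ> q) M"
    by blast
  have "Re (f z) = k * (\<integral>t. poisson_kernel z t \<partial>M)" if z: "cmod z < 1" for z
  proof -
    have "(\<lambda>n. integral\<^sup>L ((N \<circ> id \<circ> q) n) (poisson_kernel z)) \<longlonglongrightarrow> integral\<^sup>L M (poisson_kernel z)"
      using distN M conv isCont_poisson_kernel[OF z] poisson_kernel_bounds[OF z] unfolding o_def id_def
      by (intro weak_conv_imp_integral_bdd_continuous_conv[where B = "1 / (1 - cmod z)\<^sup>2"]) auto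
    moreover have "integral\<^sup>L ((N \<circ> id \<circ> q) n) (poisson_kernel z) = Re (f (of_real (r (q n)) * z)) / k" for n
    proof -
      have "poisson_kernel z \<in> borel_measurable borel"
        using isCont_poisson_kernel[OF z] by (auto intro!: borel_measurable_continuous_onI continuous_at_imp_continuous_on)
      then show ?thesis
        using int_D(2)[OF z, of "q n"] D_nonneg by (simp add: N_def integral_density)
    qed
    ultimately have 1: "(\<lambda>n. Re (f (of_real (r (q n)) * z)) / k) \<longlonglongrightarrow> integral\<^sup>L M (poisson_kernel z)" by simp
    have "(\<lambda>n. of_real (r (q n)) * z) \<longlonglongrightarrow> of_real 1 * z"
      using LIMSEQ_subseq_LIMSEQ[OF r_lim q] by (intro tendsto_intros) (simp add: o_def)
    moreover have "isCont f z"
      using contf z by (auto simp: continuous_on_eq_continuous_at)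
    ultimately have "(\<lambda>n. Re (f (of_real (r (q n)) * z)) / k) \<longlonglongrightarrow> Re (f z) / k"
      using k by (intro tendsto_intros isCont_tendsto_compose[of z f]) auto
    from LIMSEQ_unique[OF 1 this] show ?thesis using k by (simp add: field_simps)
  qed
  then show thesis unfolding k_def by (rule that[OF M])
qed

section \<open>Herglotz representation in the half plane\<close>

text \<open>A nonnegative harmonic function \<open>Im f\<close> on the half plane is represented by a finite measure
  \<open>\<rho>\<close> on the real line and a constant \<open>\<beta>\<close>, the mass at infinity. The Nevanlinna measure is then
  \<open>\<pi>(1 + s\<^sup>2) d\<rho>(s)\<close>.\<close>

definition nevanlinna_representation :: "(complex \<Rightarrow> complex) \<Rightarrow> real \<Rightarrow> real measure \<Rightarrow> bool" where
  "nevanlinna_representation f \<beta> \<rho> \<longleftrightarrow> 0 \<le> \<beta> \<and> finite_measure \<rho> \<and> sets \<rho> = sets borel \<and>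
     (\<forall>z. 0 < Im z \<longrightarrow> Im (f z) = \<beta> * Im z + (\<integral>s. Im z * (1 + s\<^sup>2) / (cmod (of_real s - z))\<^sup>2 \<partial>\<rho>))"

lemma representation_kernel_bound:
  assumes "0 < Im z"
  shows "(1 + s\<^sup>2) / (cmod (of_real s - z))\<^sup>2 \<le> 2 + (1 + 2 * (cmod z)\<^sup>2) / (Im z)\<^sup>2"
proof -
  define q where "q = (cmod (of_real s - z))\<^sup>2"
  have q: "(Im z)\<^sup>2 \<le> q" by (simp add: q_def cmod_power2)
  have q0: "0 < q" using q assms by (smt (verit) zero_less_power)
  have "\<bar>s\<bar> \<le> cmod (of_real s - z) + cmod z"
    using norm_triangle_ineq[of "of_real s - z" z] by simp
  then have "s\<^sup>2 \<le> (cmod (of_real s - z) + cmod z)\<^sup>2"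
    by (metis abs_ge_zero power2_abs power_mono)
  also have "\<dots> \<le> 2 * q + 2 * (cmod z)\<^sup>2"
    using zero_le_power2[of "cmod (of_real s - z) - cmod z"]
    by (simp add: q_def power2_eq_square algebra_simps)
  finally have "(1 + s\<^sup>2) / q \<le> (2 * q + (1 + 2 * (cmod z)\<^sup>2)) / q"
    using q0 by (intro divide_right_mono) auto
  also have "\<dots> = 2 + (1 + 2 * (cmod z)\<^sup>2) / q" using q0 by (simp add: field_simps)
  also have "\<dots> \<le> 2 + (1 + 2 * (cmod z)\<^sup>2) / (Im z)\<^sup>2"
    using q q0 assms by (intro add_left_mono divide_left_mono) auto
  finally show ?thesis by (simp add: q_def)
qed

text \<open>The Cayley transform \<open>z \<mapsto> i(1 + z)/(1 - z)\<close> turns the Poisson kernel of the disc into that of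
  the half plane; the boundary point \<open>1\<close> of the disc goes to infinity and contributes \<open>\<beta> Im z\<close>.\<close>

theorem herglotz_half_plane:
  assumes hol: "f holomorphic_on {z. 0 < Im z}" and pos: "\<And>z. 0 < Im z \<Longrightarrow> Im (f z) > 0"
  obtains \<beta> \<rho> where "nevanlinna_representation f \<beta> \<rho>"
proof -
  define cay where "cay z = \<i> * (1 + z) / (1 - z)" for z :: complex
  have Im_cay: "Im (cay z) = (1 - (cmod z)\<^sup>2) / (cmod (1 - z))\<^sup>2" for z
    unfolding cay_def Im_divide cmod_power2 by (simp add: power2_eq_square algebra_simps)
  have cay_pos: "0 < Im (cay z)" if "cmod z < 1" for z
    using that by (auto simp: Im_cay abs_square_less_1 intro!: divide_pos_pos)
  define F where "F z = - \<i> * f (cay z)" for z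
  have "F holomorphic_on ball 0 1"
    unfolding F_def using cay_pos
    by (intro holomorphic_intros holomorphic_on_compose_gen[OF _ hol, unfolded o_def])
       (auto simp: cay_def intro!: holomorphic_intros)
  moreover have Re_F: "Re (F z) = Im (f (cay z))" for z by (simp add: F_def)
  ultimately obtain M where M: "real_distribution M"
    and repr: "\<And>z. cmod z < 1 \<Longrightarrow> Im (f (cay z)) = Im (f \<i>) * (\<integral>t. poisson_kernel z t \<partial>M)"
    using herglotz_disc[of F] pos cay_pos by (auto simp: cay_def)
  interpret M: real_distribution M by fact
  define k where "k = Im (f \<i>)"
  have k: "k > 0" using pos[of \<i>] by (simp add: k_def)
  \<comment> \<open>\<open>A\<close> consists of the parameters of the boundary point \<open>1\<close>, and \<open>S\<close> maps the others to the real line.\<close>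
  define A where "A = {t :: real. cis (2 * pi * t) = 1}"
  have cis_meas [measurable]: "(\<lambda>t. cis (2 * pi * t)) \<in> borel_measurable borel"
    unfolding cis_conv_exp by (intro borel_measurable_continuous_onI continuous_intros)
  have A [measurable]: "A \<in> sets borel" unfolding A_def by measurable
  define S where "S t = Re (cay (cis (2 * pi * t)))" for t
  have S [measurable]: "S \<in> borel_measurable borel" unfolding S_def cay_def by measurable
  define \<rho> where "\<rho> = distr (density M (\<lambda>t. ennreal (k * indicator (- A) t))) borel S"
  define \<beta> where "\<beta> = k * measure M A"
  have fin: "finite_measure \<rho>"
  proof
    have "emeasure \<rho> (space \<rho>) = (\<integral>\<^sup>+t. ennreal (k * indicator (- A) t) \<partial>M)"
      by (simp add: \<rho>_def emeasure_distr emeasure_density)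
    also have "\<dots> \<le> (\<integral>\<^sup>+t. ennreal k \<partial>M)"
      using k by (intro nn_integral_mono ennreal_leI) (auto simp: indicator_def)
    also have "\<dots> < \<infinity>" using M.emeasure_space_1 by simp
    finally show "emeasure \<rho> (space \<rho>) \<noteq> \<infinity>" by simp
  qed
  have "Im (f z) = \<beta> * Im z + (\<integral>s. Im z * (1 + s\<^sup>2) / (cmod (of_real s - z))\<^sup>2 \<partial>\<rho>)" if z: "0 < Im z" for z
  proof -
    \<comment> \<open>the inverse of the Cayley transform\<close>
    define w where "w = (z - \<i>) / (z + \<i>)"
    have zi: "z + \<i> \<noteq> 0" using z by (auto simp: complex_eq_iff)
    have w1: "1 - w = 2 * \<i> / (z + \<i>)" "1 + w = 2 * z / (z + \<i>)" using zi by (simp_all add: w_def field_simps)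
    have cw: "cay w = z" unfolding cay_def w1 using zi by simp
    have "cmod (z - \<i>) < cmod (z + \<i>)"
      using z by (simp add: cmod_def power2_eq_square algebra_simps)
    then have w: "cmod w < 1" using zi by (simp add: w_def norm_divide)
    define G where "G s = Im z * (1 + s\<^sup>2) / (cmod (of_real s - z))\<^sup>2" for s
    have [measurable]: "G \<in> borel_measurable borel" unfolding G_def by measurable
    have PA: "poisson_kernel w t = Im z" if "t \<in> A" for t
      using that by (simp add: poisson_kernel_def A_def Im_cay[of w, unfolded cw])
    have PN: "poisson_kernel w t = G (S t)" if "t \<notin> A" for t
    proof -
      define c where "c = cis (2 * pi * t)"
      have c: "c \<noteq> 1" "cmod c = 1" using that by (auto simp: A_def c_def)
      have St: "of_real (S t) = cay c"
        using c by (simp add: complex_eq_iff S_def c_def[symmetric] Im_cay)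
      have c0: "1 - c \<noteq> 0" "1 - w \<noteq> 0" using c w by auto
      have e1: "cay c - cay w = 2 * \<i> * (c - w) / ((1 - c) * (1 - w))"
        using c0 by (simp add: cay_def field_simps)
      have "1 + (S t)\<^sup>2 = (cmod (1 + \<i> * cay c))\<^sup>2"
        unfolding St[symmetric] cmod_power2 by simp
      also have "1 + \<i> * cay c = - 2 * c / (1 - c)" using c0 by (simp add: cay_def field_simps)
      finally have e2: "1 + (S t)\<^sup>2 = 4 / (cmod (1 - c))\<^sup>2" using c by (simp add: norm_divide norm_mult power_divide)
      have "G (S t) = (1 - (cmod w)\<^sup>2) / (cmod (1 - w))\<^sup>2 * (4 / (cmod (1 - c))\<^sup>2) / (cmod (cay c - cay w))\<^sup>2"
        unfolding G_def e2 St by (simp add: Im_cay[of w, unfolded cw] cw)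
      also have "\<dots> = poisson_kernel w t"
        unfolding e1 poisson_kernel_def c_def[symmetric] using c0
        by (simp add: norm_divide norm_mult power_divide power_mult_distrib) (simp add: divide_simps)
      finally show ?thesis by simp
    qed
    have Gb: "norm (G s) \<le> Im z * (2 + (1 + 2 * (cmod z)\<^sup>2) / (Im z)\<^sup>2)" for s
    proof -
      have "G s = Im z * ((1 + s\<^sup>2) / (cmod (of_real s - z))\<^sup>2)" by (simp add: G_def)
      moreover have "0 \<le> \<dots>" using z by simp
      ultimately show ?thesis
        using mult_left_mono[OF representation_kernel_bound[OF z, of s], of "Im z"] z by (simp only: real_norm_def abs_of_nonneg)
    qed
    have i1: "integrable M (\<lambda>t. indicator (- A) t * G (S t))"
      using Gb by (intro M.integrable_const_bound[where B = "Im z * (2 + (1 + 2 * (cmod z)\<^sup>2) / (Im z)\<^sup>2)"])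
                  (auto simp: indicator_def intro: order_trans[OF abs_ge_zero])
    have i2: "integrable M (\<lambda>t. indicator A t * Im z)"
      by (intro M.integrable_const_bound[where B = "Im z"]) (use z in \<open>auto simp: indicator_def\<close>)
    have "Im (f z) = k * (\<integral>t. poisson_kernel w t \<partial>M)"
      using repr[OF w] by (simp add: cw k_def)
    also have "(\<integral>t. poisson_kernel w t \<partial>M) = (\<integral>t. indicator A t * Im z + indicator (- A) t * G (S t) \<partial>M)"
      by (intro Bochner_Integration.integral_cong) (auto simp: indicator_def PA PN)
    also have "\<dots> = (\<integral>t. indicator A t * Im z \<partial>M) + (\<integral>t. indicator (- A) t * G (S t) \<partial>M)"
      by (rule Bochner_Integration.integral_add[OF i2 i1])
    also have "(\<integral>t. indicator A t * Im z \<partial>M) = measure M A * Im z" by simp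
    also have "k * (measure M A * Im z + (\<integral>t. indicator (- A) t * G (S t) \<partial>M)) =
        \<beta> * Im z + (\<integral>t. (k * indicator (- A) t) * G (S t) \<partial>M)"
      by (simp add: \<beta>_def algebra_simps)
    also have "(\<integral>t. (k * indicator (- A) t) * G (S t) \<partial>M) = (\<integral>s. G s \<partial>\<rho>)"
      unfolding \<rho>_def using k by (subst integral_distr) (auto simp: integral_density indicator_def)
    finally show ?thesis by (simp add: G_def)
  qed
  then have "nevanlinna_representation f \<beta> \<rho>"
    using fin k by (simp add: nevanlinna_representation_def \<beta>_def \<rho>_def)
  then show thesis by (rule that)
qed

lemma nevanlinna_representation_zero:
  assumes "\<And>z. 0 < Im z \<Longrightarrow> Im (f z) = 0"
  shows "nevanlinna_representation f 0 (null_measure borel)"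
  using assms by (auto simp: nevanlinna_representation_def intro!: finite_measureI)

section \<open>The Nevanlinna measure\<close>

text \<open>A locally finite measure on the line is determined by its integrals of continuous functions of
  compact support: indicators of compact intervals are limits of such functions.\<close>

lemma locally_finite_measure_unique:
  fixes \<mu> \<nu> :: "real measure"
  assumes sets: "sets \<mu> = sets borel" "sets \<nu> = sets borel"
    and fin: "\<And>K. compact K \<Longrightarrow> emeasure \<mu> K < \<infinity>" "\<And>K. compact K \<Longrightarrow> emeasure \<nu> K < \<infinity>"
    and eq: "\<And>g :: real \<Rightarrow> real. continuous_on UNIV g \<Longrightarrow> compact (closure {x. g x \<noteq> 0}) \<Longrightarrow>
      integral\<^sup>L \<mu> g = integral\<^sup>L \<nu> g"
  shows "\<mu> = \<nu>"
proof -
  define g where "g a b n x = max 0 (min 1 (min (1 + real (Suc n) * (x - a)) (1 + real (Suc n) * (b - x))))"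
    for a b x :: real and n
  have cont: "continuous_on UNIV (g a b n)" for a b n
    unfolding g_def by (intro continuous_intros)
  have out: "g a b n x = 0" if "x \<notin> {a-1..b+1}" for a b n x
  proof -
    have *: "1 + real (Suc n) * t \<le> 0" if "t < -1" for t
      using mult_mono[of 1 "real (Suc n)" 1 "- t"] that by simp
    show ?thesis using that *[of "x - a"] *[of "b - x"] by (auto simp: g_def)
  qed
  have bnd: "norm (g a b n x) \<le> indicator {a-1..b+1} x" for a b n x
    using out[of x a b n] by (auto simp: g_def indicator_def)
  have supp: "compact (closure {x. g a b n x \<noteq> 0})" for a b n
  proof -
    have "{x. g a b n x \<noteq> 0} \<subseteq> {a-1..b+1}" using out by blast
    then show ?thesis using bounded_subset compact_closure bounded_closed_interval by blast
  qed
  have lim: "(\<lambda>n. g a b n x) \<longlonglongrightarrow> indicator {a..b} x" if "a \<le> b" for a b x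
  proof (cases "x \<in> {a..b}")
    case True
    then have "g a b n x = 1" for n by (auto simp: g_def)
    then show ?thesis using True by simp
  next
    case False
    then obtain t where t: "t < 0" "\<And>n. g a b n x \<le> max 0 (1 + real (Suc n) * t)"
    proof (cases "x < a")
      case True
      then show ?thesis using that[of "x - a"] by (simp add: g_def)
    next
      case F: False
      then show ?thesis using False that[of "b - x"] by (simp add: g_def)
    qed
    obtain n0 where n0: "1 < real n0 * (- t)" using reals_Archimedean3[of "-t"] t(1) by (meson neg_0_less_iff_less)
    have "g a b n x = 0" if n: "n \<ge> n0" for n
    proof -
      have "real n0 * (- t) \<le> real (Suc n) * (- t)" using n t(1) by (intro mult_right_mono) auto
      then have "1 + real (Suc n) * t \<le> 0" using n0 by (simp only: mult_minus_right)
      then have "max 0 (1 + real (Suc n) * t) = 0" by simp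
      moreover have "0 \<le> g a b n x" by (simp add: g_def)
      ultimately show ?thesis using t(2)[of n] by linarith
    qed
    then have "\<forall>\<^sub>F n in sequentially. g a b n x = 0" by (auto simp: eventually_sequentially)
    then show ?thesis using False by (simp add: tendsto_eventually)
  qed
  have conv: "(\<lambda>n. integral\<^sup>L m (g a b n)) \<longlonglongrightarrow> measure m {a..b}"
    if ab: "a \<le> b" and m: "sets m = sets borel" "\<And>K. compact K \<Longrightarrow> emeasure m K < \<infinity>" for m :: "real measure" and a b
  proof -
    note [measurable_cong] = m(1)
    have [measurable]: "g a b n \<in> borel_measurable borel" for n
      by (rule borel_measurable_continuous_onI[OF cont])
    have "(\<lambda>n. integral\<^sup>L m (g a b n)) \<longlonglongrightarrow> integral\<^sup>L m (indicator {a..b})"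
    proof (rule integral_dominated_convergence[where w = "indicator {a-1..b+1}"])
      show "integrable m (indicator {a-1..b+1} :: real \<Rightarrow> real)"
        using m(2)[of "{a-1..b+1}"] m(1) by (simp add: compact_Icc)
    qed (use lim[OF ab] bnd in auto)
    also have "integral\<^sup>L m (indicator {a..b}) = measure m {a..b}"
      using m(1) sets_eq_imp_space_eq[OF m(1)] by simp
    finally show ?thesis .
  qed
  show ?thesis
  proof (rule measure_eqI_generator_eq[where \<Omega> = UNIV and E = "range (\<lambda>(a, b). {a..b})"
        and A = "\<lambda>n. {- real n..real n}"])
    show "Int_stable (range (\<lambda>(a, b). {a..b :: real}))"
      by (auto simp: Int_stable_def Int_atLeastAtMost)
    show "sets \<mu> = sigma_sets UNIV (range (\<lambda>(a, b). {a..b}))" "sets \<nu> = sigma_sets UNIV (range (\<lambda>(a, b). {a..b}))"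
      using sets by (simp_all add: borel_eq_atLeastAtMost)
    show "range (\<lambda>n. {- real n..real n}) \<subseteq> range (\<lambda>(a, b). {a..b})" by auto
    show "(\<Union>n. {- real n..real n}) = UNIV"
    proof (rule UNIV_eq_I[symmetric])
      fix x :: real
      obtain n where "\<bar>x\<bar> \<le> real n" using real_arch_simple by blast
      then show "x \<in> (\<Union>n. {- real n..real n})" by (auto intro!: exI[of _ n])
    qed
    show "emeasure \<mu> {- real n..real n} \<noteq> \<infinity>" for n using fin(1)[of "{- real n..real n}"] by auto
    fix X :: "real set" assume "X \<in> range (\<lambda>(a, b). {a..b})"
    then obtain a b where X: "X = {a..b}" by auto
    show "emeasure \<mu> X = emeasure \<nu> X"
    proof (cases "a \<le> b")
      case True
      have "measure \<mu> {a..b} = measure \<nu> {a..b}"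
        using conv[OF True sets(1) fin(1)] conv[OF True sets(2) fin(2)] eq[OF cont supp]
        by (auto intro: LIMSEQ_unique)
      then show ?thesis
        using fin[of "{a..b}"] X by (simp add: emeasure_eq_ennreal_measure less_top[symmetric])
    qed (simp add: X)
  qed auto
qed

lemma is_nevanlinna_measure_unique:
  assumes "is_nevanlinna_measure f \<mu>" "is_nevanlinna_measure f \<nu>"
  shows "\<mu> = \<nu>"
proof (rule locally_finite_measure_unique)
  fix g :: "real \<Rightarrow> real" assume g: "continuous_on UNIV g" "compact (closure {x. g x \<noteq> 0})"
  have lim: "((\<lambda>y. integral\<^sup>L (density lborel (\<lambda>x. ennreal (Im (f (Complex x y))))) g) \<longlongrightarrow> integral\<^sup>L m g) (at_right 0)"
    if "is_nevanlinna_measure f m" for m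
    using that g by (simp add: is_nevanlinna_measure_def weak_limit_def)
  show "integral\<^sup>L \<mu> g = integral\<^sup>L \<nu> g"
    by (rule tendsto_unique[OF trivial_limit_at_right_real lim[OF assms(1)] lim[OF assms(2)]])
qed (use assms in \<open>auto simp: is_nevanlinna_measure_def\<close>)

lemma cauchy_density_integral:
  "integrable lborel (\<lambda>t::real. 1 / (1 + t\<^sup>2))" "(\<integral>t. 1 / (1 + t\<^sup>2) \<partial>lborel) = pi"
proof -
  have e: "einterval (-\<infinity>) \<infinity> = UNIV" by (auto simp: einterval_def)
  show "integrable lborel (\<lambda>t::real. 1 / (1 + t\<^sup>2))"
    using integrable_inverse_1_plus_square by (simp add: set_integrable_def e inverse_eq_divide)
  show "(\<integral>t. 1 / (1 + t\<^sup>2) \<partial>lborel) = pi"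
    using LBINT_inverse_1_plus_square
    by (simp add: interval_lebesgue_integral_def set_lebesgue_integral_def e inverse_eq_divide)
qed

lemma cauchy_kernel_integral:
  assumes y: "0 < y"
  shows "integrable lborel (\<lambda>x::real. y / ((s - x)\<^sup>2 + y\<^sup>2))" "(\<integral>x. y / ((s - x)\<^sup>2 + y\<^sup>2) \<partial>lborel) = pi"
proof -
  have e: "y / ((s - (s + y * t))\<^sup>2 + y\<^sup>2) = (1 / y) * (1 / (1 + t\<^sup>2))" for t
  proof -
    have "(s - (s + y * t))\<^sup>2 + y\<^sup>2 = y * (y * (1 + t\<^sup>2))" by (simp add: power2_eq_square algebra_simps)
    then show ?thesis using y by simp
  qed
  have "integrable lborel (\<lambda>x. y / ((s - (s + y * x))\<^sup>2 + y\<^sup>2))"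
    unfolding e using cauchy_density_integral(1) by (rule integrable_mult_right)
  then show "integrable lborel (\<lambda>x. y / ((s - x)\<^sup>2 + y\<^sup>2))"
    using lborel_integrable_real_affine_iff[of y "\<lambda>x. y / ((s - x)\<^sup>2 + y\<^sup>2)" s] y by simp
  have "(\<integral>x. y / ((s - x)\<^sup>2 + y\<^sup>2) \<partial>lborel) = y * (\<integral>x. y / ((s - (s + y * x))\<^sup>2 + y\<^sup>2) \<partial>lborel)"
    using lborel_integral_real_affine[of y "\<lambda>x. y / ((s - x)\<^sup>2 + y\<^sup>2)" s] y by simp
  also have "\<dots> = pi"
    unfolding e integral_mult_right_zero cauchy_density_integral(2) using y by simp
  finally show "(\<integral>x. y / ((s - x)\<^sup>2 + y\<^sup>2) \<partial>lborel) = pi" .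
qed

context
  fixes f \<beta> \<rho>
  assumes repr: "nevanlinna_representation f \<beta> \<rho>"
begin

interpretation \<rho>: finite_borel_measure \<rho>
  using repr by (simp add: nevanlinna_representation_def finite_borel_measure_def finite_borel_measure_axioms_def)

lemma rho_sets: "sets \<rho> = sets borel"
  using repr by (simp add: nevanlinna_representation_def)

lemma rho_space: "space \<rho> = UNIV"
  using sets_eq_imp_space_eq[OF rho_sets] by simp

lemma Im_repr:
  assumes "0 < y"
  shows "Im (f (Complex x y)) = \<beta> * y + (\<integral>s. (1 + s\<^sup>2) * (y / ((s - x)\<^sup>2 + y\<^sup>2)) \<partial>\<rho>)"
  using repr assms by (simp add: nevanlinna_representation_def cmod_power2 mult_ac)

text \<open>By Fubini the integral of \<open>g(x) Im f(x + iy)\<close> is \<open>\<beta> y \<integral> g\<close> plus the \<open>\<rho>\<close>-integral of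
  \<open>H\<^sub>y(s) = (1 + s\<^sup>2) \<integral> g(x) y/((s - x)\<^sup>2 + y\<^sup>2) dx\<close>. As \<open>y \<rightarrow> 0\<close> the functions \<open>H\<^sub>y(s)\<close> tend to \<open>\<pi>(1 + s\<^sup>2) g(s)\<close>
  pointwise and stay bounded because \<open>g\<close> has compact support; and \<open>\<rho>\<close> is finite.\<close>

lemma weak_limit_repr:
  "weak_limit (\<lambda>y. density lborel (\<lambda>x. ennreal (Im (f (Complex x y)))))
     (density \<rho> (\<lambda>s. ennreal (pi * (1 + s\<^sup>2)))) (at_right 0)"
  unfolding weak_limit_def
proof (intro allI impI, elim conjE)
  fix g :: "real \<Rightarrow> real"
  assume cont: "continuous_on UNIV g" and supp: "compact (closure {x. g x \<noteq> 0})"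
  note [measurable_cong] = rho_sets
  have [measurable]: "g \<in> borel_measurable borel" by (rule borel_measurable_continuous_onI[OF cont])
  obtain R where R: "R > 0" "\<And>x. g x \<noteq> 0 \<Longrightarrow> \<bar>x\<bar> \<le> R"
  proof -
    have "bounded {x. g x \<noteq> 0}" using supp by (meson bounded_subset closure_subset compact_imp_bounded)
    then obtain R where "R > 0" "\<forall>x\<in>{x. g x \<noteq> 0}. norm x \<le> R" by (auto simp: bounded_pos)
    then show thesis using that by auto
  qed
  obtain B where B: "B > 0" "\<And>x. \<bar>g x\<bar> \<le> B"
  proof -
    have "compact (g ` {-R..R})" by (intro compact_continuous_image continuous_on_subset[OF cont]) auto
    then obtain B where B: "B > 0" "\<forall>y\<in>g ` {-R..R}. norm y \<le> B" using compact_imp_bounded bounded_pos by metis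
    have "\<bar>g x\<bar> \<le> B" for x
      using B R(2)[of x] by (cases "g x = 0") (auto simp: abs_le_iff)
    then show thesis using that B by blast
  qed
  have bound_ind: "\<bar>g x\<bar> \<le> B * indicator {-R..R} x" for x
    using B(2)[of x] R(2)[of x] by (cases "g x = 0") (auto simp: indicator_def abs_le_iff)
  have int_g: "integrable lborel g"
  proof (rule Bochner_Integration.integrable_bound)
    show "integrable lborel (\<lambda>x. B * indicator {-R..R} x)"
      by (intro integrable_mult_right integrable_real_indicator) (auto simp: emeasure_lborel_Icc_eq)
    show "AE x in lborel. norm (g x) \<le> norm (B * indicator {-R..R} x)"
      unfolding real_norm_def by (intro AE_I2 order_trans[OF bound_ind abs_ge_self])
  qed simp
  define H where "H y s = (\<integral>x. g x * ((1 + s\<^sup>2) * (y / ((s - x)\<^sup>2 + y\<^sup>2))) \<partial>lborel)" for y s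
  have H_subst: "H y s = (1 + s\<^sup>2) * (\<integral>t. g (s + y * t) * (1 / (1 + t\<^sup>2)) \<partial>lborel)" if y: "0 < y" for y s
  proof -
    have e: "(s - (s + y * t))\<^sup>2 + y\<^sup>2 = y * (y * (1 + t\<^sup>2))" for t by (simp add: power2_eq_square algebra_simps)
    have "H y s = y * (\<integral>t. g (s + y * t) * ((1 + s\<^sup>2) * (y / ((s - (s + y * t))\<^sup>2 + y\<^sup>2))) \<partial>lborel)"
      unfolding H_def using y by (subst lborel_integral_real_affine[of y _ s]) auto
    also have "\<dots> = (\<integral>t. (1 + s\<^sup>2) * (g (s + y * t) * (1 / (1 + t\<^sup>2))) \<partial>lborel)"
      unfolding integral_mult_right_zero[symmetric] using y
      by (intro Bochner_Integration.integral_cong refl)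
         (unfold e, simp)
    finally show ?thesis by (simp only: integral_mult_right_zero)
  qed
  have fubini: "(\<integral>x. Im (f (Complex x y)) * g x \<partial>lborel) = \<beta> * y * (\<integral>x. g x \<partial>lborel) + (\<integral>s. H y s \<partial>\<rho>)"
    if y: "0 < y" for y
  proof -
    interpret P: pair_sigma_finite lborel \<rho> ..
    define h where "h x s = g x * ((1 + s\<^sup>2) * (y / ((s - x)\<^sup>2 + y\<^sup>2)))" for x s
    have [measurable]: "case_prod h \<in> borel_measurable (lborel \<Otimes>\<^sub>M \<rho>)"
      unfolding h_def by measurable
    define K where "K = B * (y * (2 + (1 + 2 * (R\<^sup>2 + y\<^sup>2)) / y\<^sup>2))"
    have hK: "\<bar>h x s\<bar> \<le> K" if x: "\<bar>x\<bar> \<le> R" for x s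
    proof -
      have "x\<^sup>2 \<le> R\<^sup>2" using power_mono[OF x, of 2] by simp
      have "(1 + s\<^sup>2) / ((s - x)\<^sup>2 + y\<^sup>2) \<le> 2 + (1 + 2 * (x\<^sup>2 + y\<^sup>2)) / y\<^sup>2"
        using representation_kernel_bound[of "Complex x y" s] y by (simp add: cmod_power2)
      also have "\<dots> \<le> 2 + (1 + 2 * (R\<^sup>2 + y\<^sup>2)) / y\<^sup>2"
        using \<open>x\<^sup>2 \<le> R\<^sup>2\<close> by (intro add_left_mono divide_right_mono) auto
      finally have k1: "y * ((1 + s\<^sup>2) / ((s - x)\<^sup>2 + y\<^sup>2)) \<le> y * (2 + (1 + 2 * (R\<^sup>2 + y\<^sup>2)) / y\<^sup>2)"
        using y by (intro mult_left_mono) auto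
      have k2: "0 \<le> y * ((1 + s\<^sup>2) / ((s - x)\<^sup>2 + y\<^sup>2))" using y by simp
      have "\<bar>g x\<bar> * (y * ((1 + s\<^sup>2) / ((s - x)\<^sup>2 + y\<^sup>2))) \<le> K"
        unfolding K_def by (rule mult_mono[OF B(2) k1 less_imp_le[OF B(1)] k2])
      moreover have "\<bar>h x s\<bar> = \<bar>g x\<bar> * (y * ((1 + s\<^sup>2) / ((s - x)\<^sup>2 + y\<^sup>2)))"
        using y by (simp add: h_def abs_mult mult_ac)
      ultimately show ?thesis by simp
    qed
    have int_h: "integrable (lborel \<Otimes>\<^sub>M \<rho>) (case_prod h)"
    proof (rule integrableI_bounded_set[where A = "{-R..R} \<times> UNIV" and B = K])
      have "emeasure (lborel \<Otimes>\<^sub>M \<rho>) ({-R..R} \<times> UNIV) = emeasure lborel {-R..R} * emeasure \<rho> UNIV"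
        using rho_sets by (intro \<rho>.emeasure_pair_measure_Times) auto
      also have "\<dots> < \<infinity>"
        using R(1) by (simp add: ennreal_mult_eq_top_iff less_top[symmetric])
      finally show "emeasure (lborel \<Otimes>\<^sub>M \<rho>) ({-R..R} \<times> UNIV) < \<infinity>" .
      show "AE x in lborel \<Otimes>\<^sub>M \<rho>. x \<in> {-R..R} \<times> UNIV \<longrightarrow> norm (case_prod h x) \<le> K"
        using hK by (intro AE_I2) (auto simp: abs_le_iff)
      have h0: "h x s = 0" if "x \<notin> {-R..R}" for x s using R(2)[of x] that by (auto simp: h_def abs_le_iff)
      have "case_prod h p = 0" if "p \<notin> {-R..R} \<times> UNIV" for p
        using h0[of "fst p" "snd p"] that by (cases p) (simp del: atLeastAtMost_iff)
      then show "AE x in lborel \<Otimes>\<^sub>M \<rho>. x \<notin> {-R..R} \<times> UNIV \<longrightarrow> case_prod h x = 0" by (intro AE_I2 impI)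
    qed (auto simp: rho_sets)
    have i1: "integrable lborel (\<lambda>x. \<integral>s. h x s \<partial>\<rho>)" using P.integrable_fst'[OF int_h] by simp
    have "(\<integral>x. Im (f (Complex x y)) * g x \<partial>lborel) = (\<integral>x. (\<beta> * y) * g x + (\<integral>s. h x s \<partial>\<rho>) \<partial>lborel)"
      by (intro Bochner_Integration.integral_cong refl)
         (simp add: Im_repr[OF y] h_def algebra_simps flip: integral_mult_right_zero)
    also have "\<dots> = \<beta> * y * (\<integral>x. g x \<partial>lborel) + (\<integral>x. (\<integral>s. h x s \<partial>\<rho>) \<partial>lborel)"
      using int_g i1 by simp
    also have "(\<integral>x. (\<integral>s. h x s \<partial>\<rho>) \<partial>lborel) = (\<integral>s. (\<integral>x. h x s \<partial>lborel) \<partial>\<rho>)"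
      using P.Fubini_integral[OF int_h] by simp
    finally show ?thesis by (simp add: H_def h_def)
  qed
  have H_bound: "\<bar>H y s\<bar> \<le> B * (2 * Y * (2 * R)) + B * (1 + 2 * R\<^sup>2) * pi" if y: "0 < y" "y \<le> Y" for y Y s
  proof -
    let ?u = "\<lambda>x. B * (2 * Y) * indicator {-R..R} x + B * (1 + 2 * R\<^sup>2) * (y / ((s - x)\<^sup>2 + y\<^sup>2))"
    have pw: "\<bar>g x * ((1 + s\<^sup>2) * (y / ((s - x)\<^sup>2 + y\<^sup>2)))\<bar> \<le> ?u x" for x
    proof (cases "g x = 0")
      case False
      then have x: "\<bar>x\<bar> \<le> R" by (rule R(2))
      define q where "q = (s - x)\<^sup>2 + y\<^sup>2"
      have q: "0 < q" using y by (simp add: q_def add_nonneg_pos)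
      have "s\<^sup>2 \<le> 2 * (s - x)\<^sup>2 + 2 * x\<^sup>2"
        using zero_le_power2[of "s - 2 * x"] by (simp add: power2_eq_square algebra_simps)
      moreover have "x\<^sup>2 \<le> R\<^sup>2" using power_mono[OF x abs_ge_zero, of 2] by simp
      moreover have "1 + u \<le> 2 * (v + w) + (1 + 2 * p)" if "u \<le> 2 * v + 2 * t" "t \<le> p" "0 \<le> w" for t u v w p :: real
        using that by argo
      ultimately have "1 + s\<^sup>2 \<le> 2 * q + (1 + 2 * R\<^sup>2)" unfolding q_def by (metis zero_le_power2)
      then have "(1 + s\<^sup>2) * (y / q) \<le> (2 * q + (1 + 2 * R\<^sup>2)) * (y / q)"
        using y q by (intro mult_right_mono) auto
      also have "\<dots> = 2 * y + (1 + 2 * R\<^sup>2) * (y / q)" using q by (simp add: field_simps)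
      also have "\<dots> \<le> 2 * Y + (1 + 2 * R\<^sup>2) * (y / q)" using y by simp
      finally have "\<bar>g x\<bar> * ((1 + s\<^sup>2) * (y / q)) \<le> B * (2 * Y + (1 + 2 * R\<^sup>2) * (y / q))"
        using B y q by (intro mult_mono) auto
      moreover have "\<bar>g x * ((1 + s\<^sup>2) * (y / q))\<bar> = \<bar>g x\<bar> * ((1 + s\<^sup>2) * (y / q))"
        using y q by (simp add: abs_mult)
      ultimately show ?thesis using x unfolding q_def[symmetric] by (simp add: algebra_simps abs_le_iff)
    qed (use y B in auto)
    have iu1: "integrable lborel (\<lambda>x. B * (2 * Y) * indicator {-R..R} x)"
      by (intro integrable_mult_right integrable_real_indicator) (auto simp: emeasure_lborel_Icc_eq)
    have iu2: "integrable lborel (\<lambda>x. B * (1 + 2 * R\<^sup>2) * (y / ((s - x)\<^sup>2 + y\<^sup>2)))"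
      using cauchy_kernel_integral(1)[OF y(1)] by (rule integrable_mult_right)
    have iu: "integrable lborel ?u" by (rule Bochner_Integration.integrable_add[OF iu1 iu2])
    have ih: "integrable lborel (\<lambda>x. g x * ((1 + s\<^sup>2) * (y / ((s - x)\<^sup>2 + y\<^sup>2))))"
    proof (rule Bochner_Integration.integrable_bound[OF iu])
      show "AE x in lborel. norm (g x * ((1 + s\<^sup>2) * (y / ((s - x)\<^sup>2 + y\<^sup>2)))) \<le> norm (?u x)"
        unfolding real_norm_def by (intro AE_I2 order_trans[OF pw abs_ge_self])
    qed measurable
    have "\<bar>H y s\<bar> \<le> (\<integral>x. \<bar>g x * ((1 + s\<^sup>2) * (y / ((s - x)\<^sup>2 + y\<^sup>2)))\<bar> \<partial>lborel)"
      unfolding H_def by (rule integral_abs_bound)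
    also have "\<dots> \<le> integral\<^sup>L lborel ?u"
      by (rule Bochner_Integration.integral_mono[OF integrable_abs[OF ih] iu pw])
    also have "integral\<^sup>L lborel ?u = B * (2 * Y) * (2 * R) + B * (1 + 2 * R\<^sup>2) * pi"
      unfolding Bochner_Integration.integral_add[OF iu1 iu2] integral_mult_right_zero
        cauchy_kernel_integral(2)[OF y(1)] using R(1) by simp
    finally show ?thesis by (simp add: mult_ac)
  qed
  have [measurable]: "H y \<in> borel_measurable \<rho>" for y
    unfolding H_def by measurable
  have H_lim: "(\<lambda>n. H (X n) s) \<longlonglongrightarrow> pi * (1 + s\<^sup>2) * g s" if X: "\<And>n. 0 < X n" "X \<longlonglongrightarrow> 0" for X s
  proof -
    have "(\<lambda>n. \<integral>t. g (s + X n * t) * (1 / (1 + t\<^sup>2)) \<partial>lborel) \<longlonglongrightarrow> (\<integral>t. g s * (1 / (1 + t\<^sup>2)) \<partial>lborel)"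
    proof (rule integral_dominated_convergence[where w = "\<lambda>t. B * (1 / (1 + t\<^sup>2))"])
      show "integrable lborel (\<lambda>t. B * (1 / (1 + t\<^sup>2)))"
        using cauchy_density_integral(1) by (rule integrable_mult_right)
      show "AE t in lborel. (\<lambda>n. g (s + X n * t) * (1 / (1 + t\<^sup>2))) \<longlonglongrightarrow> g s * (1 / (1 + t\<^sup>2))"
      proof (rule AE_I2)
        fix t
        have "(\<lambda>n. s + X n * t) \<longlonglongrightarrow> s + 0 * t" using X by (intro tendsto_intros)
        moreover have "isCont g s" using cont by (simp add: continuous_on_eq_continuous_at)
        ultimately have "(\<lambda>n. g (s + X n * t)) \<longlonglongrightarrow> g s" by (intro isCont_tendsto_compose[of s g]) auto
        then show "(\<lambda>n. g (s + X n * t) * (1 / (1 + t\<^sup>2))) \<longlonglongrightarrow> g s * (1 / (1 + t\<^sup>2))" by (rule tendsto_mult_right)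
      qed
      show "AE t in lborel. norm (g (s + X n * t) * (1 / (1 + t\<^sup>2))) \<le> B * (1 / (1 + t\<^sup>2))" for n
      proof (rule AE_I2)
        fix t :: real
        have "\<bar>1 / (1 + t\<^sup>2)\<bar> = 1 / (1 + t\<^sup>2)" by (intro abs_of_nonneg) simp
        then show "norm (g (s + X n * t) * (1 / (1 + t\<^sup>2))) \<le> B * (1 / (1 + t\<^sup>2))"
          unfolding real_norm_def abs_mult by (metis B(2) abs_ge_zero mult_right_mono)
      qed
    qed auto
    then have "(\<lambda>n. (1 + s\<^sup>2) * (\<integral>t. g (s + X n * t) * (1 / (1 + t\<^sup>2)) \<partial>lborel)) \<longlonglongrightarrow> (1 + s\<^sup>2) * (g s * pi)"
      unfolding integral_mult_right_zero cauchy_density_integral(2) by (intro tendsto_intros)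
    then show ?thesis using X by (simp add: H_subst mult_ac del: times_divide_eq_right)
  qed
  have nonneg: "0 \<le> Im (f (Complex x y))" if "0 < y" for x y
    using repr that by (simp add: Im_repr nevanlinna_representation_def integral_nonneg_AE)
  have lhs: "integral\<^sup>L (density lborel (\<lambda>x. ennreal (Im (f (Complex x y))))) g =
      \<beta> * y * (\<integral>x. g x \<partial>lborel) + (\<integral>s. H y s \<partial>\<rho>)" if y: "0 < y" for y
  proof -
    have [measurable]: "(\<lambda>x. Im (f (Complex x y))) \<in> borel_measurable borel"
      unfolding Im_repr[OF y] by measurable
    have "integral\<^sup>L (density lborel (\<lambda>x. ennreal (Im (f (Complex x y))))) g = (\<integral>x. Im (f (Complex x y)) * g x \<partial>lborel)"
      using nonneg[OF y] by (subst integral_density) auto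
    then show ?thesis using fubini[OF y] by simp
  qed
  have rhs: "integral\<^sup>L (density \<rho> (\<lambda>s. ennreal (pi * (1 + s\<^sup>2)))) g = (\<integral>s. pi * (1 + s\<^sup>2) * g s \<partial>\<rho>)"
    by (subst integral_density) auto
  show "((\<lambda>y. integral\<^sup>L (density lborel (\<lambda>x. ennreal (Im (f (Complex x y))))) g) \<longlongrightarrow>
      integral\<^sup>L (density \<rho> (\<lambda>s. ennreal (pi * (1 + s\<^sup>2)))) g) (at_right 0)"
    unfolding tendsto_at_iff_sequentially rhs
  proof (intro allI impI)
    fix X :: "nat \<Rightarrow> real" assume "\<forall>i. X i \<in> {0<..} - {0}" and X0: "X \<longlonglongrightarrow> 0"
    then have X: "0 < X n" for n by auto
    obtain Y where "\<And>n. norm (X n) \<le> Y"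
      using X0 convergent_imp_Bseq convergentI BseqE by metis
    then have Y: "X n \<le> Y" for n using abs_le_D1 by auto
    have "(\<lambda>n. \<integral>s. H (X n) s \<partial>\<rho>) \<longlonglongrightarrow> (\<integral>s. pi * (1 + s\<^sup>2) * g s \<partial>\<rho>)"
      using H_lim[OF X X0] H_bound[OF X Y]
      by (intro integral_dominated_convergence[where w = "\<lambda>s. B * (2 * Y * (2 * R)) + B * (1 + 2 * R\<^sup>2) * pi"]) auto
    moreover have "(\<lambda>n. \<beta> * X n * (\<integral>x. g x \<partial>lborel)) \<longlonglongrightarrow> \<beta> * 0 * (\<integral>x. g x \<partial>lborel)"
      using X0 by (intro tendsto_intros)
    ultimately have "(\<lambda>n. \<beta> * X n * (\<integral>x. g x \<partial>lborel) + (\<integral>s. H (X n) s \<partial>\<rho>)) \<longlonglongrightarrow>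
        \<beta> * 0 * (\<integral>x. g x \<partial>lborel) + (\<integral>s. pi * (1 + s\<^sup>2) * g s \<partial>\<rho>)" by (intro tendsto_add)
    then show "((\<lambda>y. integral\<^sup>L (density lborel (\<lambda>x. ennreal (Im (f (Complex x y))))) g) \<circ> X) \<longlonglongrightarrow>
        (\<integral>s. pi * (1 + s\<^sup>2) * g s \<partial>\<rho>)"
      by (simp add: o_def lhs X)
  qed
qed

theorem nevanlinna_measure_eq: "nevanlinna_measure f = density \<rho> (\<lambda>s. ennreal (pi * (1 + s\<^sup>2)))"
proof -
  note [measurable_cong] = rho_sets
  have "is_nevanlinna_measure f (density \<rho> (\<lambda>s. ennreal (pi * (1 + s\<^sup>2))))"
    unfolding is_nevanlinna_measure_def
  proof (intro conjI allI impI weak_limit_repr)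
    fix K :: "real set" assume K: "compact K"
    then obtain R where R: "\<And>x. x \<in> K \<Longrightarrow> \<bar>x\<bar> \<le> R" using compact_imp_bounded bounded_real by metis
    have [measurable]: "K \<in> sets borel" using K by (simp add: borel_compact)
    have "emeasure (density \<rho> (\<lambda>s. ennreal (pi * (1 + s\<^sup>2)))) K = (\<integral>\<^sup>+s. ennreal (pi * (1 + s\<^sup>2)) * indicator K s \<partial>\<rho>)"
      by (simp add: emeasure_density)
    also have "\<dots> \<le> (\<integral>\<^sup>+s. ennreal (pi * (1 + R\<^sup>2)) \<partial>\<rho>)"
    proof (intro nn_integral_mono)
      fix s
      have "s \<in> K \<Longrightarrow> s\<^sup>2 \<le> R\<^sup>2" using power_mono[OF R, of s 2] by simp
      then show "ennreal (pi * (1 + s\<^sup>2)) * indicator K s \<le> ennreal (pi * (1 + R\<^sup>2))"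
        by (auto simp: indicator_def intro!: ennreal_leI)
    qed
    also have "\<dots> < \<infinity>" by (simp add: rho_space ennreal_mult_eq_top_iff less_top[symmetric])
    finally show "emeasure (density \<rho> (\<lambda>s. ennreal (pi * (1 + s\<^sup>2)))) K < \<infinity>" .
  qed (simp add: rho_sets)
  then show ?thesis
    unfolding nevanlinna_measure_def using is_nevanlinna_measure_unique by (intro the_equality) auto
qed

end

section \<open>Regularity and boundary growth in the half plane\<close>

lemma gauge_measurable:
  assumes "regularity_gauge \<gamma>" "0 \<le> C"
  shows "(\<lambda>t. \<gamma> (C * \<bar>t - \<sigma>\<bar>)) \<in> borel_measurable borel"
proof -
  have "mono (\<lambda>t. \<gamma> (max 0 t))"
    using regularity_gaugeD(4)[OF assms(1)] by (intro monoI) auto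
  then have [measurable]: "(\<lambda>t. \<gamma> (max 0 t)) \<in> borel_measurable borel" by (rule borel_measurable_mono)
  have "(\<lambda>t. (\<lambda>u. \<gamma> (max 0 u)) (C * \<bar>t - \<sigma>\<bar>)) \<in> borel_measurable borel" by measurable
  moreover have "(\<lambda>t. (\<lambda>u. \<gamma> (max 0 u)) (C * \<bar>t - \<sigma>\<bar>)) = (\<lambda>t. \<gamma> (C * \<bar>t - \<sigma>\<bar>))"
    using assms(2) by (auto simp: max_def)
  ultimately show ?thesis by simp
qed

lemma one_divide_ennreal: "0 < x \<Longrightarrow> 1 / ennreal x = ennreal (1 / x)"
  using divide_ennreal[of 1 x] by simp

lemma ennreal_le_const_divide:
  assumes "0 \<le> u" "0 < K" "0 \<le> g" "u * g \<le> K"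
  shows "ennreal u \<le> ennreal K * (1 / ennreal g)"
proof (cases "g = 0")
  case True
  then show ?thesis using assms by (simp add: ennreal_mult_top)
next
  case False
  then have g: "0 < g" using assms by simp
  then have "u \<le> K * (1 / g)" using assms by (simp add: field_simps)
  then show ?thesis using assms g by (simp add: one_divide_ennreal ennreal_mult[symmetric] ennreal_leI)
qed

context
  fixes f \<beta> \<rho>
  assumes repr: "nevanlinna_representation f \<beta> \<rho>"
begin

interpretation \<rho>: finite_borel_measure \<rho>
  using repr by (simp add: nevanlinna_representation_def finite_borel_measure_def finite_borel_measure_axioms_def)

lemma repr_nn_integral:
  assumes z: "0 < Im z"
  shows "(\<integral>\<^sup>+s. ennreal ((1 + s\<^sup>2) / (cmod (of_real s - z))\<^sup>2) \<partial>\<rho>) = ennreal (Im (f z) / Im z - \<beta>)"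
    and "\<beta> \<le> Im (f z) / Im z"
proof -
  note [measurable_cong] = rho_sets[OF repr]
  let ?k = "\<lambda>s. (1 + s\<^sup>2) / (cmod (of_real s - z))\<^sup>2"
  have int: "integrable \<rho> ?k"
  proof (rule \<rho>.integrable_const_bound)
    show "AE s in \<rho>. norm (?k s) \<le> 2 + (1 + 2 * (cmod z)\<^sup>2) / (Im z)\<^sup>2"
      using representation_kernel_bound[OF z] by (intro AE_I2) simp
  qed measurable
  have "(\<integral>s. Im z * (1 + s\<^sup>2) / (cmod (of_real s - z))\<^sup>2 \<partial>\<rho>) = Im z * integral\<^sup>L \<rho> ?k"
    unfolding integral_mult_right_zero[symmetric] by simp
  then have eq: "Im (f z) / Im z - \<beta> = integral\<^sup>L \<rho> ?k"
    using repr z by (simp add: nevanlinna_representation_def field_simps)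
  show "(\<integral>\<^sup>+s. ennreal (?k s) \<partial>\<rho>) = ennreal (Im (f z) / Im z - \<beta>)"
    unfolding eq by (intro nn_integral_eq_integral[OF int]) simp
  have "0 \<le> integral\<^sup>L \<rho> ?k" by (intro integral_nonneg_AE) simp
  then show "\<beta> \<le> Im (f z) / Im z" using eq by linarith
qed

lemma nevanlinna_nn_integral:
  assumes [measurable]: "h \<in> borel_measurable borel"
  shows "(\<integral>\<^sup>+s. h s \<partial>nevanlinna_measure f) = (\<integral>\<^sup>+s. ennreal (pi * (1 + s\<^sup>2)) * h s \<partial>\<rho>)"
proof -
  note [measurable_cong] = rho_sets[OF repr]
  show ?thesis unfolding nevanlinna_measure_eq[OF repr] by (rule nn_integral_density) measurable
qed

text \<open>Regularity at \<open>\<sigma>\<close> bounds \<open>Im f(z) / Im z\<close> near \<open>\<sigma>\<close>, both in cones and above the curve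
  \<open>(Im z)\<^sup>2 = \<gamma>(2C |Re z - \<sigma>|) / \<kappa>\<close>. In either region \<open>\<gamma>(C |s - \<sigma>|) \<le> K |s - z|\<^sup>2\<close> for real \<open>s\<close> near \<open>\<sigma>\<close>;
  above the curve this holds where \<open>|s - \<sigma>| \<le> 2 |Re z - \<sigma>|\<close> because of the height of \<open>z\<close>, and in all other cases
  because \<open>|s - \<sigma>| = O(|s - z|)\<close> and \<open>\<gamma>(t) = O(t\<^sup>2)\<close>.\<close>

theorem regular_imp_bounded:
  assumes reg: "regularity_gauge \<gamma>" and gr: "gamma_regular \<gamma> f \<sigma>"
  obtains C where "0 < C" "\<And>\<kappa>. 0 < \<kappa> \<Longrightarrow> \<exists>N \<epsilon>. 0 < \<epsilon> \<and> (\<forall>z. 0 < Im z \<and> cmod (z - of_real \<sigma>) < \<epsilon> \<and>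
      (\<bar>Re z - \<sigma>\<bar> \<le> \<kappa> * Im z \<or> \<gamma> (2 * C * \<bar>Re z - \<sigma>\<bar>) \<le> \<kappa> * (Im z)\<^sup>2) \<longrightarrow> Im (f z) \<le> N * Im z)"
proof -
  note \<gamma> = regularity_gaugeD[OF reg]
  note [measurable_cong] = rho_sets[OF repr]
  obtain C U where C: "0 < C" and U: "open U" "\<sigma> \<in> U"
    and fin: "(\<integral>\<^sup>+t\<in>U. 1 / ennreal (\<gamma> (C * \<bar>t - \<sigma>\<bar>)) \<partial>nevanlinna_measure f) < \<infinity>"
    using gr by (auto simp: gamma_regular_def)
  obtain M r where M: "0 < M" "0 < r" "\<And>t. 0 \<le> t \<Longrightarrow> t \<le> r \<Longrightarrow> \<gamma> t \<le> M * t\<^sup>2"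
    using regularity_gauge_quadratic[OF reg] by blast
  obtain e where e: "0 < e" "ball \<sigma> e \<subseteq> U" using U openE by blast
  define \<epsilon> where "\<epsilon> = min e (r / C)"
  have \<epsilon>: "0 < \<epsilon>" using e M C by (simp add: \<epsilon>_def)
  have in_U: "s \<in> U" if "\<bar>s - \<sigma>\<bar> < \<epsilon>" for s
    using e(2) that by (auto simp: \<epsilon>_def dist_real_def abs_minus_commute subset_iff)
  have quad: "\<gamma> (C * \<bar>s - \<sigma>\<bar>) \<le> M * C\<^sup>2 * (s - \<sigma>)\<^sup>2" if "\<bar>s - \<sigma>\<bar> < \<epsilon>" for s
  proof -
    have "C * \<bar>s - \<sigma>\<bar> \<le> r" using that C by (simp add: \<epsilon>_def field_simps)
    then have "\<gamma> (C * \<bar>s - \<sigma>\<bar>) \<le> M * (C * \<bar>s - \<sigma>\<bar>)\<^sup>2" using C by (intro M(3)) auto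
    then show ?thesis by (simp add: power_mult_distrib mult_ac)
  qed
  have U_meas [measurable]: "U \<in> sets borel" using U by simp
  have g_meas [measurable]: "(\<lambda>t. \<gamma> (C * \<bar>t - \<sigma>\<bar>)) \<in> borel_measurable borel"
    using gauge_measurable[OF reg] C by simp
  define w where "w s = ennreal (pi * (1 + s\<^sup>2)) * (1 / ennreal (\<gamma> (C * \<bar>s - \<sigma>\<bar>)) * indicator U s)" for s
  have [measurable]: "w \<in> borel_measurable borel" unfolding w_def by measurable
  have "(\<integral>\<^sup>+s. w s \<partial>\<rho>) < \<infinity>"
    using fin unfolding w_def by (subst (asm) nevanlinna_nn_integral) measurable
  then obtain I where I: "0 \<le> I" "(\<integral>\<^sup>+s. w s \<partial>\<rho>) = ennreal I"
    by (metis ennreal_cases infinity_ennreal_def less_irrefl)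
  show thesis
  proof (rule that[OF C])
    fix \<kappa> :: real assume \<kappa>: "0 < \<kappa>"
    \<comment> \<open>\<open>K1\<close> serves the points \<open>s\<close> near \<open>\<sigma>\<close>, one summand for each of the three cases below; \<open>K2\<close> serves the others.\<close>
    define K1 where "K1 = M * C\<^sup>2 * (1 + \<kappa>)\<^sup>2 + \<kappa> + M * C\<^sup>2 * 4"
    define K2 where "K2 = 4 * ((1 + 2 * \<sigma>\<^sup>2) / \<epsilon>\<^sup>2 + 2)"
    have K1: "0 < K1" using M C \<kappa> by (simp add: K1_def add_nonneg_pos add_pos_nonneg)
    have K2: "0 \<le> K2" by (simp add: K2_def)
    have mono: "M * C\<^sup>2 * (1 + \<kappa>)\<^sup>2 * u \<le> K1 * u" "\<kappa> * u \<le> K1 * u" "M * C\<^sup>2 * 4 * u \<le> K1 * u" if "0 \<le> u" for u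
      using that M C \<kappa> by (auto intro!: mult_right_mono simp: K1_def)
    define N where "N = \<beta> + (K1 / pi * I + K2 * measure \<rho> UNIV)"
    have "Im (f z) \<le> N * Im z" if z: "0 < Im z" "cmod (z - of_real \<sigma>) < \<epsilon> / 2"
      and reg: "\<bar>Re z - \<sigma>\<bar> \<le> \<kappa> * Im z \<or> \<gamma> (2 * C * \<bar>Re z - \<sigma>\<bar>) \<le> \<kappa> * (Im z)\<^sup>2" for z
    proof -
      have x: "\<bar>Re z - \<sigma>\<bar> < \<epsilon> / 2" using abs_Re_le_cmod[of "z - of_real \<sigma>"] z by simp
      have d: "\<bar>s - Re z\<bar> \<le> cmod (of_real s - z)" "Im z \<le> cmod (of_real s - z)" for s
        using abs_Re_le_cmod[of "of_real s - z"] abs_Im_le_cmod[of "of_real s - z"] by auto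
      have far: "(s - \<sigma>)\<^sup>2 \<le> 4 * (cmod (of_real s - z))\<^sup>2" if "2 * \<bar>Re z - \<sigma>\<bar> \<le> \<bar>s - \<sigma>\<bar>" for s
      proof -
        have "\<bar>s - \<sigma>\<bar> \<le> \<bar>s - Re z\<bar> + \<bar>Re z - \<sigma>\<bar>" by linarith
        then have "\<bar>s - \<sigma>\<bar> \<le> 2 * cmod (of_real s - z)" using that d(1)[of s] by argo
        then have "\<bar>s - \<sigma>\<bar>\<^sup>2 \<le> (2 * cmod (of_real s - z))\<^sup>2" by (intro power_mono) auto
        then show ?thesis by (simp add: power_mult_distrib)
      qed
      have near: "\<gamma> (C * \<bar>s - \<sigma>\<bar>) \<le> K1 * (cmod (of_real s - z))\<^sup>2" if s: "\<bar>s - \<sigma>\<bar> < \<epsilon>" for s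
      proof -
        consider "\<bar>Re z - \<sigma>\<bar> \<le> \<kappa> * Im z" | "\<bar>s - \<sigma>\<bar> \<le> 2 * \<bar>Re z - \<sigma>\<bar>" "\<gamma> (2 * C * \<bar>Re z - \<sigma>\<bar>) \<le> \<kappa> * (Im z)\<^sup>2"
          | "2 * \<bar>Re z - \<sigma>\<bar> \<le> \<bar>s - \<sigma>\<bar>" using reg by linarith
        then show ?thesis
        proof cases
          case 1
          have "\<bar>s - \<sigma>\<bar> \<le> \<bar>s - Re z\<bar> + \<kappa> * Im z" using 1 by linarith
          also have "\<dots> \<le> cmod (of_real s - z) + \<kappa> * cmod (of_real s - z)"
            using d[of s] \<kappa> by (intro add_mono mult_left_mono) auto
          finally have "\<bar>s - \<sigma>\<bar> \<le> (1 + \<kappa>) * cmod (of_real s - z)" by (simp add: algebra_simps)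
          then have "\<bar>s - \<sigma>\<bar>\<^sup>2 \<le> ((1 + \<kappa>) * cmod (of_real s - z))\<^sup>2" by (intro power_mono) auto
          then have "M * C\<^sup>2 * (s - \<sigma>)\<^sup>2 \<le> M * C\<^sup>2 * ((1 + \<kappa>) * cmod (of_real s - z))\<^sup>2"
            using M by (intro mult_left_mono) auto
          also have "\<dots> \<le> K1 * (cmod (of_real s - z))\<^sup>2"
            using mono(1)[of "(cmod (of_real s - z))\<^sup>2"] by (simp add: power_mult_distrib mult_ac)
          finally show ?thesis using quad[OF s] by linarith
        next
          case 2
          have "C * \<bar>s - \<sigma>\<bar> \<le> 2 * C * \<bar>Re z - \<sigma>\<bar>" using 2(1) C by simp
          then have "\<gamma> (C * \<bar>s - \<sigma>\<bar>) \<le> \<gamma> (2 * C * \<bar>Re z - \<sigma>\<bar>)" using C by (intro \<gamma>(4)) auto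
          also have "\<dots> \<le> \<kappa> * (Im z)\<^sup>2" by (rule 2)
          also have "\<dots> \<le> \<kappa> * (cmod (of_real s - z))\<^sup>2" using d(2)[of s] z \<kappa> by (intro mult_left_mono power_mono) auto
          also have "\<dots> \<le> K1 * (cmod (of_real s - z))\<^sup>2" by (rule mono) simp
          finally show ?thesis .
        next
          case 3
          have "M * C\<^sup>2 * (s - \<sigma>)\<^sup>2 \<le> M * C\<^sup>2 * (4 * (cmod (of_real s - z))\<^sup>2)"
            using far[OF 3] M by (intro mult_left_mono) auto
          then show ?thesis using quad[OF s] mono(3)[of "(cmod (of_real s - z))\<^sup>2"] by simp
        qed
      qed
      have pw: "ennreal ((1 + s\<^sup>2) / (cmod (of_real s - z))\<^sup>2) \<le> ennreal (K1 / pi) * w s + ennreal K2" for s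
      proof (cases "\<bar>s - \<sigma>\<bar> < \<epsilon>")
        case True
        define q where "q = (cmod (of_real s - z))\<^sup>2"
        have q: "0 < q" unfolding q_def using d(2)[of s] z by (intro zero_less_power) linarith
        have "ennreal (1 / q) \<le> ennreal K1 * (1 / ennreal (\<gamma> (C * \<bar>s - \<sigma>\<bar>)))"
          using near[OF True] q K1 C \<gamma>(1)[of "C * \<bar>s - \<sigma>\<bar>"]
          by (intro ennreal_le_const_divide) (auto simp: q_def[symmetric] field_simps)
        then have "ennreal (1 + s\<^sup>2) * ennreal (1 / q) \<le> ennreal (1 + s\<^sup>2) * (ennreal K1 * (1 / ennreal (\<gamma> (C * \<bar>s - \<sigma>\<bar>))))"
          by (rule mult_left_mono) simp
        also have "ennreal (1 + s\<^sup>2) * ennreal (1 / q) = ennreal ((1 + s\<^sup>2) / q)"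
          using q by (subst ennreal_mult[symmetric]) auto
        also have "ennreal (1 + s\<^sup>2) * (ennreal K1 * (1 / ennreal (\<gamma> (C * \<bar>s - \<sigma>\<bar>)))) =
            (ennreal (K1 / pi) * ennreal (pi * (1 + s\<^sup>2))) * (1 / ennreal (\<gamma> (C * \<bar>s - \<sigma>\<bar>)))"
        proof -
          have "ennreal (K1 / pi) * ennreal (pi * (1 + s\<^sup>2)) = ennreal (1 + s\<^sup>2) * ennreal K1"
            using K1 by (simp add: ennreal_mult[symmetric] mult.commute del: ennreal_plus)
          then show ?thesis by (simp add: mult.assoc)
        qed
        also have "\<dots> = ennreal (K1 / pi) * w s" using in_U[OF True] by (simp add: w_def mult.assoc)
        finally show ?thesis unfolding q_def by (rule order_trans) simp
      next
        case False
        define q where "q = (s - \<sigma>)\<^sup>2"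
        have "\<epsilon>\<^sup>2 \<le> \<bar>s - \<sigma>\<bar>\<^sup>2" using False \<epsilon> by (intro power_mono) auto
        then have q: "\<epsilon>\<^sup>2 \<le> q" "0 < q" using \<epsilon> by (auto simp: q_def intro: less_le_trans[of _ "\<epsilon>\<^sup>2"])
        have "s\<^sup>2 \<le> 2 * \<sigma>\<^sup>2 + 2 * q"
          using zero_le_power2[of "s - 2 * \<sigma>"] by (simp add: q_def power2_eq_square algebra_simps)
        then have "1 + s\<^sup>2 \<le> (1 + 2 * \<sigma>\<^sup>2) * 1 + 2 * q" by simp
        also have "\<dots> \<le> (1 + 2 * \<sigma>\<^sup>2) * (q / \<epsilon>\<^sup>2) + 2 * q"
          using q \<epsilon> by (intro add_right_mono mult_left_mono) auto
        also have "\<dots> = K2 * (q / 4)" by (simp add: K2_def algebra_simps add_divide_distrib)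
        also have "\<dots> \<le> K2 * (cmod (of_real s - z))\<^sup>2"
          using far[of s] False x K2 by (intro mult_left_mono) (auto simp: q_def)
        finally have "(1 + s\<^sup>2) / (cmod (of_real s - z))\<^sup>2 \<le> K2"
          using d(2)[of s] z by (subst pos_divide_le_eq) (auto simp: zero_less_power)
        then show ?thesis by (intro add_increasing ennreal_leI) simp_all
      qed
      have "ennreal (Im (f z) / Im z - \<beta>) \<le> (\<integral>\<^sup>+s. ennreal (K1 / pi) * w s + ennreal K2 \<partial>\<rho>)"
        unfolding repr_nn_integral(1)[OF z(1), symmetric] using pw by (intro nn_integral_mono)
      also have "\<dots> = ennreal (K1 / pi) * ennreal I + ennreal K2 * emeasure \<rho> UNIV"
        by (simp add: nn_integral_add nn_integral_cmult I rho_space[OF repr])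
      also have "\<dots> = ennreal (K1 / pi * I + K2 * measure \<rho> UNIV)"
      proof -
        have "ennreal (K1 / pi * I) = ennreal (K1 / pi) * ennreal I"
          using K1 I(1) by (intro ennreal_mult) auto
        moreover have "ennreal (K2 * measure \<rho> UNIV) = ennreal K2 * emeasure \<rho> UNIV"
          unfolding \<rho>.emeasure_eq_measure using K2 by (intro ennreal_mult) auto
        ultimately show ?thesis using K1 K2 I(1) by (subst ennreal_plus) auto
      qed
      finally have "Im (f z) / Im z - \<beta> \<le> K1 / pi * I + K2 * measure \<rho> UNIV"
        using K1 K2 I by (subst (asm) ennreal_le_iff) auto
      then have "Im (f z) / Im z \<le> N" by (simp add: N_def)
      then show ?thesis using z(1) by (simp add: divide_le_eq)
    qed
    then show "\<exists>N \<epsilon>. 0 < \<epsilon> \<and> (\<forall>z. 0 < Im z \<and> cmod (z - of_real \<sigma>) < \<epsilon> \<and>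
      (\<bar>Re z - \<sigma>\<bar> \<le> \<kappa> * Im z \<or> \<gamma> (2 * C * \<bar>Re z - \<sigma>\<bar>) \<le> \<kappa> * (Im z)\<^sup>2) \<longrightarrow> Im (f z) \<le> N * Im z)"
      using \<epsilon> by (intro exI[of _ N] exI[of _ "\<epsilon> / 2"]) auto
  qed
qed

end

lemma abs_arctan_le: "\<bar>arctan x\<bar> \<le> \<bar>x\<bar>"
proof -
  have pos: "arctan x \<le> x" if "0 < x" for x
  proof -
    have "\<exists>z. 0 < z \<and> z < x \<and> arctan x - arctan 0 = (x - 0) * inverse (1 + z\<^sup>2)"
      using that by (intro MVT2) (auto intro: DERIV_arctan)
    then obtain z where z: "arctan x = x * inverse (1 + z\<^sup>2)" by auto
    have "inverse (1 + z\<^sup>2) \<le> 1" by (simp add: inverse_le_1_iff)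
    then show ?thesis unfolding z using that by (simp add: mult_left_le)
  qed
  consider "x < 0" | "x = 0" | "0 < x" by linarith
  then show ?thesis
  proof cases
    case 1
    then show ?thesis using pos[of "- x"] by (simp add: arctan_minus)
  next
    case 3
    then show ?thesis using pos[of x] by simp
  qed simp
qed

context
  fixes f \<beta> \<rho>
  assumes repr: "nevanlinna_representation f \<beta> \<rho>"
begin

interpretation \<rho>: finite_borel_measure \<rho>
  using repr by (simp add: nevanlinna_representation_def finite_borel_measure_def finite_borel_measure_axioms_def)

text \<open>Give the real point \<open>s\<close> the parameter \<open>\<theta> = 2 arctan s\<close>, and let \<open>Im f / Im z\<close> be bounded along a curve
  \<open>\<zeta>(t)\<close> whose distance from \<open>s\<close> is \<open>O(|\<theta> - t| + h(t))\<close>, where \<open>h(t) = D \<gamma>(C|t|)\<close>. Then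
  \<open>\<integral> (1 + s\<^sup>2) / (|\<theta> - t| + h(t))\<^sup>2 d\<rho>(s)\<close> is bounded in \<open>t\<close>. Every small \<open>\<theta> \<noteq> 0\<close> satisfies
  \<open>1/(4 h(\<theta>)) \<le> \<integral> dt / (|\<theta> - t| + h(t))\<^sup>2\<close>, because the \<open>t\<close> between \<open>0\<close> and \<open>\<theta>\<close> at distance at most \<open>h(\<theta>)\<close>
  from \<open>\<theta>\<close> form an interval of length \<open>h(\<theta>)\<close> on which \<open>h(t) \<le> h(\<theta>)\<close>. Integration in \<open>s\<close> and Tonelli's
  theorem bound the integral of \<open>1/h(\<theta>)\<close>; no point mass at \<open>0\<close> can occur.\<close>

theorem bounded_on_curve_imp_regular:
  assumes reg: "regularity_gauge \<gamma>" and C: "0 < C" and D: "0 < D" and e: "0 < e" and K: "0 < K"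
    and bd: "\<And>t. 0 < \<bar>t\<bar> \<Longrightarrow> \<bar>t\<bar> < e \<Longrightarrow> 0 < Im (\<zeta> t) \<and> Im (f (\<zeta> t)) \<le> N * Im (\<zeta> t)"
    and dist: "\<And>s t. \<bar>s\<bar> \<le> 1 \<Longrightarrow> 0 < \<bar>t\<bar> \<Longrightarrow> \<bar>t\<bar> < e \<Longrightarrow>
      cmod (of_real s - \<zeta> t) \<le> K * (\<bar>2 * arctan s - t\<bar> + D * \<gamma> (C * \<bar>t\<bar>))"
  shows "gamma_regular \<gamma> f 0"
proof -
  note \<gamma> = regularity_gaugeD[OF reg]
  note [measurable_cong] = rho_sets[OF repr]
  define \<theta> where "\<theta> s = 2 * arctan s" for s :: real
  define h where "h t = D * \<gamma> (C * \<bar>t\<bar>)" for t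
  have \<theta>_le: "\<bar>\<theta> s\<bar> \<le> 2 * \<bar>s\<bar>" for s using abs_arctan_le[of s] by (simp add: \<theta>_def abs_mult)
  have \<theta>_nz: "\<theta> s \<noteq> 0" if "s \<noteq> 0" for s using that by (simp add: \<theta>_def)
  have [measurable]: "\<theta> \<in> borel_measurable borel"
    unfolding \<theta>_def by (intro borel_measurable_continuous_onI continuous_intros)
  have [measurable]: "(\<lambda>t. \<gamma> (A * \<bar>t\<bar>)) \<in> borel_measurable borel" if "0 < A" for A
    using gauge_measurable[OF reg, of A 0] that by simp
  have h_meas [measurable]: "h \<in> borel_measurable borel"
    unfolding h_def using C by measurable
  have h_pos: "0 < h t" if "t \<noteq> 0" for t using that C D \<gamma>(2) by (simp add: h_def)
  have h_mono: "h t \<le> h u" if "\<bar>t\<bar> \<le> \<bar>u\<bar>" for t u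
    unfolding h_def using that C D by (intro mult_left_mono \<gamma>(4)) auto
  obtain M r where M: "0 < M" "0 < r" "\<And>t. 0 \<le> t \<Longrightarrow> t \<le> r \<Longrightarrow> \<gamma> t \<le> M * t\<^sup>2"
    using regularity_gauge_quadratic[OF reg] by blast
  \<comment> \<open>The last two entries make \<open>h(t) \<le> |t|\<close> for \<open>|t| < \<epsilon>\<close>.\<close>
  define \<epsilon> where "\<epsilon> = min 1 (min e (min (r / C) (1 / (D * M * C\<^sup>2))))"
  have \<epsilon>: "0 < \<epsilon>" "\<epsilon> \<le> e" "\<epsilon> \<le> 1" using e M C D by (auto simp: \<epsilon>_def)
  have h_le: "h t \<le> \<bar>t\<bar>" if "\<bar>t\<bar> < \<epsilon>" for t
  proof -
    have "C * \<bar>t\<bar> \<le> r" using that C by (simp add: \<epsilon>_def field_simps)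
    then have "h t \<le> D * (M * (C * \<bar>t\<bar>)\<^sup>2)" unfolding h_def using C D by (intro mult_left_mono M(3)) auto
    also have "\<dots> = (D * M * C\<^sup>2 * \<bar>t\<bar>) * \<bar>t\<bar>" by (simp add: power_mult_distrib power2_eq_square)
    also have "\<dots> \<le> 1 * \<bar>t\<bar>"
      using that C D M by (intro mult_right_mono) (auto simp: \<epsilon>_def field_simps)
    finally show ?thesis by simp
  qed
  define T where "T = {t :: real. 0 < \<bar>t\<bar> \<and> \<bar>t\<bar> < \<epsilon>}"
  have [measurable]: "T \<in> sets borel" unfolding T_def by measurable
  define G where "G t s = indicator {-1..1} s / (\<bar>\<theta> s - t\<bar> + h t)\<^sup>2" for t s
  have [measurable]: "(\<lambda>(t, s). G t s) \<in> borel_measurable (borel \<Otimes>\<^sub>M borel)"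
    unfolding G_def by measurable
  have int_G: "(\<integral>\<^sup>+s. ennreal ((1 + s\<^sup>2) * G t s) \<partial>\<rho>) \<le> ennreal (K\<^sup>2 * N)" if t: "t \<in> T" for t
  proof -
    have t': "0 < \<bar>t\<bar>" "\<bar>t\<bar> < e" using t \<epsilon> by (auto simp: T_def)
    have z: "0 < Im (\<zeta> t)" "Im (f (\<zeta> t)) \<le> N * Im (\<zeta> t)" using bd[OF t'] by auto
    have "(1 + s\<^sup>2) * G t s \<le> K\<^sup>2 * ((1 + s\<^sup>2) / (cmod (of_real s - \<zeta> t))\<^sup>2)" for s
    proof (cases "\<bar>s\<bar> \<le> 1")
      case True
      define p where "p = \<bar>\<theta> s - t\<bar> + h t"
      have p: "0 < p" using h_pos[of t] t' by (simp add: p_def)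
      have q: "0 < cmod (of_real s - \<zeta> t)" using z(1) by (auto simp: complex_eq_iff)
      have "(cmod (of_real s - \<zeta> t))\<^sup>2 \<le> (K * p)\<^sup>2"
        using dist[OF True t'] by (intro power_mono) (auto simp: p_def h_def \<theta>_def)
      then have "(1 + s\<^sup>2) * (cmod (of_real s - \<zeta> t))\<^sup>2 \<le> (1 + s\<^sup>2) * (K\<^sup>2 * p\<^sup>2)"
        by (intro mult_left_mono) (auto simp: power_mult_distrib)
      then have "(1 + s\<^sup>2) / p\<^sup>2 \<le> K\<^sup>2 * (1 + s\<^sup>2) / (cmod (of_real s - \<zeta> t))\<^sup>2"
        using p q by (subst frac_le_eq) (auto simp: divide_le_0_iff mult_ac)
      then show ?thesis using True by (simp add: G_def p_def[symmetric] abs_le_iff)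
    next
      case False
      then have "s \<notin> {-1..1}" by auto
      then have "G t s = 0" unfolding G_def by (simp del: atLeastAtMost_iff)
      then show ?thesis by simp
    qed
    then have "(\<integral>\<^sup>+s. ennreal ((1 + s\<^sup>2) * G t s) \<partial>\<rho>) \<le>
        (\<integral>\<^sup>+s. ennreal (K\<^sup>2) * ennreal ((1 + s\<^sup>2) / (cmod (of_real s - \<zeta> t))\<^sup>2) \<partial>\<rho>)"
      by (intro nn_integral_mono) (simp add: ennreal_mult[symmetric] ennreal_leI)
    also have "\<dots> = ennreal (K\<^sup>2) * (\<integral>\<^sup>+s. ennreal ((1 + s\<^sup>2) / (cmod (of_real s - \<zeta> t))\<^sup>2) \<partial>\<rho>)"
      by (rule nn_integral_cmult) measurable
    also have "\<dots> = ennreal (K\<^sup>2) * ennreal (Im (f (\<zeta> t)) / Im (\<zeta> t) - \<beta>)"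
      by (simp only: repr_nn_integral(1)[OF repr z(1)])
    also have "\<dots> \<le> ennreal (K\<^sup>2) * ennreal N"
    proof (intro mult_left_mono ennreal_leI)
      have "Im (f (\<zeta> t)) / Im (\<zeta> t) \<le> N" using z by (simp add: divide_le_eq)
      then show "Im (f (\<zeta> t)) / Im (\<zeta> t) - \<beta> \<le> N" using repr by (simp add: nevanlinna_representation_def)
    qed simp
    also have "\<dots> = ennreal (K\<^sup>2 * N)"
    proof -
      have "\<beta> \<le> Im (f (\<zeta> t)) / Im (\<zeta> t)" by (rule repr_nn_integral(2)[OF repr z(1)])
      also have "\<dots> \<le> N" using z by (simp add: divide_le_eq)
      finally have "0 \<le> N" using repr by (simp add: nevanlinna_representation_def)
      then show ?thesis by (subst ennreal_mult) auto
    qed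
    finally show ?thesis .
  qed
  have null: "emeasure \<rho> {0} = 0"
  proof -
    have "measure \<rho> {0} \<le> max 0 (K\<^sup>2 * N) * (2 * t)\<^sup>2" if t: "0 < t" "t < \<epsilon>" for t
    proof -
      have tT: "t \<in> T" using t by (simp add: T_def)
      have "ennreal (G t 0) * emeasure \<rho> {0} = (\<integral>\<^sup>+s. ennreal (G t 0) * indicator {0} s \<partial>\<rho>)"
        by (subst nn_integral_cmult_indicator) auto
      also have "\<dots> \<le> (\<integral>\<^sup>+s. ennreal ((1 + s\<^sup>2) * G t s) \<partial>\<rho>)"
        by (intro nn_integral_mono) (auto simp: indicator_def)
      also have "\<dots> \<le> ennreal (K\<^sup>2 * N)" by (rule int_G[OF tT])
      also have "\<dots> \<le> ennreal (max 0 (K\<^sup>2 * N))" by (intro ennreal_leI) simp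
      also have "ennreal (G t 0) * emeasure \<rho> {0} = ennreal (G t 0 * measure \<rho> {0})"
        unfolding \<rho>.emeasure_eq_measure by (rule ennreal_mult[symmetric]) (auto simp: G_def)
      finally have "ennreal (G t 0 * measure \<rho> {0}) \<le> ennreal (max 0 (K\<^sup>2 * N))" .
      then have le: "G t 0 * measure \<rho> {0} \<le> max 0 (K\<^sup>2 * N)" by (subst (asm) ennreal_le_iff) auto
      have p: "0 < t + h t" "t + h t \<le> 2 * t" using h_pos[of t] h_le[of t] t by auto
      have "measure \<rho> {0} \<le> max 0 (K\<^sup>2 * N) * (t + h t)\<^sup>2"
        using le p t by (simp add: G_def \<theta>_def pos_divide_le_eq zero_less_power)
      also have "\<dots> \<le> max 0 (K\<^sup>2 * N) * (2 * t)\<^sup>2" using p by (intro mult_left_mono power_mono) auto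
      finally show ?thesis .
    qed
    then have "\<forall>\<^sub>F t in at_right 0. measure \<rho> {0} \<le> max 0 (K\<^sup>2 * N) * (2 * t)\<^sup>2"
      using \<epsilon>(1) by (auto simp: eventually_at_right_field)
    moreover have "((\<lambda>t. max 0 (K\<^sup>2 * N) * (2 * t)\<^sup>2) \<longlongrightarrow> 0) (at_right 0)" by (auto intro!: tendsto_eq_intros)
    ultimately have "measure \<rho> {0} \<le> 0" by (intro tendsto_lowerbound) auto
    then show ?thesis by (simp add: \<rho>.emeasure_eq_measure measure_le_0_iff)
  qed
  have lower: "ennreal (1 / (4 * h (\<theta> s))) \<le> (\<integral>\<^sup>+t. ennreal (G t s) * indicator T t \<partial>lborel)"
    if s: "\<theta> s \<noteq> 0" "\<bar>\<theta> s\<bar> < \<epsilon>" "s \<in> {-1..1}" for s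
  proof -
    define a where "a = \<theta> s"
    have ha: "0 < h a" "h a \<le> \<bar>a\<bar>" using h_pos[of a] h_le[of a] s by (auto simp: a_def)
    define J where "J = (if 0 < a then {a - h a<..a} else {a..<a + h a})"
    have J: "J \<in> sets lborel" "emeasure lborel J = ennreal (h a)" using ha by (auto simp: J_def)
    have J_in: "\<bar>t\<bar> \<le> \<bar>a\<bar>" "\<bar>a - t\<bar> \<le> h a" "t \<noteq> 0" if "t \<in> J" for t
      using that ha s by (auto simp: J_def a_def split: if_splits)
    have "ennreal (1 / (4 * h a)) = ennreal (1 / (2 * h a)\<^sup>2) * ennreal (h a)"
      using ha by (subst ennreal_mult[symmetric]) (auto simp: power2_eq_square)
    also have "\<dots> = (\<integral>\<^sup>+t. ennreal (1 / (2 * h a)\<^sup>2) * indicator J t \<partial>lborel)"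
      using J by (subst nn_integral_cmult_indicator) auto
    also have "\<dots> \<le> (\<integral>\<^sup>+t. ennreal (G t s) * indicator T t \<partial>lborel)"
    proof (intro nn_integral_mono)
      fix t
      show "ennreal (1 / (2 * h a)\<^sup>2) * indicator J t \<le> ennreal (G t s) * indicator T t"
      proof (cases "t \<in> J")
        case True
        have "\<bar>a - t\<bar> + h t \<le> 2 * h a" using J_in[OF True] h_mono[of t a] by linarith
        moreover have "0 < \<bar>a - t\<bar> + h t" using h_pos[OF J_in(3)[OF True]] by simp
        ultimately have "1 / (2 * h a)\<^sup>2 \<le> 1 / (\<bar>a - t\<bar> + h t)\<^sup>2"
          by (intro divide_left_mono power_mono mult_pos_pos) auto
        also have "\<dots> = G t s" using s(3) by (simp add: G_def a_def del: atLeastAtMost_iff)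
        finally have "1 / (2 * h a)\<^sup>2 \<le> G t s" .
        moreover have "t \<in> T" using J_in[OF True] s by (auto simp: T_def a_def)
        ultimately show ?thesis using True by (simp add: ennreal_leI)
      qed simp
    qed
    finally show ?thesis by (simp add: a_def)
  qed
  define U where "U = {- (\<epsilon> / 2)<..<\<epsilon> / 2}"
  interpret P: pair_sigma_finite lborel \<rho> ..
  have "(\<integral>\<^sup>+s\<in>U. 1 / ennreal (\<gamma> (2 * C * \<bar>s - 0\<bar>)) \<partial>nevanlinna_measure f) =
      (\<integral>\<^sup>+s. ennreal (pi * (1 + s\<^sup>2)) * (1 / ennreal (\<gamma> (2 * C * \<bar>s - 0\<bar>)) * indicator U s) \<partial>\<rho>)"
    using C by (intro nevanlinna_nn_integral[OF repr]) (simp add: U_def)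
  also have "\<dots> \<le> (\<integral>\<^sup>+s. (\<integral>\<^sup>+t. ennreal (4 * D * pi) * (ennreal ((1 + s\<^sup>2) * G t s) * indicator T t) \<partial>lborel) \<partial>\<rho>)"
  proof (rule nn_integral_mono_AE)
    have "AE s in \<rho>. s \<noteq> 0" using null by (intro AE_I[of _ _ "{0}"]) auto
    then show "AE s in \<rho>. ennreal (pi * (1 + s\<^sup>2)) * (1 / ennreal (\<gamma> (2 * C * \<bar>s - 0\<bar>)) * indicator U s) \<le>
      (\<integral>\<^sup>+t. ennreal (4 * D * pi) * (ennreal ((1 + s\<^sup>2) * G t s) * indicator T t) \<partial>lborel)"
    proof eventually_elim
      fix s :: real assume s: "s \<noteq> 0"
      show "ennreal (pi * (1 + s\<^sup>2)) * (1 / ennreal (\<gamma> (2 * C * \<bar>s - 0\<bar>)) * indicator U s) \<le>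
        (\<integral>\<^sup>+t. ennreal (4 * D * pi) * (ennreal ((1 + s\<^sup>2) * G t s) * indicator T t) \<partial>lborel)"
      proof (cases "s \<in> U")
        case True
        then have ts: "\<theta> s \<noteq> 0" "\<bar>\<theta> s\<bar> < \<epsilon>" "s \<in> {-1..1}" using \<theta>_le[of s] \<theta>_nz[OF s] \<epsilon>(3) by (auto simp: U_def)
        have g: "0 < \<gamma> (2 * C * \<bar>s\<bar>)" using s C \<gamma>(2) by simp
        have "h (\<theta> s) \<le> D * \<gamma> (2 * C * \<bar>s\<bar>)"
          unfolding h_def using \<theta>_le[of s] C D by (intro mult_left_mono \<gamma>(4)) (auto simp: mult.left_commute mult.assoc)
        then have "1 / \<gamma> (2 * C * \<bar>s\<bar>) \<le> 4 * D * (1 / (4 * h (\<theta> s)))"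
          using g D h_pos[OF ts(1)] by (simp add: field_simps)
        then have "1 / ennreal (\<gamma> (2 * C * \<bar>s\<bar>)) \<le> ennreal (4 * D) * ennreal (1 / (4 * h (\<theta> s)))"
          using g D h_pos[OF ts(1)] by (subst ennreal_mult[symmetric]) (auto simp: one_divide_ennreal intro!: ennreal_leI)
        also have "\<dots> \<le> ennreal (4 * D) * (\<integral>\<^sup>+t. ennreal (G t s) * indicator T t \<partial>lborel)"
          using lower[OF ts] by (rule mult_left_mono) simp
        finally have "ennreal (pi * (1 + s\<^sup>2)) * (1 / ennreal (\<gamma> (2 * C * \<bar>s\<bar>))) \<le>
          ennreal (pi * (1 + s\<^sup>2)) * (ennreal (4 * D) * (\<integral>\<^sup>+t. ennreal (G t s) * indicator T t \<partial>lborel))"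
          by (rule mult_left_mono) simp
        also have "\<dots> = (\<integral>\<^sup>+t. ennreal (pi * (1 + s\<^sup>2)) * (ennreal (4 * D) * (ennreal (G t s) * indicator T t)) \<partial>lborel)"
          by (simp add: nn_integral_cmult)
        also have "\<dots> = (\<integral>\<^sup>+t. ennreal (4 * D * pi) * (ennreal ((1 + s\<^sup>2) * G t s) * indicator T t) \<partial>lborel)"
        proof (intro nn_integral_cong)
          fix t
          have "ennreal (pi * (1 + s\<^sup>2)) * (ennreal (4 * D) * ennreal (G t s)) = ennreal (4 * D * pi) * ennreal ((1 + s\<^sup>2) * G t s)"
            using D by (simp add: G_def ennreal_mult[symmetric] mult_ac del: ennreal_plus)
          then show "ennreal (pi * (1 + s\<^sup>2)) * (ennreal (4 * D) * (ennreal (G t s) * indicator T t)) =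
            ennreal (4 * D * pi) * (ennreal ((1 + s\<^sup>2) * G t s) * indicator T t)"
            by (simp add: mult.assoc[symmetric])
        qed
        finally show ?thesis using True by simp
      qed simp
    qed
  qed
  also have "\<dots> = (\<integral>\<^sup>+t. (\<integral>\<^sup>+s. ennreal (4 * D * pi) * (ennreal ((1 + s\<^sup>2) * G t s) * indicator T t) \<partial>\<rho>) \<partial>lborel)"
    by (rule P.Fubini') measurable
  also have "\<dots> \<le> (\<integral>\<^sup>+t. ennreal (4 * D * pi) * ennreal (K\<^sup>2 * N) * indicator T t \<partial>lborel)"
  proof (intro nn_integral_mono)
    fix t
    have "(\<integral>\<^sup>+s. ennreal (4 * D * pi) * (ennreal ((1 + s\<^sup>2) * G t s) * indicator T t) \<partial>\<rho>) =
        ennreal (4 * D * pi) * ((\<integral>\<^sup>+s. ennreal ((1 + s\<^sup>2) * G t s) \<partial>\<rho>) * indicator T t)"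
      by (simp add: nn_integral_cmult nn_integral_multc)
    also have "\<dots> \<le> ennreal (4 * D * pi) * (ennreal (K\<^sup>2 * N) * indicator T t)"
      using int_G[of t] by (intro mult_left_mono) (auto simp: indicator_def)
    finally show "(\<integral>\<^sup>+s. ennreal (4 * D * pi) * (ennreal ((1 + s\<^sup>2) * G t s) * indicator T t) \<partial>\<rho>) \<le>
        ennreal (4 * D * pi) * ennreal (K\<^sup>2 * N) * indicator T t" by (simp add: mult.assoc)
  qed
  also have "\<dots> = ennreal (4 * D * pi) * ennreal (K\<^sup>2 * N) * emeasure lborel T"
    by (rule nn_integral_cmult_indicator) simp
  also have "\<dots> < \<infinity>"
  proof -
    have "emeasure lborel T \<le> emeasure lborel {-\<epsilon>..\<epsilon>}" by (intro emeasure_mono) (auto simp: T_def)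
    also have "\<dots> < \<infinity>" by (auto simp: emeasure_lborel_Icc_eq)
    finally show ?thesis by (simp add: ennreal_mult_less_top)
  qed
  finally show ?thesis
    unfolding gamma_regular_def using C \<epsilon>(1)
    by (intro exI[of _ "2 * C"] conjI exI[of _ U]) (auto simp: U_def)
qed

end

section \<open>Regularity and the Julia quotient\<close>

lemma norm_cis_diff_le: "cmod (cis a - cis b) \<le> \<bar>a - b\<bar>"
proof -
  have "cis a - cis b = cis b * (exp (\<i> * of_real (a - b)) - 1)"
    unfolding cis_conv_exp[of "a - b", symmetric] by (simp add: right_diff_distrib cis_mult)
  then have "cmod (cis a - cis b) = 2 * \<bar>sin ((a - b) / 2)\<bar>"
    by (simp only: norm_mult norm_cis dist_exp_i_1)
  then show ?thesis using abs_sin_x_le_abs_x[of "(a - b) / 2"] by simp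
qed

lemma holomorphic_disc_dichotomy:
  assumes hol: "\<phi> holomorphic_on ball 0 1" and img: "\<phi> ` ball 0 1 \<subseteq> cball 0 1"
  shows "(\<forall>z. cmod z < 1 \<longrightarrow> cmod (\<phi> z) < 1) \<or> (\<exists>\<alpha>. cmod \<alpha> = 1 \<and> (\<forall>z. cmod z < 1 \<longrightarrow> \<phi> z = \<alpha>))"
proof (cases "\<exists>z. cmod z < 1 \<and> cmod (\<phi> z) \<ge> 1")
  case True
  have le: "cmod (\<phi> z) \<le> 1" if "cmod z < 1" for z using img that by (auto simp: image_subset_iff)
  obtain w where w: "cmod w < 1" "cmod (\<phi> w) = 1" using True le by (metis order_antisym)
  have "\<phi> constant_on ball 0 1"
    using le w by (intro maximum_modulus_principle[OF hol, of "ball 0 1" w]) auto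
  then obtain \<alpha> where "\<And>z. cmod z < 1 \<Longrightarrow> \<phi> z = \<alpha>" by (auto simp: constant_on_def)
  then show ?thesis using w by metis
qed auto

lemma julia_quotient_nonneg:
  assumes "\<phi> ` ball 0 1 \<subseteq> cball 0 1" "cmod z < 1"
  shows "0 \<le> julia_quotient \<phi> z"
  using assms by (auto simp: julia_quotient_def image_subset_iff)

lemma gauge_tendsto_zero:
  assumes reg: "regularity_gauge \<gamma>" and C: "0 < C"
  shows "((\<lambda>t. \<gamma> (C * \<bar>t\<bar>)) \<longlongrightarrow> 0) (at 0)"
proof -
  obtain M r where M: "0 < M" "0 < r" "\<And>t. 0 \<le> t \<Longrightarrow> t \<le> r \<Longrightarrow> \<gamma> t \<le> M * t\<^sup>2"
    using regularity_gauge_quadratic[OF reg] by blast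
  show ?thesis
  proof (rule tendsto_sandwich)
    show "((\<lambda>t. 0) \<longlongrightarrow> 0) (at (0 :: real))" by simp
    show "((\<lambda>t. M * (C * \<bar>t\<bar>)\<^sup>2) \<longlongrightarrow> 0) (at 0)" by (auto intro!: tendsto_eq_intros)
    show "\<forall>\<^sub>F t in at 0. 0 \<le> \<gamma> (C * \<bar>t\<bar>)"
      using C regularity_gaugeD(1)[OF reg] by (intro always_eventually) simp
    have "\<gamma> (C * \<bar>t\<bar>) \<le> M * (C * \<bar>t\<bar>)\<^sup>2" if "\<bar>t\<bar> < r / C" for t
      using that C by (intro M(3)) (auto simp: field_simps)
    then show "\<forall>\<^sub>F t in at 0. \<gamma> (C * \<bar>t\<bar>) \<le> M * (C * \<bar>t\<bar>)\<^sup>2"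
      unfolding eventually_at using M C by (intro exI[of _ "r / C"]) auto
  qed
qed

text \<open>The curve \<open>\<tau> e\<^sup>-\<^sup>h\<^sup>(\<^sup>t\<^sup>) e\<^sup>i\<^sup>t\<close>, which runs at distance about \<open>h(t)\<close> from the unit circle.\<close>

definition gauge_curve :: "complex \<Rightarrow> (real \<Rightarrow> real) \<Rightarrow> real \<Rightarrow> complex" where
  "gauge_curve \<tau> h t = \<tau> * exp (- complex_of_real (h t) + \<i> * complex_of_real t)"

lemma gauge_curve_eq: "gauge_curve \<tau> h t = \<tau> * of_real (exp (- h t)) * cis t"
proof -
  have "exp (- complex_of_real (h t)) = of_real (exp (- h t))" by (metis exp_of_real of_real_minus)
  then show ?thesis by (simp only: gauge_curve_def exp_add cis_conv_exp mult.assoc)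
qed

lemma norm_gauge_curve: "cmod \<tau> = 1 \<Longrightarrow> cmod (gauge_curve \<tau> h t) = exp (- h t)"
  by (simp add: gauge_curve_eq norm_mult)

lemma gauge_curve_dist:
  assumes \<tau>: "cmod \<tau> = 1" and h: "0 \<le> h t"
  shows "cmod (gauge_curve \<tau> h t - \<tau> * cis b) \<le> \<bar>b - t\<bar> + h t"
proof -
  have "gauge_curve \<tau> h t - \<tau> * cis b = \<tau> * ((of_real (exp (- h t)) - 1) * cis t + (cis t - cis b))"
    by (simp add: gauge_curve_eq algebra_simps)
  then have "cmod (gauge_curve \<tau> h t - \<tau> * cis b) = cmod ((of_real (exp (- h t)) - 1) * cis t + (cis t - cis b))"
    using \<tau> by (simp only: norm_mult)
  also have "\<dots> \<le> cmod ((of_real (exp (- h t)) - 1) * cis t) + cmod (cis t - cis b)"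
    by (rule norm_triangle_ineq)
  also have "cmod ((of_real (exp (- h t)) - 1) * cis t) = \<bar>exp (- h t) - 1\<bar>"
  proof -
    have "of_real (exp (- h t)) - 1 = complex_of_real (exp (- h t) - 1)" by simp
    then show ?thesis by (simp only: norm_mult norm_cis norm_of_real mult_1_right)
  qed
  also have "\<dots> \<le> h t" using h exp_ge_add_one_self[of "- h t"] by (simp add: abs_if)
  finally show ?thesis using norm_cis_diff_le[of t b] by (simp add: abs_minus_commute)
qed

lemma gauge_curve_tendsto:
  assumes reg: "regularity_gauge \<gamma>" and C: "0 < C" and D: "0 < D" and \<tau>: "cmod \<tau> = 1" and d: "0 < d"
  shows "\<forall>\<^sub>F t in at 0. cmod (gauge_curve \<tau> (\<lambda>t. D * \<gamma> (C * \<bar>t\<bar>)) t - \<tau>) < d"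
proof -
  have "((\<lambda>t. \<bar>t\<bar> + D * \<gamma> (C * \<bar>t\<bar>)) \<longlongrightarrow> \<bar>0\<bar> + D * 0) (at 0)"
    by (intro tendsto_intros gauge_tendsto_zero[OF reg C])
  then have "\<forall>\<^sub>F t in at 0. \<bar>t\<bar> + D * \<gamma> (C * \<bar>t\<bar>) < d" using d by (intro order_tendstoD) auto
  then show ?thesis
  proof eventually_elim
    case (elim t)
    have "0 \<le> D * \<gamma> (C * \<bar>t\<bar>)" using C D regularity_gaugeD(1)[OF reg] by simp
    then show ?case
      using gauge_curve_dist[OF \<tau>, of "\<lambda>t. D * \<gamma> (C * \<bar>t\<bar>)" t 0] elim by simp
  qed
qed

text \<open>For \<open>z\<close> in the Stolz region with parameter \<open>u\<close> put \<open>y = 1 - |z|\<close>, so that \<open>|z - \<tau>| \<le> u + y\<close>. If \<open>u \<le> y\<close>,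
  then the preimage \<open>\<zeta>\<close> of \<open>z\<close> in the half plane lies in a fixed cone at \<open>\<sigma>\<close>; otherwise \<open>|Re \<zeta> - \<sigma>| = O(u)\<close> while
  \<open>(Im \<zeta>)\<^sup>2\<close> is at least a multiple of \<open>\<gamma>(C' u)\<close>. The square root in the profile of the region enters here.\<close>

theorem transform_regular_imp_bounded_on_stolz:
  assumes reg: "regularity_gauge \<gamma>" and \<tau>: "cmod \<tau> = 1"
    and hol: "\<phi> holomorphic_on ball 0 1" and img: "\<phi> ` ball 0 1 \<subseteq> cball 0 1"
    and tr: "transform_gamma_regular \<gamma> \<phi> \<tau>"
  shows "\<exists>C>0. \<exists>D>0. \<exists>U. open U \<and> \<tau> \<in> U \<and>
    bounded (julia_quotient \<phi> ` (stolz_region (\<lambda>t. sqrt (D * \<gamma> (C * t))) \<tau> \<inter> U))"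
  using holomorphic_disc_dichotomy[OF hol img]
proof (elim disjE exE conjE)
  fix \<alpha> assume \<alpha>: "cmod \<alpha> = 1" "\<forall>z. cmod z < 1 \<longrightarrow> \<phi> z = \<alpha>"
  have "julia_quotient \<phi> ` (stolz_region l \<tau> \<inter> UNIV) \<subseteq> {0}" for l
    using \<alpha> by (auto simp: stolz_region_def julia_quotient_def)
  then have "bounded (julia_quotient \<phi> ` (stolz_region (\<lambda>t. sqrt (1 * \<gamma> (1 * t))) \<tau> \<inter> UNIV))"
    by (rule bounded_subset[rotated]) simp
  then show ?thesis by (intro exI[of _ 1] exI[of _ UNIV] conjI) (auto intro!: exI[of _ 1])
next
  assume lt: "\<forall>z. cmod z < 1 \<longrightarrow> cmod (\<phi> z) < 1"
  note \<gamma> = regularity_gaugeD[OF reg]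
  obtain a b c d a' b' c' d' \<sigma> where det: "a * d - b * c \<noteq> 0" and im: "moebius a b c d ` upper_half_plane = ball 0 1"
    and det': "a' * d' - b' * c' \<noteq> 0" and im': "moebius a' b' c' d' ` ball 0 1 = upper_half_plane"
    and \<sigma>: "moebius a b c d (of_real \<sigma>) = \<tau>"
    and gr: "gamma_regular \<gamma> (moebius a' b' c' d' \<circ> \<phi> \<circ> moebius a b c d) \<sigma>"
    using tr unfolding transform_gamma_regular_def by blast
  define \<eta> where "\<eta> = moebius a b c d"
  define \<psi> where "\<psi> = moebius a' b' c' d'"
  define f where "f = \<psi> \<circ> \<phi> \<circ> \<eta>"
  have \<eta>_in: "cmod (\<eta> z) < 1" if "0 < Im z" for z
    using im that unfolding \<eta>_def by (metis (mono_tags, lifting) imageI mem_Collect_eq mem_ball_0)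
  have \<psi>_in: "0 < Im (\<psi> w)" if "cmod w < 1" for w
    using im' that unfolding \<psi>_def by (metis (mono_tags, lifting) imageI mem_Collect_eq mem_ball_0)
  have hol_\<eta>: "\<eta> holomorphic_on {z. 0 < Im z}"
    unfolding \<eta>_def moebius_def using moebius_half_plane_disc_no_pole[OF det im] by (intro holomorphic_intros) auto
  have hol_\<psi>: "\<psi> holomorphic_on ball 0 1"
    unfolding \<psi>_def moebius_def using moebius_disc_half_plane(1)[OF det' im'] by (intro holomorphic_intros) auto
  have "\<psi> \<circ> \<phi> holomorphic_on ball 0 1"
    using lt by (intro holomorphic_on_compose_gen[OF hol hol_\<psi>]) auto
  then have "f holomorphic_on {z. 0 < Im z}"
    unfolding f_def using \<eta>_in by (intro holomorphic_on_compose_gen[OF hol_\<eta>, of "\<psi> \<circ> \<phi>" "ball 0 1"]) auto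
  moreover have "0 < Im (f z)" if "0 < Im z" for z
    using \<psi>_in \<eta>_in lt that by (simp add: f_def)
  ultimately obtain \<beta> \<rho> where repr: "nevanlinna_representation f \<beta> \<rho>"
    using herglotz_half_plane by blast
  obtain C where C: "0 < C" and bd: "\<And>\<kappa>. 0 < \<kappa> \<Longrightarrow> \<exists>N \<epsilon>. 0 < \<epsilon> \<and> (\<forall>z. 0 < Im z \<and> cmod (z - of_real \<sigma>) < \<epsilon> \<and>
      (\<bar>Re z - \<sigma>\<bar> \<le> \<kappa> * Im z \<or> \<gamma> (2 * C * \<bar>Re z - \<sigma>\<bar>) \<le> \<kappa> * (Im z)\<^sup>2) \<longrightarrow> Im (f z) \<le> N * Im z)"
    using regular_imp_bounded[OF repr reg, of \<sigma>] gr unfolding f_def \<eta>_def \<psi>_def by blast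
  obtain m1 where m1: "0 < m1" "\<And>w. cmod w < 1 \<Longrightarrow> m1 * (1 - cmod w) \<le> Im (\<psi> w)"
    using moebius_disc_half_plane(2)[OF det' im'] unfolding \<psi>_def by blast
  have "\<tau> \<noteq> 0" using \<tau> by auto
  then obtain m R r where m: "0 < m" and R: "0 < R" and r: "0 < r" and loc:
    "\<And>z. cmod z < 1 \<Longrightarrow> cmod (z - \<tau>) < r \<Longrightarrow> \<exists>\<zeta>. Im \<zeta> > 0 \<and> \<eta> \<zeta> = z \<and>
       cmod (\<zeta> - of_real \<sigma>) \<le> R * cmod (z - \<tau>) \<and> m * (1 - cmod z) \<le> Im \<zeta> \<and> Im \<zeta> \<le> R * (1 - cmod z)"
    using moebius_half_plane_disc_local[OF det im \<sigma>] unfolding \<eta>_def by blast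
  \<comment> \<open>one summand for each of the two cases\<close>
  define \<kappa> where "\<kappa> = 2 * R / m + 1 / m\<^sup>2"
  have \<kappa>: "0 < \<kappa>" "2 * R / m \<le> \<kappa>" "1 / m\<^sup>2 \<le> \<kappa>" using m R by (auto simp: \<kappa>_def add_pos_pos)
  obtain N \<epsilon> where \<epsilon>: "0 < \<epsilon>" and N: "\<And>z. 0 < Im z \<Longrightarrow> cmod (z - of_real \<sigma>) < \<epsilon> \<Longrightarrow>
      \<bar>Re z - \<sigma>\<bar> \<le> \<kappa> * Im z \<or> \<gamma> (2 * C * \<bar>Re z - \<sigma>\<bar>) \<le> \<kappa> * (Im z)\<^sup>2 \<Longrightarrow> Im (f z) \<le> N * Im z"
    using bd[OF \<kappa>(1)] by blast
  define C' where "C' = 4 * C * R"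
  have C': "0 < C'" using C R by (simp add: C'_def)
  define U where "U = ball \<tau> (min r (\<epsilon> / R))"
  have "norm (julia_quotient \<phi> z) \<le> \<bar>N\<bar> * R / m1"
    if z: "z \<in> stolz_region (\<lambda>t. sqrt (1 * \<gamma> (C' * t))) \<tau> \<inter> U" for z
  proof -
    have z1: "cmod z < 1" using z by (auto simp: stolz_region_def)
    define y where "y = 1 - cmod z"
    have y: "0 < y" using z1 by (simp add: y_def)
    obtain u where u: "0 < u" "sqrt (\<gamma> (C' * u)) \<le> y" "sqrt ((cmod (z - \<tau>))\<^sup>2 - y\<^sup>2) \<le> u"
      using z by (auto simp: stolz_region_def y_def)
    have zU: "cmod (z - \<tau>) < r" "cmod (z - \<tau>) < \<epsilon> / R" using z by (auto simp: U_def dist_norm norm_minus_commute)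
    obtain \<zeta> where \<zeta>: "Im \<zeta> > 0" "\<eta> \<zeta> = z" "cmod (\<zeta> - of_real \<sigma>) \<le> R * cmod (z - \<tau>)"
      "m * y \<le> Im \<zeta>" "Im \<zeta> \<le> R * y"
      using loc[OF z1 zU(1)] unfolding y_def by blast
    have "(cmod (z - \<tau>))\<^sup>2 - y\<^sup>2 \<le> u\<^sup>2" using u(3) by (rule sqrt_le_D)
    moreover have "0 \<le> 2 * u * y" using u(1) y by simp
    ultimately have "(cmod (z - \<tau>))\<^sup>2 \<le> (u + y)\<^sup>2" unfolding power2_sum by argo
    then have "cmod (z - \<tau>) \<le> u + y" 
      by (rule power2_le_imp_le) (use u(1) y in simp)
    then have "R * cmod (z - \<tau>) \<le> R * (u + y)" using R by (intro mult_left_mono) auto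
    then have x: "\<bar>Re \<zeta> - \<sigma>\<bar> \<le> R * (u + y)"
      using \<zeta>(3) abs_Re_le_cmod[of "\<zeta> - of_real \<sigma>"] by simp
    have "Im (f \<zeta>) \<le> N * Im \<zeta>"
    proof (rule N[OF \<zeta>(1)])
      show "cmod (\<zeta> - of_real \<sigma>) < \<epsilon>" using \<zeta>(3) zU(2) R by (simp add: field_simps)
      show "\<bar>Re \<zeta> - \<sigma>\<bar> \<le> \<kappa> * Im \<zeta> \<or> \<gamma> (2 * C * \<bar>Re \<zeta> - \<sigma>\<bar>) \<le> \<kappa> * (Im \<zeta>)\<^sup>2"
      proof (cases "u \<le> y")
        case True
        then have "R * (u + y) \<le> R * (2 * y)" using R by (intro mult_left_mono) auto
        also have "\<dots> = 2 * R / m * (m * y)" using m by simp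
        also have "\<dots> \<le> \<kappa> * Im \<zeta>" using \<kappa> \<zeta>(4) m y by (intro mult_mono) auto
        finally show ?thesis using x by linarith
      next
        case False
        then have "R * (u + y) \<le> R * (2 * u)" using R by (intro mult_left_mono) auto
        then have "2 * C * \<bar>Re \<zeta> - \<sigma>\<bar> \<le> 2 * C * (R * (2 * u))" using x C by (intro mult_left_mono) auto
        also have "\<dots> = C' * u" by (simp add: C'_def)
        finally have "\<gamma> (2 * C * \<bar>Re \<zeta> - \<sigma>\<bar>) \<le> \<gamma> (C' * u)" using C by (intro \<gamma>(4)) auto
        also have "\<dots> \<le> y\<^sup>2" using u(2) by (rule sqrt_le_D)
        also have "\<dots> = 1 / m\<^sup>2 * (m * y)\<^sup>2" using m by (simp add: power_mult_distrib)
        also have "\<dots> \<le> \<kappa> * (Im \<zeta>)\<^sup>2" using \<kappa> \<zeta>(4) m y by (intro mult_mono power_mono) auto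
        finally show ?thesis by simp
      qed
    qed
    also have "\<dots> \<le> \<bar>N\<bar> * (R * y)" using \<zeta>(1,5) by (intro mult_mono) auto
    finally have "m1 * (1 - cmod (\<phi> z)) \<le> \<bar>N\<bar> * (R * y)"
      using m1(2)[of "\<phi> z"] lt z1 \<zeta>(2) by (simp add: f_def)
    then have "julia_quotient \<phi> z \<le> \<bar>N\<bar> * R / m1"
      using m1(1) y by (simp add: julia_quotient_def y_def[symmetric] field_simps)
    then show ?thesis using julia_quotient_nonneg[OF img z1] by simp
  qed
  then have "bounded (julia_quotient \<phi> ` (stolz_region (\<lambda>t. sqrt (1 * \<gamma> (C' * t))) \<tau> \<inter> U))"
    unfolding bounded_iff by blast
  moreover have "open U" "\<tau> \<in> U" using r \<epsilon> R by (auto simp: U_def)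
  ultimately show ?thesis using C' zero_less_one by blast
qed

text \<open>The curve at height \<open>D \<gamma>(C|t|)\<close> lies in the Stolz region of profile \<open>sqrt(D' \<gamma>(C' t))\<close> once \<open>C\<close> is a
  large multiple of \<open>C'\<close>, as \<open>\<gamma>(cu) = O(\<gamma>(u)\<^sup>2)\<close> for some \<open>c > 0\<close>.\<close>

theorem bounded_on_stolz_imp_bounded_on_curve:
  assumes reg: "regularity_gauge \<gamma>" and aug: "gamma_augury \<gamma> (\<lambda>t. sqrt (\<gamma> t))" and \<tau>: "cmod \<tau> = 1"
    and C': "0 < C'" and D': "0 < D'" and U: "open U" "\<tau> \<in> U"
    and bd: "bounded (julia_quotient \<phi> ` (stolz_region (\<lambda>t. sqrt (D' * \<gamma> (C' * t))) \<tau> \<inter> U))"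
  shows "\<exists>C>0. \<exists>D>0. Limsup (at (0::real)) (\<lambda>t. ereal (julia_quotient \<phi>
    (gauge_curve \<tau> (\<lambda>t. D * \<gamma> (C * \<bar>t\<bar>)) t))) < \<infinity>"
proof -
  note \<gamma> = regularity_gaugeD[OF reg]
  obtain B where B: "\<And>z. z \<in> stolz_region (\<lambda>t. sqrt (D' * \<gamma> (C' * t))) \<tau> \<inter> U \<Longrightarrow> julia_quotient \<phi> z \<le> B"
    using bd unfolding bounded_iff by (force simp: abs_le_iff)
  obtain c K r where c: "0 < c" and K: "0 < K" and r: "0 < r"
    and sq: "\<And>u. 0 < u \<Longrightarrow> u \<le> r \<Longrightarrow> \<gamma> (c * u) \<le> K * (\<gamma> u)\<^sup>2"
    using augury_dominates_square[OF reg aug] by blast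
  \<comment> \<open>With these constants \<open>D' \<gamma>(C'|t|) \<le> D' K \<gamma>(C|t|)\<^sup>2 = (D \<gamma>(C|t|) / 2)\<^sup>2\<close>.\<close>
  define C where "C = C' / c"
  define D where "D = 2 * sqrt (D' * K)"
  have C: "0 < C" and D: "0 < D" using C' c D' K by (auto simp: C_def D_def)
  define h where "h t = D * \<gamma> (C * \<bar>t\<bar>)" for t
  obtain \<delta> where \<delta>: "0 < \<delta>" "ball \<tau> \<delta> \<subseteq> U" using U openE by blast
  have "((\<lambda>t. D * \<gamma> (C * \<bar>t\<bar>)) \<longlongrightarrow> D * 0) (at 0)" by (intro tendsto_intros gauge_tendsto_zero[OF reg C])
  then have ev1: "\<forall>\<^sub>F t in at 0. h t < 1" unfolding h_def by (intro order_tendstoD) auto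
  have ev2: "\<forall>\<^sub>F t in at 0. cmod (gauge_curve \<tau> h t - \<tau>) < \<delta>"
    using gauge_curve_tendsto[OF reg C D \<tau> \<delta>(1)] unfolding h_def .
  have ev3: "\<forall>\<^sub>F t in at 0. t \<noteq> 0 \<and> \<bar>t\<bar> < r / C"
    unfolding eventually_at using r C by (intro exI[of _ "r / C"]) auto
  have "\<forall>\<^sub>F t in at 0. ereal (julia_quotient \<phi> (gauge_curve \<tau> h t)) \<le> ereal B"
    using ev1 ev2 ev3
  proof eventually_elim
    case (elim t)
    then have t: "t \<noteq> 0" "C * \<bar>t\<bar> \<le> r" using C by (auto simp: field_simps)
    define p where "p = exp (- h t)"
    have hp: "0 < h t" using t C D \<gamma>(2) by (simp add: h_def)
    have p: "0 < p" "p < 1" using hp by (auto simp: p_def)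
    have nz: "cmod (gauge_curve \<tau> h t) = p" using norm_gauge_curve[OF \<tau>] by (simp add: p_def)
    have height: "h t / 2 \<le> 1 - p"
    proof -
      have "p * (1 + h t) \<le> p * exp (h t)" using p exp_ge_add_one_self[of "h t"] by (intro mult_left_mono) auto
      also have "\<dots> = 1" by (simp add: p_def flip: exp_add)
      finally have "h t * p \<le> 1 - p" by (simp add: algebra_simps)
      moreover have "h t * (1 - p) \<le> 1 * (1 - p)" using elim p by (intro mult_right_mono) auto
      ultimately show ?thesis by (simp add: algebra_simps)
    qed
    have "D' * \<gamma> (C' * \<bar>t\<bar>) \<le> D' * (K * (\<gamma> (C * \<bar>t\<bar>))\<^sup>2)"
      using sq[of "C * \<bar>t\<bar>"] t C C' c D' by (intro mult_left_mono) (auto simp: C_def)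
    also have "\<dots> = (h t / 2)\<^sup>2"
      using D' K by (simp add: h_def D_def power_mult_distrib)
    also have "\<dots> \<le> (1 - p)\<^sup>2" using height hp by (intro power_mono) auto
    finally have "sqrt (D' * \<gamma> (C' * \<bar>t\<bar>)) \<le> 1 - p" using p by (intro real_le_lsqrt) auto
    moreover have "sqrt ((cmod (gauge_curve \<tau> h t - \<tau>))\<^sup>2 - (1 - p)\<^sup>2) \<le> \<bar>t\<bar>"
    proof -
      have e: "gauge_curve \<tau> h t - \<tau> = \<tau> * (of_real p * cis t - 1)"
        by (simp add: gauge_curve_eq p_def algebra_simps)
      have "(cmod (gauge_curve \<tau> h t - \<tau>))\<^sup>2 = (cmod (of_real p * cis t - 1))\<^sup>2"
        unfolding e norm_mult \<tau> by simp
      also have "\<dots> = (p * cos t - 1)\<^sup>2 + (p * sin t)\<^sup>2" unfolding cmod_power2 by simp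
      also have "\<dots> = (1 - p)\<^sup>2 + p * ((cos t - 1)\<^sup>2 + (sin t)\<^sup>2)"
        using sin_cos_squared_add[of t] by (simp add: power2_eq_square) algebra
      also have "(cos t - 1)\<^sup>2 + (sin t)\<^sup>2 = (cmod (cis t - cis 0))\<^sup>2" unfolding cmod_power2 by simp
      finally have "(cmod (gauge_curve \<tau> h t - \<tau>))\<^sup>2 - (1 - p)\<^sup>2 = p * (cmod (cis t - cis 0))\<^sup>2" by simp
      also have "\<dots> \<le> 1 * \<bar>t\<bar>\<^sup>2" using p norm_cis_diff_le[of t 0] by (intro mult_mono power_mono) auto
      finally show ?thesis by (intro real_le_lsqrt) auto
    qed
    ultimately have "gauge_curve \<tau> h t \<in> stolz_region (\<lambda>t. sqrt (D' * \<gamma> (C' * t))) \<tau>"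
      unfolding stolz_region_def using t p nz by (auto intro!: exI[of _ "\<bar>t\<bar>"])
    moreover have "gauge_curve \<tau> h t \<in> U" using \<delta>(2) elim by (auto simp: subset_iff dist_norm norm_minus_commute)
    ultimately show ?case using B by simp
  qed
  then have "Limsup (at 0) (\<lambda>t. ereal (julia_quotient \<phi> (gauge_curve \<tau> h t))) \<le> ereal B" by (rule Limsup_bounded)
  then have "Limsup (at 0) (\<lambda>t. ereal (julia_quotient \<phi> (gauge_curve \<tau> h t))) < \<infinity>"
    by (rule le_less_trans) simp
  then show ?thesis using C D unfolding h_def[abs_def] by blast
qed

lemma cis_two_arctan: "cis (2 * arctan s) = (\<i> - of_real s) / (\<i> + of_real s)"
proof -
  define q where "q = sqrt (1 + s\<^sup>2)"
  have q: "q\<^sup>2 = 1 + s\<^sup>2" "q \<noteq> 0" by (auto simp: q_def add_nonneg_eq_0_iff)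
  have "cis (arctan s) = (1 + \<i> * of_real s) / of_real q"
    by (simp add: complex_eq_iff cos_arctan sin_arctan q_def)
  moreover have "cis (2 * arctan s) = (cis (arctan s))\<^sup>2" by (simp add: Complex.DeMoivre)
  ultimately have "cis (2 * arctan s) = (1 + \<i> * of_real s)\<^sup>2 / of_real (1 + s\<^sup>2)"
    by (simp add: power_divide flip: q(1))
  also have "of_real (1 + s\<^sup>2) = (1 + \<i> * of_real s) * (1 - \<i> * complex_of_real s)"
    by (simp add: algebra_simps power2_eq_square)
  also have "(1 + \<i> * of_real s)\<^sup>2 / ((1 + \<i> * of_real s) * (1 - \<i> * complex_of_real s)) = (\<i> - of_real s) / (\<i> + of_real s)"
  proof -
    have "1 + \<i> * of_real s \<noteq> 0" "1 - \<i> * of_real s \<noteq> 0" "\<i> + of_real s \<noteq> 0" by (auto simp: complex_eq_iff)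
    then show ?thesis by (simp add: divide_simps power2_eq_square) (simp add: algebra_simps)
  qed
  finally show ?thesis .
qed

lemma Im_divide_cnj: "Im (x / y) = Im (x * cnj y) / (cmod y)\<^sup>2"
  by (simp add: Im_divide cmod_power2 algebra_simps)

text \<open>The Cayley transform normalised to send \<open>0\<close> to \<open>\<tau>\<close>, with its inverse.\<close>

lemma cayley_to_disc:
  assumes \<tau>: "cmod \<tau> = 1"
  shows "moebius (- \<tau>) (\<tau> * \<i>) 1 \<i> ` upper_half_plane = ball 0 1"
    and "\<And>z. cmod z < 1 \<Longrightarrow> 0 < Im (\<i> * (\<tau> - z) / (\<tau> + z)) \<and> moebius (- \<tau>) (\<tau> * \<i>) 1 \<i> (\<i> * (\<tau> - z) / (\<tau> + z)) = z \<and>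
      1 - cmod z \<le> 4 * Im (\<i> * (\<tau> - z) / (\<tau> + z))"
proof -
  let ?\<eta> = "moebius (- \<tau>) (\<tau> * \<i>) 1 \<i>"
  have \<tau>0: "\<tau> \<noteq> 0" using \<tau> by auto
  have \<eta>_eq: "?\<eta> z = \<tau> * ((\<i> - z) / (\<i> + z))" for z
    by (simp add: moebius_def algebra_simps)
  show inv: "0 < Im (\<i> * (\<tau> - z) / (\<tau> + z)) \<and> ?\<eta> (\<i> * (\<tau> - z) / (\<tau> + z)) = z \<and>
      1 - cmod z \<le> 4 * Im (\<i> * (\<tau> - z) / (\<tau> + z))" if z: "cmod z < 1" for z
  proof -
    let ?\<zeta> = "\<i> * (\<tau> - z) / (\<tau> + z)"
    have nz: "\<tau> + z \<noteq> 0"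
    proof
      assume "\<tau> + z = 0"
      then have "z = - \<tau>" by (simp add: eq_neg_iff_add_eq_0 add.commute)
      then show False using z \<tau> by simp
    qed
    have "Im ?\<zeta> = Im (\<i> * (\<tau> - z) * cnj (\<tau> + z)) / (cmod (\<tau> + z))\<^sup>2"
      by (rule Im_divide_cnj)
    also have "Im (\<i> * (\<tau> - z) * cnj (\<tau> + z)) = (cmod \<tau>)\<^sup>2 - (cmod z)\<^sup>2"
      unfolding cmod_power2 by (simp add: power2_eq_square algebra_simps)
    finally have Im: "Im ?\<zeta> = (1 - (cmod z)\<^sup>2) / (cmod (\<tau> + z))\<^sup>2" using \<tau> by simp
    have z2: "(cmod z)\<^sup>2 \<le> cmod z" using z by (simp add: power2_eq_square mult_left_le)
    have "cmod (\<tau> + z) \<le> 2" using norm_triangle_ineq[of \<tau> z] \<tau> z by simp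
    then have "(cmod (\<tau> + z))\<^sup>2 \<le> 2\<^sup>2" by (intro power_mono) auto
    then have "(1 - cmod z) * (cmod (\<tau> + z))\<^sup>2 \<le> (1 - (cmod z)\<^sup>2) * 4"
      using z z2 by (intro mult_mono) auto
    then have low: "1 - cmod z \<le> 4 * Im ?\<zeta>" unfolding Im using nz by (simp add: field_simps)
    have "\<i> + ?\<zeta> = 2 * \<i> * \<tau> / (\<tau> + z)" "\<i> - ?\<zeta> = 2 * \<i> * z / (\<tau> + z)"
      using nz by (simp_all add: field_simps)
    then have "?\<eta> ?\<zeta> = \<tau> * ((2 * \<i> * z / (\<tau> + z)) / (2 * \<i> * \<tau> / (\<tau> + z)))" by (simp only: \<eta>_eq)
    also have "\<dots> = z" using nz \<tau>0 by simp
    finally show ?thesis using low z by auto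
  qed
  have "cmod (?\<eta> z) < 1" if "0 < Im z" for z
  proof -
    have "(cmod (\<i> - z))\<^sup>2 < (cmod (\<i> + z))\<^sup>2"
      unfolding cmod_power2 using that by (simp add: power2_eq_square algebra_simps)
    then have "cmod (\<i> - z) < cmod (\<i> + z)" by (rule power2_less_imp_less) simp
    then show ?thesis by (simp add: \<eta>_eq norm_mult norm_divide \<tau> divide_less_eq)
  qed
  then show "?\<eta> ` upper_half_plane = ball 0 1"
    using inv by (auto simp: image_iff) (metis)
qed

text \<open>The map \<open>w \<mapsto> i(\<alpha> + w)/(\<alpha> - w)\<close> of the disc onto the half plane with pole \<open>\<alpha>\<close>.\<close>

lemma cayley_to_half_plane:
  assumes \<alpha>: "cmod \<alpha> = 1"
  shows "moebius \<i> (\<i> * \<alpha>) (- 1) \<alpha> ` ball 0 1 = upper_half_plane"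
    and "\<And>w. Im (moebius \<i> (\<i> * \<alpha>) (- 1) \<alpha> w) = (1 - (cmod w)\<^sup>2) / (cmod (\<alpha> - w))\<^sup>2"
proof -
  let ?\<psi> = "moebius \<i> (\<i> * \<alpha>) (- 1) \<alpha>"
  have \<psi>_eq: "?\<psi> w = \<i> * (\<alpha> + w) / (\<alpha> - w)" for w by (simp add: moebius_def algebra_simps)
  show Im: "Im (?\<psi> w) = (1 - (cmod w)\<^sup>2) / (cmod (\<alpha> - w))\<^sup>2" for w
  proof -
    have "Im (?\<psi> w) = Im (\<i> * (\<alpha> + w) * cnj (\<alpha> - w)) / (cmod (\<alpha> - w))\<^sup>2"
      unfolding \<psi>_eq by (rule Im_divide_cnj)
    also have "Im (\<i> * (\<alpha> + w) * cnj (\<alpha> - w)) = (cmod \<alpha>)\<^sup>2 - (cmod w)\<^sup>2"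
      unfolding cmod_power2 by (simp add: power2_eq_square algebra_simps)
    finally show ?thesis using \<alpha> by simp
  qed
  show "?\<psi> ` ball 0 1 = upper_half_plane"
  proof (intro equalityI subsetI)
    fix y assume "y \<in> ?\<psi> ` ball 0 1"
    then obtain w where w: "cmod w < 1" "y = ?\<psi> w" by auto
    have "\<alpha> \<noteq> w" using \<alpha> w by auto
    then show "y \<in> upper_half_plane"
      using w by (auto simp: Im abs_square_less_1 intro!: divide_pos_pos)
  next
    fix y assume "y \<in> upper_half_plane"
    then have y: "0 < Im y" by simp
    define w where "w = \<alpha> * ((y - \<i>) / (y + \<i>))"
    have nz: "y + \<i> \<noteq> 0" using y by (auto simp: complex_eq_iff)
    have "(cmod (y - \<i>))\<^sup>2 < (cmod (y + \<i>))\<^sup>2"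
      unfolding cmod_power2 using y by (simp add: power2_eq_square algebra_simps)
    then have "cmod (y - \<i>) < cmod (y + \<i>)" by (rule power2_less_imp_less) simp
    then have w: "cmod w < 1" using \<alpha> nz by (simp add: w_def norm_mult norm_divide)
    have "\<alpha> + w = \<alpha> * (2 * y) / (y + \<i>)" "\<alpha> - w = \<alpha> * (2 * \<i>) / (y + \<i>)"
      using nz by (simp_all add: w_def field_simps)
    then have "?\<psi> w = \<i> * (\<alpha> * (2 * y) / (y + \<i>)) / (\<alpha> * (2 * \<i>) / (y + \<i>))" by (simp only: \<psi>_eq)
    also have "\<dots> = y" using nz \<alpha> by auto
    finally show "y \<in> ?\<psi> ` ball 0 1" using w by force
  qed
qed

text \<open>By the Schwarz--Pick lemma the values of \<open>\<phi>\<close> at two points with bounded Julia quotient differ by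
  \<open>O(|1 - \<bar>w z|)\<close>, hence by \<open>O(|z - \<tau>| + |w - \<tau>|)\<close>.\<close>

lemma julia_quotient_bounded_imp_close:
  assumes hol: "\<phi> holomorphic_on ball 0 1" and lt: "\<And>z. cmod z < 1 \<Longrightarrow> cmod (\<phi> z) < 1"
    and z: "cmod z < 1" "julia_quotient \<phi> z \<le> B" and w: "cmod w < 1" "julia_quotient \<phi> w \<le> B"
    and \<tau>: "cmod \<tau> = 1" and B: "0 \<le> B"
  shows "cmod (\<phi> z - \<phi> w) \<le> 2 * B * (cmod (z - \<tau>) + cmod (w - \<tau>))"
proof -
  have J: "1 - (cmod (\<phi> u))\<^sup>2 \<le> 2 * B * (1 - (cmod u)\<^sup>2)" "0 < 1 - (cmod u)\<^sup>2" "0 \<le> 1 - (cmod (\<phi> u))\<^sup>2"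
    if u: "cmod u < 1" "julia_quotient \<phi> u \<le> B" for u
  proof -
    have "0 \<le> (1 - cmod (\<phi> u))\<^sup>2" by simp
    then have "1 - (cmod (\<phi> u))\<^sup>2 \<le> 2 * (1 - cmod (\<phi> u))" by (simp add: power2_eq_square algebra_simps)
    also have "\<dots> \<le> 2 * (B * (1 - cmod u))"
      using u by (simp add: julia_quotient_def divide_le_eq)
    also have "\<dots> \<le> 2 * (B * (1 - (cmod u)\<^sup>2))"
    proof -
      have "(cmod u)\<^sup>2 \<le> cmod u" using u by (simp add: power2_eq_square mult_left_le)
      then show ?thesis using B by (intro mult_left_mono) auto
    qed
    finally show "1 - (cmod (\<phi> u))\<^sup>2 \<le> 2 * B * (1 - (cmod u)\<^sup>2)" by simp
    show "0 < 1 - (cmod u)\<^sup>2" using u by (simp add: abs_square_less_1)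
    show "0 \<le> 1 - (cmod (\<phi> u))\<^sup>2" using lt[OF u(1)] by (simp add: power_le_one)
  qed
  define X where "X = (1 - (cmod z)\<^sup>2) * (1 - (cmod w)\<^sup>2)"
  have X: "0 < X" using J(2)[OF z] J(2)[OF w] by (simp add: X_def)
  have "(cmod (\<phi> z - \<phi> w))\<^sup>2 * X \<le> (1 - (cmod (\<phi> z))\<^sup>2) * (1 - (cmod (\<phi> w))\<^sup>2) * (cmod (1 - cnj w * z))\<^sup>2"
    unfolding X_def by (rule Schwarz_Pick[OF hol lt z(1) w(1)])
  also have "\<dots> \<le> (2 * B * (1 - (cmod z)\<^sup>2)) * (2 * B * (1 - (cmod w)\<^sup>2)) * (cmod (1 - cnj w * z))\<^sup>2"
    using J[OF z] J[OF w] B by (intro mult_right_mono mult_mono) auto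
  also have "\<dots> = (2 * B * cmod (1 - cnj w * z))\<^sup>2 * X"
    by (simp add: X_def power_mult_distrib power2_eq_square)
  finally have "(cmod (\<phi> z - \<phi> w))\<^sup>2 \<le> (2 * B * cmod (1 - cnj w * z))\<^sup>2"
    using X by (rule mult_right_le_imp_le)
  then have "cmod (\<phi> z - \<phi> w) \<le> 2 * B * cmod (1 - cnj w * z)"
    by (rule power2_le_imp_le) (use B in simp)
  also have "cmod (1 - cnj w * z) \<le> cmod (z - \<tau>) + cmod (w - \<tau>)"
  proof -
    have "cnj \<tau> * \<tau> = 1" using \<tau> by (metis complex_norm_square mult.commute of_real_1 power_one)
    then have "1 - cnj w * z = cnj (\<tau> - w) * \<tau> + cnj w * (\<tau> - z)" by (simp add: algebra_simps)
    also have "cmod \<dots> \<le> cmod (cnj (\<tau> - w) * \<tau>) + cmod (cnj w * (\<tau> - z))" by (rule norm_triangle_ineq)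
    also have "cmod (cnj (\<tau> - w) * \<tau>) = cmod (w - \<tau>)"
      unfolding norm_mult complex_mod_cnj \<tau> by (simp add: norm_minus_commute)
    also have "cmod (cnj w * (\<tau> - z)) \<le> cmod (z - \<tau>)"
      unfolding norm_mult complex_mod_cnj using w(1) by (simp add: norm_minus_commute mult_left_le_one_le)
    finally show ?thesis by simp
  qed
  finally show ?thesis using B by (simp add: mult_left_mono)
qed

text \<open>The map \<open>\<psi>\<close> in the definition of transform regularity must have its pole \<open>\<alpha>\<close> away from the values of \<open>\<phi>\<close> on
  the curve, so that \<open>Im \<psi>(\<phi>(z)) = O(1 - |\<phi>(z)|)\<close> there. By the preceding lemma these values stay close to
  a single one of them, and \<open>\<alpha>\<close> is chosen opposite to it.\<close>

theorem bounded_on_curve_imp_transform_regular: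
  assumes reg: "regularity_gauge \<gamma>" and \<tau>: "cmod \<tau> = 1"
    and hol: "\<phi> holomorphic_on ball 0 1" and img: "\<phi> ` ball 0 1 \<subseteq> cball 0 1"
    and C: "0 < C" and D: "0 < D"
    and lim: "Limsup (at (0::real)) (\<lambda>t. ereal (julia_quotient \<phi> (gauge_curve \<tau> (\<lambda>t. D * \<gamma> (C * \<bar>t\<bar>)) t))) < \<infinity>"
  shows "transform_gamma_regular \<gamma> \<phi> \<tau>"
proof -
  note \<gamma> = regularity_gaugeD[OF reg]
  define \<eta> where "\<eta> = moebius (- \<tau>) (\<tau> * \<i>) 1 \<i>"
  define \<psi> where "\<psi> \<alpha> = moebius \<i> (\<i> * \<alpha>) (- 1) \<alpha>" for \<alpha>
  have suffices: "transform_gamma_regular \<gamma> \<phi> \<tau>"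
    if \<alpha>: "cmod \<alpha> = 1" "\<And>z. cmod z < 1 \<Longrightarrow> \<phi> z \<noteq> \<alpha>" and gr: "gamma_regular \<gamma> (\<psi> \<alpha> \<circ> \<phi> \<circ> \<eta>) 0" for \<alpha>
    unfolding transform_gamma_regular_def
  proof (intro exI conjI)
    show "- \<tau> * \<i> - \<tau> * \<i> * 1 \<noteq> 0" using \<tau> by auto
    show "\<eta> = moebius (- \<tau>) (\<tau> * \<i>) 1 \<i>" by (rule \<eta>_def)
    show "\<eta> ` upper_half_plane = ball 0 1" unfolding \<eta>_def by (rule cayley_to_disc(1)[OF \<tau>])
    show "\<i> * \<alpha> - \<i> * \<alpha> * (- 1) \<noteq> 0" using \<alpha> by auto
    show "\<psi> \<alpha> = moebius \<i> (\<i> * \<alpha>) (- 1) \<alpha>" by (rule \<psi>_def)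
    show "\<psi> \<alpha> ` ball 0 1 = upper_half_plane" unfolding \<psi>_def by (rule cayley_to_half_plane(1)[OF \<alpha>(1)])
    have "\<tau> * \<i> / \<i> = \<tau>" by (rule nonzero_mult_div_cancel_right) simp
    then show "\<eta> (complex_of_real 0) = \<tau>"
      by (simp only: \<eta>_def moebius_def of_real_0 mult_zero_right add_0)
    show "\<forall>z\<in>ball 0 1. - 1 * \<phi> z + \<alpha> \<noteq> 0"
    proof
      fix z :: complex assume "z \<in> ball 0 1"
      then have "\<phi> z \<noteq> \<alpha>" by (intro \<alpha>(2)) simp
      then show "- 1 * \<phi> z + \<alpha> \<noteq> 0" by simp
    qed
    show "gamma_regular \<gamma> (\<psi> \<alpha> \<circ> \<phi> \<circ> \<eta>) 0" by (rule gr)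
  qed
  have \<eta>_in: "cmod (\<eta> z) < 1" if "0 < Im z" for z
    using cayley_to_disc(1)[OF \<tau>] that unfolding \<eta>_def[symmetric] by (metis (mono_tags, lifting) imageI mem_Collect_eq mem_ball_0)
  have Im_\<psi>: "Im (\<psi> \<alpha> w) = (1 - (cmod w)\<^sup>2) / (cmod (\<alpha> - w))\<^sup>2" if "cmod \<alpha> = 1" for \<alpha> w
    unfolding \<psi>_def by (rule cayley_to_half_plane(2)[OF that])
  from holomorphic_disc_dichotomy[OF hol img] show ?thesis
  proof (elim disjE exE conjE)
    fix \<alpha> assume \<alpha>: "cmod \<alpha> = 1" "\<forall>z. cmod z < 1 \<longrightarrow> \<phi> z = \<alpha>"
    show ?thesis
    proof (rule suffices)
      show "cmod (- \<alpha>) = 1" using \<alpha> by simp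
      show "\<phi> z \<noteq> - \<alpha>" if "cmod z < 1" for z using \<alpha> that by auto
      have "Im ((\<psi> (- \<alpha>) \<circ> \<phi> \<circ> \<eta>) z) = 0" if "0 < Im z" for z
        using \<alpha> \<eta>_in[OF that] by (simp add: Im_\<psi>)
      then have repr: "nevanlinna_representation (\<psi> (- \<alpha>) \<circ> \<phi> \<circ> \<eta>) 0 (null_measure borel)"
        by (rule nevanlinna_representation_zero)
      have "(\<integral>\<^sup>+t\<in>UNIV. 1 / ennreal (\<gamma> (1 * \<bar>t - 0\<bar>)) \<partial>nevanlinna_measure (\<psi> (- \<alpha>) \<circ> \<phi> \<circ> \<eta>)) = 0"
        using gauge_measurable[OF reg, of 1 0] by (subst nevanlinna_nn_integral[OF repr]) auto
      then show "gamma_regular \<gamma> (\<psi> (- \<alpha>) \<circ> \<phi> \<circ> \<eta>) 0"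
        unfolding gamma_regular_def by (intro exI[of _ 1] conjI exI[of _ UNIV]) auto
    qed
  next
    assume lt': "\<forall>z. cmod z < 1 \<longrightarrow> cmod (\<phi> z) < 1"
    then have lt: "\<And>z. cmod z < 1 \<Longrightarrow> cmod (\<phi> z) < 1" by blast
    define h where "h t = D * \<gamma> (C * \<bar>t\<bar>)" for t
    define Z where "Z = gauge_curve \<tau> h"
    have h_pos: "0 < h t" if "t \<noteq> 0" for t using that C D \<gamma>(2) by (simp add: h_def)
    have h_nonneg: "0 \<le> h t" for t using C D \<gamma>(1) by (simp add: h_def)
    have Z_in: "cmod (Z t) < 1" if "t \<noteq> 0" for t using h_pos[OF that] norm_gauge_curve[OF \<tau>] by (simp add: Z_def)
    obtain B0 where "Limsup (at 0) (\<lambda>t. ereal (julia_quotient \<phi> (Z t))) < ereal B0"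
      using lim ereal_dense2 unfolding Z_def h_def[abs_def] by blast
    then have "\<forall>\<^sub>F t in at 0. ereal (julia_quotient \<phi> (Z t)) < ereal B0" by (rule Limsup_lessD)
    then have ev1: "\<forall>\<^sub>F t in at 0. julia_quotient \<phi> (Z t) < B0" by simp
    define B where "B = max 0 B0"
    have B: "0 \<le> B" by (simp add: B_def)
    have ev2: "\<forall>\<^sub>F t in at 0. cmod (Z t - \<tau>) < 1 / (8 * (B + 1))"
      unfolding Z_def h_def[abs_def] using B by (intro gauge_curve_tendsto[OF reg C D \<tau>]) simp
    obtain e where e: "0 < e" and ev: "\<And>t. t \<noteq> 0 \<Longrightarrow> \<bar>t\<bar> < e \<Longrightarrow>
        julia_quotient \<phi> (Z t) < B0 \<and> cmod (Z t - \<tau>) < 1 / (8 * (B + 1))"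
      using eventually_conj[OF ev1 ev2] unfolding eventually_at dist_real_def by (metis UNIV_I diff_zero)
    have eB: "julia_quotient \<phi> (Z t) \<le> B" if "t \<noteq> 0" "\<bar>t\<bar> < e" for t
      using ev[OF that] max.cobounded2[of B0 0] by (simp only: B_def max.commute) linarith
    have e\<tau>: "cmod (Z t - \<tau>) < 1 / (8 * (B + 1))" if "t \<noteq> 0" "\<bar>t\<bar> < e" for t
      using ev[OF that] by blast
    define w where "w = \<phi> (Z (e / 2))"
    define \<alpha> where "\<alpha> = (if w = 0 then 1 else - w / of_real (cmod w))"
    have \<alpha>: "cmod \<alpha> = 1" by (simp add: \<alpha>_def norm_divide)
    have \<alpha>w: "1 \<le> cmod (\<alpha> - w)"
    proof (cases "w = 0")
      case False
      then have "\<alpha> - w = - w * of_real (1 / cmod w + 1)" by (simp add: \<alpha>_def algebra_simps)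
      then have "cmod (\<alpha> - w) = cmod w * \<bar>1 / cmod w + 1\<bar>" by (simp only: norm_mult norm_minus_cancel norm_of_real)
      also have "\<dots> = 1 + cmod w" using False by (simp add: abs_of_nonneg algebra_simps)
      finally show ?thesis by simp
    qed (simp add: \<alpha>_def)
    have away: "1 / 2 \<le> cmod (\<alpha> - \<phi> (Z t))" if t: "t \<noteq> 0" "\<bar>t\<bar> < e" for t
    proof -
      have "cmod (\<phi> (Z t) - w) \<le> 2 * B * (cmod (Z t - \<tau>) + cmod (Z (e / 2) - \<tau>))"
        unfolding w_def using e t eB Z_in by (intro julia_quotient_bounded_imp_close[OF hol lt _ _ _ _ \<tau> B]) auto
      also have "\<dots> \<le> 2 * B * (1 / (8 * (B + 1)) + 1 / (8 * (B + 1)))"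
        using e\<tau>[OF t] e\<tau>[of "e / 2"] e B by (intro mult_left_mono add_mono) auto
      also have "\<dots> \<le> 1 / 2" using B by (simp add: field_simps)
      finally have "cmod (\<phi> (Z t) - w) \<le> 1 / 2" .
      moreover have "cmod (\<alpha> - w) \<le> cmod (\<alpha> - \<phi> (Z t)) + cmod (\<phi> (Z t) - w)"
        using norm_triangle_ineq[of "\<alpha> - \<phi> (Z t)" "\<phi> (Z t) - w"] by simp
      ultimately show ?thesis using \<alpha>w by linarith
    qed
    define f where "f = \<psi> \<alpha> \<circ> \<phi> \<circ> \<eta>"
    have hol_\<eta>: "\<eta> holomorphic_on {z. 0 < Im z}"
      unfolding \<eta>_def moebius_def by (intro holomorphic_intros) (auto simp: complex_eq_iff)
    have ne: "- 1 * u + \<alpha> \<noteq> 0" if "cmod u < 1" for u using that \<alpha> by (auto simp: add_eq_0_iff)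
    have hol_\<psi>: "\<psi> \<alpha> holomorphic_on ball 0 1"
      unfolding \<psi>_def moebius_def using ne by (intro holomorphic_intros) auto
    have "\<psi> \<alpha> \<circ> \<phi> holomorphic_on ball 0 1"
      using lt by (intro holomorphic_on_compose_gen[OF hol hol_\<psi>]) auto
    then have "f holomorphic_on {z. 0 < Im z}"
      unfolding f_def using \<eta>_in by (intro holomorphic_on_compose_gen[OF hol_\<eta>, of "\<psi> \<alpha> \<circ> \<phi>" "ball 0 1"]) auto
    moreover have "0 < Im (f z)" if "0 < Im z" for z
    proof -
      have "cmod (\<phi> (\<eta> z)) < 1" using lt \<eta>_in[OF that] by blast
      moreover from this have "\<alpha> \<noteq> \<phi> (\<eta> z)" using \<alpha> by auto
      ultimately show ?thesis
        by (auto simp: f_def Im_\<psi>[OF \<alpha>] abs_square_less_1 intro!: divide_pos_pos)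
    qed
    ultimately obtain \<beta> \<rho> where repr: "nevanlinna_representation f \<beta> \<rho>" using herglotz_half_plane by blast
    define \<zeta> where "\<zeta> t = \<i> * (\<tau> - Z t) / (\<tau> + Z t)" for t
    have \<zeta>: "0 < Im (\<zeta> t)" "\<eta> (\<zeta> t) = Z t" "1 - cmod (Z t) \<le> 4 * Im (\<zeta> t)" if "t \<noteq> 0" for t
      using cayley_to_disc(2)[OF \<tau> Z_in[OF that]] unfolding \<zeta>_def \<eta>_def by blast+
    have near: "1 \<le> cmod (\<tau> + Z t)" if t: "t \<noteq> 0" "\<bar>t\<bar> < e" for t
    proof -
      have "1 / (8 * (B + 1)) \<le> 1" using B by (simp add: field_simps)
      then have "cmod (Z t - \<tau>) \<le> 1" using e\<tau>[OF t] by linarith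
      moreover have "cmod (2 * \<tau>) \<le> cmod (\<tau> + Z t) + cmod (Z t - \<tau>)"
        using norm_triangle_ineq4[of "\<tau> + Z t" "Z t - \<tau>"] by simp
      ultimately show ?thesis using \<tau> by (simp add: norm_mult)
    qed
    have "gamma_regular \<gamma> f 0"
    proof (rule bounded_on_curve_imp_regular[OF repr reg C D e, where K = 2 and \<zeta> = \<zeta> and N = "32 * B"])
      fix t :: real assume "0 < \<bar>t\<bar>" and te: "\<bar>t\<bar> < e"
      then have t: "t \<noteq> 0" by simp
      have "1 - cmod (\<phi> (Z t)) \<le> B * (1 - cmod (Z t))"
        using eB[OF t te] Z_in[OF t] by (simp add: julia_quotient_def divide_le_eq)
      also have "\<dots> \<le> B * (4 * Im (\<zeta> t))" using \<zeta>(3)[OF t] B by (rule mult_left_mono)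
      finally have b: "1 - cmod (\<phi> (Z t)) \<le> 4 * B * Im (\<zeta> t)" by simp
      have "0 \<le> (1 - cmod (\<phi> (Z t)))\<^sup>2" by simp
      then have "1 - (cmod (\<phi> (Z t)))\<^sup>2 \<le> 2 * (1 - cmod (\<phi> (Z t)))" by (simp add: power2_eq_square algebra_simps)
      also have "\<dots> \<le> 2 * (4 * B * Im (\<zeta> t))" using b by (rule mult_left_mono) simp
      finally have num: "1 - (cmod (\<phi> (Z t)))\<^sup>2 \<le> 8 * B * Im (\<zeta> t)" by simp
      have "(1 / 2)\<^sup>2 \<le> (cmod (\<alpha> - \<phi> (Z t)))\<^sup>2" using away[OF t te] by (intro power_mono) auto
      moreover have "0 \<le> 8 * B * Im (\<zeta> t)" using B \<zeta>(1)[OF t] by simp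
      ultimately have "Im (f (\<zeta> t)) \<le> (8 * B * Im (\<zeta> t)) / (1 / 2)\<^sup>2"
        unfolding f_def o_def \<zeta>(2)[OF t] Im_\<psi>[OF \<alpha>] using num by (intro frac_le) auto
      then show "0 < Im (\<zeta> t) \<and> Im (f (\<zeta> t)) \<le> 32 * B * Im (\<zeta> t)"
        using \<zeta>(1)[OF t] by (simp add: power2_eq_square)
    next
      fix s t :: real assume s: "\<bar>s\<bar> \<le> 1" and "0 < \<bar>t\<bar>" and te: "\<bar>t\<bar> < e"
      then have t: "t \<noteq> 0" by simp
      define \<omega> where "\<omega> = \<tau> * cis (2 * arctan s)"
      have is0: "\<i> + of_real s \<noteq> 0" by (auto simp: complex_eq_iff)
      have \<omega>: "\<omega> = \<tau> * ((\<i> - of_real s) / (\<i> + of_real s))" by (simp add: \<omega>_def cis_two_arctan)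
      have nz: "\<tau> + Z t \<noteq> 0" using near[OF t te] by auto
      have d1: "(of_real s - \<zeta> t) * (\<tau> + Z t) = (\<i> + of_real s) * (Z t - \<omega>)"
      proof -
        have "\<zeta> t * (\<tau> + Z t) = \<i> * (\<tau> - Z t)" using nz by (simp add: \<zeta>_def)
        moreover have "(\<i> + of_real s) * \<omega> = \<tau> * (\<i> - of_real s)" using is0 by (simp add: \<omega>)
        ultimately show ?thesis by (simp add: left_diff_distrib right_diff_distrib) (simp add: algebra_simps)
      qed
      have "cmod (of_real s - \<zeta> t) * 1 \<le> cmod (of_real s - \<zeta> t) * cmod (\<tau> + Z t)"
        using near[OF t te] by (intro mult_left_mono) auto
      also have "\<dots> = cmod (\<i> + of_real s) * cmod (Z t - \<omega>)" using d1 by (metis norm_mult)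
      also have "\<dots> \<le> 2 * (\<bar>2 * arctan s - t\<bar> + h t)"
      proof (intro mult_mono)
        show "cmod (\<i> + of_real s) \<le> 2" using norm_triangle_ineq[of \<i> "of_real s"] s by simp
        show "cmod (Z t - \<omega>) \<le> \<bar>2 * arctan s - t\<bar> + h t"
          unfolding Z_def \<omega>_def by (rule gauge_curve_dist[where h = h, OF \<tau> h_nonneg])
      qed auto
      finally show "cmod (of_real s - \<zeta> t) \<le> 2 * (\<bar>2 * arctan s - t\<bar> + D * \<gamma> (C * \<bar>t\<bar>))" by (simp add: h_def)
    qed simp
    moreover have "\<phi> z \<noteq> \<alpha>" if "cmod z < 1" for z using lt[OF that] \<alpha> by auto
    ultimately show ?thesis using suffices[OF \<alpha>] unfolding f_def by blast
  qed
qed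

theorem corollary2p4:
  fixes \<tau> :: complex and \<gamma> :: "real \<Rightarrow> real" and \<phi> :: "complex \<Rightarrow> complex"
  assumes "norm \<tau> = 1"
    and "regularity_gauge \<gamma>"
    and "gamma_augury \<gamma> (\<lambda>t. sqrt (\<gamma> t))"
    and "\<phi> holomorphic_on ball 0 1" and "\<phi> ` ball 0 1 \<subseteq> cball 0 1"
  shows "(transform_gamma_regular \<gamma> \<phi> \<tau> \<longleftrightarrow>
           (\<exists>C>0. \<exists>D>0. \<exists>U. open U \<and> \<tau> \<in> U \<and>
              bounded (julia_quotient \<phi> ` (stolz_region (\<lambda>t. sqrt (D * \<gamma> (C * t))) \<tau> \<inter> U)))) \<and>
         (transform_gamma_regular \<gamma> \<phi> \<tau> \<longleftrightarrow>
           (\<exists>C>0. \<exists>D>0.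
              Limsup (at (0::real)) (\<lambda>t. ereal (julia_quotient \<phi>
                (\<tau> * exp (- complex_of_real (D * \<gamma> (C * \<bar>t\<bar>)) + \<i> * complex_of_real t)))) < \<infinity>))"
    (is "(?A \<longleftrightarrow> ?B) \<and> (?A \<longleftrightarrow> ?C)")
proof -
  have AB: ?B if ?A
    using transform_regular_imp_bounded_on_stolz[OF assms(2,1,4,5) that] .
  have BC: ?C if ?B
    using that bounded_on_stolz_imp_bounded_on_curve[OF assms(2,3,1)] unfolding gauge_curve_def by blast
  have CA: ?A if ?C
    using that bounded_on_curve_imp_transform_regular[OF assms(2,1,4,5)] unfolding gauge_curve_def by blast
  show ?thesis using AB BC CA by blast
qed

end
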